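(* Let $\Gamma$ be a countable discrete group and let $A\subseteq\Gamma$ be a non-empty subset that is a finite union of sparse subsets of $\Gamma$. Then $\mathscr{I}_A/\mathscr{K}$ is type $I_0$. In particular, $\mathscr{I}_A$ is type I.
   Context: $\Gamma$ is equipped with a proper right-invariant metric $d$ (unique up to coarse equivalence). The uniform Roe algebra is $C_u^*(\Gamma)=\ell^\infty(\Gamma)\rtimes_r\Gamma\cong C(\beta\Gamma)\rtimes_r\Gamma$ for the left translation action, where $\beta\Gamma$ is the Stone–Čech compactification; it is faithfully represented on $\ell^2(\Gamma)$. For $A\subseteq\Gamma$, let $K_A\subseteq\beta\Gamma$ be the closure of $A$ (a clopen set) and $X_A=\bigcup_{g\in\Gamma}gK_A$; then $\mathscr{I}_A:=C_0(X_A)\rtimes_r\Gamma$ is the ideal of $C_u^*(\Gamma)$ generated by the projection $1_A$. $\mathscr{K}$ denotes the ideal of $C_u^*(\Gamma)$ that is $\mathscr{K}(\ell^2(\Gamma))$, the compact operators, in the standard representation on $\ell^2(\Gamma)$; it is the smallest non-zero ideal of $C_u^*(\Gamma)$, so it is contained in $\mathscr{I}_A$ for $A\neq\emptyset$. A metric space $(X,d)$ is sparse if, for some (equivalently any) base point $x_0\in X$, the function $s(r)=\inf\{d(x,y):x,y\in X\setminus B_X(x_0,r),\ x\neq y\}$ (with $\inf\emptyset=+\infty$) satisfies $\lim_{r\to\infty}s(r)=\infty$, where $B_X(x_0,r)$ is the open ball. Subsets of $\Gamma$ carry the inherited metric. An element $x$ of a C*-algebra $\mathscr{B}$ is abelian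 if the hereditary C*-subalgebra $\overline{x^*\mathscr{B}x}$ is commutative. A C*-algebra is type $I_0$ if it is generated as a C*-algebra by abelian elements. It is type I if the image of each of its irreducible representations contains the compact operators (equivalently, each of its non-zero quotients contains a non-zero abelian element). *)

theory Defs
  imports "HOL-Analysis.Analysis"
begin

section \<open>Complex Hilbert spaces and operators\<close>

text \<open>The inner product is linear in the second argument; \<^term>\<open>inner\<close> is its real part.\<close>

class complex_hilbert_space = real_inner + banach +
  fixes scaleC :: "complex \<Rightarrow> 'a \<Rightarrow> 'a" (infixr \<open>*\<^sub>C\<close> 75)
    and cinner :: "'a \<Rightarrow> 'a \<Rightarrow> complex"
  assumes scaleC_add_right: "c *\<^sub>C (x + y) = c *\<^sub>C x + c *\<^sub>C y"
    and scaleC_add_left: "(c + e) *\<^sub>C x = c *\<^sub>C x + e *\<^sub>C x"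
    and scaleC_scaleC: "c *\<^sub>C (e *\<^sub>C x) = (c * e) *\<^sub>C x"
    and scaleC_of_real: "complex_of_real r *\<^sub>C x = r *\<^sub>R x"
    and cinner_commute: "cinner x y = cnj (cinner y x)"
    and cinner_add_right: "cinner x (y + z) = cinner x y + cinner x z"
    and cinner_scaleC_right: "cinner x (c *\<^sub>C y) = c * cinner x y"
    and Re_cinner: "Re (cinner x y) = inner x y"

lemma inner_scaleC_scaleC:
  fixes x :: "'h::complex_hilbert_space"
  shows "inner (c *\<^sub>C x) (c *\<^sub>C x) = (cmod c)\<^sup>2 * inner x x"
proof -
  have "cinner (c *\<^sub>C x) (c *\<^sub>C x) = c * cnj (cinner x (c *\<^sub>C x))"
    by (metis cinner_commute cinner_scaleC_right)
  also have "\<dots> = (c * cnj c) * cnj (cinner x x)"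
    by (simp add: cinner_scaleC_right mult.assoc)
  finally have "cinner (c *\<^sub>C x) (c *\<^sub>C x) = of_real ((cmod c)\<^sup>2) * cnj (cinner x x)"
    by (simp only: complex_norm_square)
  then have "Re (cinner (c *\<^sub>C x) (c *\<^sub>C x)) = (cmod c)\<^sup>2 * Re (cinner x x)"
    by simp
  then show ?thesis
    by (simp add: Re_cinner)
qed

lemma norm_scaleC:
  fixes x :: "'h::complex_hilbert_space"
  shows "norm (c *\<^sub>C x) = cmod c * norm x"
  by (simp add: norm_eq_sqrt_inner inner_scaleC_scaleC real_sqrt_mult)

lemma bounded_linear_scaleC: "bounded_linear (\<lambda>x::'h::complex_hilbert_space. c *\<^sub>C x)"
proof (rule bounded_linear_intro)
  fix x y :: 'h and r :: real
  show "c *\<^sub>C (x + y) = c *\<^sub>C x + c *\<^sub>C y" by (rule scaleC_add_right)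
  show "c *\<^sub>C (r *\<^sub>R x) = r *\<^sub>R (c *\<^sub>C x)"
    by (simp add: scaleC_of_real[symmetric] scaleC_scaleC mult.commute)
  show "norm (c *\<^sub>C x) \<le> norm x * cmod c" by (simp add: norm_scaleC mult.commute)
qed

definition is_clinear :: "('h::complex_hilbert_space \<Rightarrow>\<^sub>L 'h) \<Rightarrow> bool" where
  "is_clinear T \<longleftrightarrow> (\<forall>c x. T (c *\<^sub>C x) = c *\<^sub>C T x)"

definition scaleC_op :: "complex \<Rightarrow> ('h::complex_hilbert_space \<Rightarrow>\<^sub>L 'h) \<Rightarrow> ('h \<Rightarrow>\<^sub>L 'h)" where
  "scaleC_op c T = Blinfun (\<lambda>x. c *\<^sub>C T x)"

lemma scaleC_op_apply: "blinfun_apply (scaleC_op c T) x = c *\<^sub>C T x"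
  unfolding scaleC_op_def
  by (subst bounded_linear_Blinfun_apply)
     (auto intro: bounded_linear_compose[OF bounded_linear_scaleC blinfun.bounded_linear_right])

definition is_adjoint :: "('h::complex_hilbert_space \<Rightarrow>\<^sub>L 'h) \<Rightarrow> ('h \<Rightarrow>\<^sub>L 'h) \<Rightarrow> bool" where
  "is_adjoint S T \<longleftrightarrow> (\<forall>x y. cinner (S x) y = cinner x (T y))"

definition adj :: "('h::complex_hilbert_space \<Rightarrow>\<^sub>L 'h) \<Rightarrow> ('h \<Rightarrow>\<^sub>L 'h)" where
  "adj T = (THE S. is_adjoint S T)"

lemma is_adjoint_unique:
  assumes "is_adjoint S T" "is_adjoint S' T"
  shows "S = S'"
proof (rule blinfun_eqI)
  fix x
  have "cinner (S x) y = cinner (S' x) y" for y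
    using assms by (simp add: is_adjoint_def)
  then have "inner (S x) y = inner (S' x) y" for y
    by (metis Re_cinner)
  then have "inner (S x - S' x) (S x - S' x) = 0"
    by (simp add: inner_diff_left)
  then show "S x = S' x" by simp
qed

lemma adj_eqI: "is_adjoint S T \<Longrightarrow> adj T = S"
  unfolding adj_def by (blast intro: the_equality is_adjoint_unique)

definition compact_operators :: "('h::complex_hilbert_space \<Rightarrow>\<^sub>L 'h) set" where
  "compact_operators = {T. is_clinear T \<and> compact (closure (blinfun_apply T ` cball 0 1))}"


section \<open>C*-algebras\<close>

text \<open>
  The record only carries the operations of a (not necessarily unital) C*-algebra, so that the same
  definitions apply to algebras of operators and to quotients, whose elements are cosets.
\<close>

record 'a cstar =
  csa_carrier :: "'a set"
  csa_zero :: 'a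
  csa_add :: "'a \<Rightarrow> 'a \<Rightarrow> 'a"
  csa_scale :: "complex \<Rightarrow> 'a \<Rightarrow> 'a"
  csa_mult :: "'a \<Rightarrow> 'a \<Rightarrow> 'a"
  csa_star :: "'a \<Rightarrow> 'a"
  csa_norm :: "'a \<Rightarrow> real"

definition bounded_operators :: "('h::complex_hilbert_space \<Rightarrow>\<^sub>L 'h) cstar" where
  "bounded_operators =
     \<lparr>csa_carrier = {T. is_clinear T}, csa_zero = 0, csa_add = (+), csa_scale = scaleC_op,
      csa_mult = (o\<^sub>L), csa_star = adj, csa_norm = norm\<rparr>"

definition csa_closure :: "'a cstar \<Rightarrow> 'a set \<Rightarrow> 'a set" where
  "csa_closure B S = {x \<in> csa_carrier B.
     \<forall>e>0. \<exists>y\<in>S. csa_norm B (csa_add B x (csa_scale B (-1) y)) < e}"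

definition cstar_subalgebra :: "'a cstar \<Rightarrow> 'a set \<Rightarrow> bool" where
  "cstar_subalgebra B S \<longleftrightarrow>
     S \<subseteq> csa_carrier B \<and> csa_zero B \<in> S \<and>
     (\<forall>x\<in>S. \<forall>y\<in>S. csa_add B x y \<in> S) \<and> (\<forall>c. \<forall>x\<in>S. csa_scale B c x \<in> S) \<and>
     (\<forall>x\<in>S. \<forall>y\<in>S. csa_mult B x y \<in> S) \<and> (\<forall>x\<in>S. csa_star B x \<in> S) \<and>
     csa_closure B S \<subseteq> S"

definition cstar_generated :: "'a cstar \<Rightarrow> 'a set \<Rightarrow> 'a set" where
  "cstar_generated B S = \<Inter>{T. cstar_subalgebra B T \<and> S \<subseteq> T}"

definition closed_ideal :: "'a cstar \<Rightarrow> 'a set \<Rightarrow> bool" where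
  "closed_ideal B J \<longleftrightarrow>
     J \<subseteq> csa_carrier B \<and> csa_zero B \<in> J \<and>
     (\<forall>x\<in>J. \<forall>y\<in>J. csa_add B x y \<in> J) \<and> (\<forall>c. \<forall>x\<in>J. csa_scale B c x \<in> J) \<and>
     (\<forall>x\<in>J. \<forall>b\<in>csa_carrier B. csa_mult B b x \<in> J \<and> csa_mult B x b \<in> J) \<and>
     csa_closure B J \<subseteq> J"

definition ideal_generated :: "'a cstar \<Rightarrow> 'a set \<Rightarrow> 'a set" where
  "ideal_generated B S = \<Inter>{J. closed_ideal B J \<and> S \<subseteq> J}"

definition csa_coset :: "'a cstar \<Rightarrow> 'a set \<Rightarrow> 'a \<Rightarrow> 'a set" where
  "csa_coset B J x = csa_add B x ` J"

definition csa_quotient :: "'a cstar \<Rightarrow> 'a set \<Rightarrow> 'a set cstar" where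
  "csa_quotient B J =
     \<lparr>csa_carrier = csa_coset B J ` csa_carrier B,
      csa_zero = J,
      csa_add = (\<lambda>X Y. \<Union>x\<in>X. \<Union>y\<in>Y. csa_coset B J (csa_add B x y)),
      csa_scale = (\<lambda>c X. \<Union>x\<in>X. csa_coset B J (csa_scale B c x)),
      csa_mult = (\<lambda>X Y. \<Union>x\<in>X. \<Union>y\<in>Y. csa_coset B J (csa_mult B x y)),
      csa_star = (\<lambda>X. \<Union>x\<in>X. csa_coset B J (csa_star B x)),
      csa_norm = (\<lambda>X. Inf (csa_norm B ` X))\<rparr>"

definition hereditary_of :: "'a cstar \<Rightarrow> 'a \<Rightarrow> 'a set" where
  "hereditary_of B x =
     csa_closure B ((\<lambda>b. csa_mult B (csa_mult B (csa_star B x) b) x) ` csa_carrier B)"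

definition abelian_element :: "'a cstar \<Rightarrow> 'a \<Rightarrow> bool" where
  "abelian_element B x \<longleftrightarrow> x \<in> csa_carrier B \<and>
     (\<forall>u\<in>hereditary_of B x. \<forall>v\<in>hereditary_of B x. csa_mult B u v = csa_mult B v u)"

definition type_I0 :: "'a cstar \<Rightarrow> bool" where
  "type_I0 B \<longleftrightarrow> cstar_generated B {x. abelian_element B x} = csa_carrier B"

definition representation :: "'a cstar \<Rightarrow> ('a \<Rightarrow> ('h::complex_hilbert_space \<Rightarrow>\<^sub>L 'h)) \<Rightarrow> bool" where
  "representation B \<pi> \<longleftrightarrow>
     (\<forall>a\<in>csa_carrier B. is_clinear (\<pi> a)) \<and>
     (\<forall>a\<in>csa_carrier B. \<forall>b\<in>csa_carrier B. \<pi> (csa_add B a b) = \<pi> a + \<pi> b) \<and>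
     (\<forall>c. \<forall>a\<in>csa_carrier B. \<pi> (csa_scale B c a) = scaleC_op c (\<pi> a)) \<and>
     (\<forall>a\<in>csa_carrier B. \<forall>b\<in>csa_carrier B. \<pi> (csa_mult B a b) = \<pi> a o\<^sub>L \<pi> b) \<and>
     (\<forall>a\<in>csa_carrier B. is_adjoint (\<pi> (csa_star B a)) (\<pi> a))"

definition closed_csubspace :: "'h::complex_hilbert_space set \<Rightarrow> bool" where
  "closed_csubspace V \<longleftrightarrow> closed V \<and> 0 \<in> V \<and>
     (\<forall>x\<in>V. \<forall>y\<in>V. x + y \<in> V) \<and> (\<forall>c. \<forall>x\<in>V. c *\<^sub>C x \<in> V)"

text \<open>The zero representation on a one-dimensional space is not counted as irreducible.\<close>

definition irreducible_representation ::
    "'a cstar \<Rightarrow> ('a \<Rightarrow> ('h::complex_hilbert_space \<Rightarrow>\<^sub>L 'h)) \<Rightarrow> bool" where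
  "irreducible_representation B \<pi> \<longleftrightarrow> representation B \<pi> \<and> (\<exists>a\<in>csa_carrier B. \<pi> a \<noteq> 0) \<and>
     (\<forall>V. closed_csubspace V \<and> (\<forall>a\<in>csa_carrier B. \<forall>v\<in>V. \<pi> a v \<in> V) \<longrightarrow> V = {0} \<or> V = UNIV)"

text \<open>
  HOL cannot quantify over all Hilbert spaces inside a formula, so the type of the representation
  space is a parameter. A theorem stating \<open>type_I TYPE('h) B\<close> for a type variable \<open>'h\<close>
  covers representations on every Hilbert space.
\<close>

definition type_I :: "'h::complex_hilbert_space itself \<Rightarrow> 'a cstar \<Rightarrow> bool" where
  "type_I _ B \<longleftrightarrow> (\<forall>\<pi> :: 'a \<Rightarrow> ('h \<Rightarrow>\<^sub>L 'h). irreducible_representation B \<pi> \<longrightarrow>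
     compact_operators \<subseteq> \<pi> ` csa_carrier B)"


section \<open>The Hilbert space of square-summable functions\<close>

typedef 'g ell2 = "{f :: 'g \<Rightarrow> complex. (\<lambda>x. (cmod (f x))\<^sup>2) summable_on UNIV}"
  morphisms ell2_fun Abs_ell2
  by (rule exI[of _ "\<lambda>_. 0"]) simp

setup_lifting type_definition_ell2

lemma ell2_fun_summable: "(\<lambda>x. (cmod (ell2_fun u x))\<^sup>2) summable_on UNIV"
  using ell2_fun[of u] by simp

lemma sq_summable_comparison:
  fixes f :: "'g \<Rightarrow> complex" and h :: "'g \<Rightarrow> real"
  assumes "h summable_on UNIV" "\<And>x. (cmod (f x))\<^sup>2 \<le> h x"
  shows "(\<lambda>x. (cmod (f x))\<^sup>2) summable_on UNIV"
proof -
  have nn: "0 \<le> h x" for x using assms(2)[of x] by (meson order_trans zero_le_power2)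
  have "(\<lambda>x. norm (h x)) summable_on UNIV" using assms(1) nn by (simp add: abs_of_nonneg)
  then have "(\<lambda>x. norm ((cmod (f x))\<^sup>2)) summable_on UNIV"
    by (rule Infinite_Sum.abs_summable_on_comparison_test) (use assms(2) nn in simp)
  then show ?thesis by simp
qed

lemma sq_summable_add:
  fixes f g :: "'g \<Rightarrow> complex"
  assumes "(\<lambda>x. (cmod (f x))\<^sup>2) summable_on UNIV" "(\<lambda>x. (cmod (g x))\<^sup>2) summable_on UNIV"
  shows "(\<lambda>x. (cmod (f x + g x))\<^sup>2) summable_on UNIV"
proof (rule sq_summable_comparison)
  show "(\<lambda>x. 2 * (cmod (f x))\<^sup>2 + 2 * (cmod (g x))\<^sup>2) summable_on UNIV"
    by (intro summable_on_add summable_on_cmult_right assms)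
  fix x
  have "(cmod (f x + g x))\<^sup>2 \<le> (cmod (f x) + cmod (g x))\<^sup>2"
    by (intro power_mono norm_triangle_ineq) simp
  also have "\<dots> \<le> 2 * (cmod (f x))\<^sup>2 + 2 * (cmod (g x))\<^sup>2"
    using sum_squares_ge_zero[of "cmod (f x) - cmod (g x)" 0] by (simp add: power2_eq_square algebra_simps)
  finally show "(cmod (f x + g x))\<^sup>2 \<le> 2 * (cmod (f x))\<^sup>2 + 2 * (cmod (g x))\<^sup>2" .
qed

lemma sq_summable_mult:
  fixes f m :: "'g \<Rightarrow> complex"
  assumes "(\<lambda>x. (cmod (f x))\<^sup>2) summable_on UNIV" "\<And>x. cmod (m x) \<le> K"
  shows "(\<lambda>x. (cmod (m x * f x))\<^sup>2) summable_on UNIV"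
proof (rule sq_summable_comparison)
  show "(\<lambda>x. K\<^sup>2 * (cmod (f x))\<^sup>2) summable_on UNIV"
    by (intro summable_on_cmult_right assms)
  show "(cmod (m x * f x))\<^sup>2 \<le> K\<^sup>2 * (cmod (f x))\<^sup>2" for x
    using assms(2)[of x] by (simp add: norm_mult power_mult_distrib mult_right_mono power_mono)
qed

lemma ell2_abs_summable:
  "(\<lambda>x. cmod (cnj (ell2_fun u x) * ell2_fun v x)) summable_on UNIV"
proof -
  have "(\<lambda>x. (cmod (ell2_fun u x))\<^sup>2 + (cmod (ell2_fun v x))\<^sup>2) summable_on UNIV"
    by (intro summable_on_add ell2_fun_summable)
  then have "(\<lambda>x. norm ((cmod (ell2_fun u x))\<^sup>2 + (cmod (ell2_fun v x))\<^sup>2)) summable_on UNIV"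
    by simp
  then show ?thesis
  proof (rule Infinite_Sum.abs_summable_on_comparison_test)
    fix x
    have "0 \<le> (cmod (ell2_fun u x) - cmod (ell2_fun v x))\<^sup>2" by simp
    moreover have "0 \<le> cmod (ell2_fun u x) * cmod (ell2_fun v x)" by simp
    ultimately show "norm (cnj (ell2_fun u x) * ell2_fun v x)
        \<le> norm ((cmod (ell2_fun u x))\<^sup>2 + (cmod (ell2_fun v x))\<^sup>2)"
      unfolding norm_mult complex_mod_cnj real_norm_def power2_diff by linarith
  qed
qed

lemma ell2_summable: "(\<lambda>x. cnj (ell2_fun u x) * ell2_fun v x) summable_on UNIV"
  by (rule Infinite_Sum.abs_summable_summable[OF ell2_abs_summable])

lemma ell2_sum_add: "(\<Sum>\<^sub>\<infinity>x. cnj (ell2_fun u x) * (ell2_fun v x + ell2_fun w x)) =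
    (\<Sum>\<^sub>\<infinity>x. cnj (ell2_fun u x) * ell2_fun v x) + (\<Sum>\<^sub>\<infinity>x. cnj (ell2_fun u x) * ell2_fun w x)"
  unfolding distrib_left by (intro infsum_add ell2_summable)

lemma ell2_sum_commute: "(\<Sum>\<^sub>\<infinity>x. cnj (ell2_fun u x) * ell2_fun v x) =
    cnj (\<Sum>\<^sub>\<infinity>x. cnj (ell2_fun v x) * ell2_fun u x)"
  by (simp add: infsum_cnj[symmetric] mult.commute)

lemma ell2_sum_scale: "(\<Sum>\<^sub>\<infinity>x. cnj (ell2_fun u x) * (c * ell2_fun v x)) =
    c * (\<Sum>\<^sub>\<infinity>x. cnj (ell2_fun u x) * ell2_fun v x)"
  by (simp add: infsum_cmult_right'[symmetric] mult.left_commute)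

instantiation ell2 :: (type) real_inner
begin

lift_definition zero_ell2 :: "'a ell2" is "\<lambda>_. 0" by simp
lift_definition plus_ell2 :: "'a ell2 \<Rightarrow> 'a ell2 \<Rightarrow> 'a ell2" is "\<lambda>f g x. f x + g x"
  by (simp add: sq_summable_add)
lift_definition uminus_ell2 :: "'a ell2 \<Rightarrow> 'a ell2" is "\<lambda>f x. - f x" by simp
lift_definition minus_ell2 :: "'a ell2 \<Rightarrow> 'a ell2 \<Rightarrow> 'a ell2" is "\<lambda>f g x. f x - g x"
  using sq_summable_add[where g = "\<lambda>x. - _ x"] by simp
lift_definition scaleR_ell2 :: "real \<Rightarrow> 'a ell2 \<Rightarrow> 'a ell2" is "\<lambda>r f x. complex_of_real r * f x"
  by (rule sq_summable_mult) auto
definition "inner_ell2 u v = Re (\<Sum>\<^sub>\<infinity>x::'a. cnj (ell2_fun u x) * ell2_fun v x)"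
definition "norm_ell2 (u :: 'a ell2) = sqrt (inner u u)"
definition "dist_ell2 (u :: 'a ell2) v = norm (u - v)"
definition "sgn_ell2 (u :: 'a ell2) = inverse (norm u) *\<^sub>R u"
definition "(uniformity :: ('a ell2 \<times> 'a ell2) filter) = (INF e\<in>{0<..}. principal {(x, y). dist x y < e})"
definition "open_ell2 (U :: 'a ell2 set) \<longleftrightarrow> (\<forall>x\<in>U. eventually (\<lambda>(x', y). x' = x \<longrightarrow> y \<in> U) uniformity)"

lemma ell2_inner_self: "inner u (u :: 'a ell2) = (\<Sum>\<^sub>\<infinity>x. (cmod (ell2_fun u x))\<^sup>2)"
proof -
  have "inner u u = (\<Sum>\<^sub>\<infinity>x. Re (cnj (ell2_fun u x) * ell2_fun u x))"
    unfolding inner_ell2_def by (rule infsum_Re[symmetric]) (rule ell2_summable)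
  also have "\<dots> = (\<Sum>\<^sub>\<infinity>x. (cmod (ell2_fun u x))\<^sup>2)"
    by (rule infsum_cong) (simp only: complex_norm_square[symmetric] mult.commute Re_complex_of_real)
  finally show ?thesis .
qed

instance
proof
  fix u v w :: "'a ell2" and r s :: real
  show "u + v + w = u + (v + w)" by transfer (simp add: add.assoc)
  show "u + v = v + u" by transfer (simp add: add.commute)
  show "0 + u = u" by transfer simp
  show "- u + u = 0" by transfer simp
  show "u - v = u + - v" by transfer simp
  show "r *\<^sub>R (u + v) = r *\<^sub>R u + r *\<^sub>R v" by transfer (simp add: distrib_left)
  show "(r + s) *\<^sub>R u = r *\<^sub>R u + s *\<^sub>R u" by transfer (simp add: distrib_right)
  show "r *\<^sub>R s *\<^sub>R u = (r * s) *\<^sub>R u" by transfer (simp add: mult.assoc)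
  show "1 *\<^sub>R u = u" by transfer simp
  show "sgn u = inverse (norm u) *\<^sub>R u" by (rule sgn_ell2_def)
  show "dist u v = norm (u - v)" by (rule dist_ell2_def)
  show "uniformity = (INF e\<in>{0<..}. principal {(x, y :: 'a ell2). dist x y < e})"
    by (rule uniformity_ell2_def)
  show "open U \<longleftrightarrow> (\<forall>x\<in>U. eventually (\<lambda>(x', y). x' = x \<longrightarrow> y \<in> U) uniformity)" for U :: "'a ell2 set"
    by (rule open_ell2_def)
  show c: "inner a b = inner b a" for a b :: "'a ell2"
    unfolding inner_ell2_def by (subst ell2_sum_commute) simp
  show "inner (u + v) w = inner u w + inner v w"
    unfolding c[of _ w] by (simp add: inner_ell2_def plus_ell2.rep_eq ell2_sum_add)
  show "inner (r *\<^sub>R u) v = r * inner u v"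
    unfolding c[of _ v] by (simp add: inner_ell2_def scaleR_ell2.rep_eq ell2_sum_scale)
  show "0 \<le> inner u u" unfolding ell2_inner_self by (rule infsum_nonneg) simp
  show "inner u u = 0 \<longleftrightarrow> u = 0"
  proof
    assume "inner u u = 0"
    then have s0: "(\<Sum>\<^sub>\<infinity>x. (cmod (ell2_fun u x))\<^sup>2) = 0" by (simp add: ell2_inner_self)
    have "(cmod (ell2_fun u x))\<^sup>2 = 0" for x
      by (rule nonneg_infsum_le_0D[where A = UNIV]) (use s0 ell2_fun_summable in auto)
    then have "ell2_fun u = ell2_fun 0" by (auto simp: zero_ell2.rep_eq)
    then show "u = 0" by (simp add: ell2_fun_inject)
  next
    assume "u = 0"
    then show "inner u u = 0" by (simp add: ell2_inner_self zero_ell2.rep_eq)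
  qed
  show "norm u = sqrt (inner u u)" by (rule norm_ell2_def)
qed

end

lemma ell2_norm_sq: "(norm u)\<^sup>2 = (\<Sum>\<^sub>\<infinity>x. (cmod (ell2_fun u x))\<^sup>2)"
  by (simp add: power2_norm_eq_inner ell2_inner_self)

instantiation ell2 :: (type) complex_hilbert_space
begin

lift_definition scaleC_ell2 :: "complex \<Rightarrow> 'a ell2 \<Rightarrow> 'a ell2" is "\<lambda>c f x. c * f x"
  by (rule sq_summable_mult) auto
definition "cinner_ell2 u v = (\<Sum>\<^sub>\<infinity>x::'a. cnj (ell2_fun u x) * ell2_fun v x)"

instance
proof
  fix u v w :: "'a ell2" and r :: real and c e :: complex
  show "c *\<^sub>C (u + v) = c *\<^sub>C u + c *\<^sub>C v" by transfer (simp add: distrib_left)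
  show "(c + e) *\<^sub>C u = c *\<^sub>C u + e *\<^sub>C u" by transfer (simp add: distrib_right)
  show "c *\<^sub>C (e *\<^sub>C u) = (c * e) *\<^sub>C u" by transfer (simp add: mult.assoc)
  show "complex_of_real r *\<^sub>C u = r *\<^sub>R u" by transfer simp
  show "cinner u v = cnj (cinner v u)" unfolding cinner_ell2_def by (rule ell2_sum_commute)
  show "cinner u (v + w) = cinner u v + cinner u w"
    unfolding cinner_ell2_def plus_ell2.rep_eq by (rule ell2_sum_add)
  show "cinner u (c *\<^sub>C v) = c * cinner u v"
    unfolding cinner_ell2_def scaleC_ell2.rep_eq by (rule ell2_sum_scale)
  show "Re (cinner u v) = inner u v" by (simp add: cinner_ell2_def inner_ell2_def)
next
  fix X :: "nat \<Rightarrow> 'a ell2"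
  assume "Cauchy X"
  have fin: "(\<Sum>x\<in>F. (cmod (ell2_fun u x))\<^sup>2) \<le> (norm u)\<^sup>2" if "finite F" for F and u :: "'a ell2"
    unfolding ell2_norm_sq using that by (intro finite_sum_le_infsum ell2_fun_summable) auto
  have Cau: "\<exists>M. \<forall>m\<ge>M. \<forall>n\<ge>M. norm (X m - X n) < e" if "e > 0" for e
    using \<open>Cauchy X\<close> that by (rule CauchyD)
  have pt: "Cauchy (\<lambda>n. ell2_fun (X n) x)" for x
  proof (rule CauchyI)
    fix e :: real assume "e > 0"
    then obtain M where M: "\<forall>m\<ge>M. \<forall>n\<ge>M. norm (X m - X n) < e" using Cau by blast
    have "norm (ell2_fun (X m) x - ell2_fun (X n) x) < e" if "m \<ge> M" "n \<ge> M" for m n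
    proof -
      have "(cmod (ell2_fun (X m - X n) x))\<^sup>2 \<le> (norm (X m - X n))\<^sup>2"
        using fin[of "{x}" "X m - X n"] by simp
      then have "cmod (ell2_fun (X m - X n) x) \<le> norm (X m - X n)"
        using norm_ge_zero by (rule power2_le_imp_le)
      then show ?thesis using M that by (fastforce simp: minus_ell2.rep_eq)
    qed
    then show "\<exists>M. \<forall>m\<ge>M. \<forall>n\<ge>M. norm (ell2_fun (X m) x - ell2_fun (X n) x) < e" by blast
  qed
  define f where "f x = lim (\<lambda>n. ell2_fun (X n) x)" for x
  have f: "(\<lambda>n. ell2_fun (X n) x) \<longlonglongrightarrow> f x" for x
    using pt[of x] unfolding f_def by (simp add: Cauchy_convergent_iff convergent_LIMSEQ_iff)
  have est: "(\<Sum>x\<in>F. (cmod (ell2_fun (X n) x - f x))\<^sup>2) \<le> e\<^sup>2"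
    if "finite F" and M: "\<forall>m\<ge>M. \<forall>n\<ge>M. norm (X m - X n) < e" and "n \<ge> M" for F n M e
  proof (rule LIMSEQ_le_const2)
    show "(\<lambda>m. \<Sum>x\<in>F. (cmod (ell2_fun (X n) x - ell2_fun (X m) x))\<^sup>2)
        \<longlonglongrightarrow> (\<Sum>x\<in>F. (cmod (ell2_fun (X n) x - f x))\<^sup>2)"
      by (intro tendsto_intros f)
    show "\<exists>N. \<forall>m\<ge>N. (\<Sum>x\<in>F. (cmod (ell2_fun (X n) x - ell2_fun (X m) x))\<^sup>2) \<le> e\<^sup>2"
    proof (intro exI[of _ M] allI impI)
      fix m assume "m \<ge> M"
      have "(\<Sum>x\<in>F. (cmod (ell2_fun (X n) x - ell2_fun (X m) x))\<^sup>2) \<le> (norm (X n - X m))\<^sup>2"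
        using fin[OF \<open>finite F\<close>, of "X n - X m"] by (simp add: minus_ell2.rep_eq)
      also have "\<dots> \<le> e\<^sup>2"
        using M \<open>n \<ge> M\<close> \<open>m \<ge> M\<close> norm_ge_zero by (intro power_mono) (auto intro: less_imp_le)
      finally show "(\<Sum>x\<in>F. (cmod (ell2_fun (X n) x - ell2_fun (X m) x))\<^sup>2) \<le> e\<^sup>2" .
    qed
  qed
  have summ: "(\<lambda>x. (cmod (ell2_fun (X n) x - f x))\<^sup>2) summable_on UNIV"
    if "\<forall>m\<ge>M. \<forall>n\<ge>M. norm (X m - X n) < e" "n \<ge> M" for n M e
    using est[OF _ that]
    by (intro nonneg_bdd_above_summable_on) (auto simp: bdd_above_def)
  obtain M1 where M1: "\<forall>m\<ge>M1. \<forall>n\<ge>M1. norm (X m - X n) < 1" using Cau[of 1] by auto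
  have "(\<lambda>x. (cmod (f x))\<^sup>2) summable_on UNIV"
    using sq_summable_add[OF summ[OF M1 order_refl] ell2_fun_summable[of "- X M1"]]
    by (simp add: uminus_ell2.rep_eq)
  then have L: "ell2_fun (Abs_ell2 f) = f" by (simp add: Abs_ell2_inverse)
  have "X \<longlonglongrightarrow> Abs_ell2 f"
  proof (rule tendstoI, unfold eventually_sequentially)
    fix e :: real assume "e > 0"
    then obtain M where M: "\<forall>m\<ge>M. \<forall>n\<ge>M. norm (X m - X n) < e / 2" using Cau[of "e/2"] by auto
    have "dist (X n) (Abs_ell2 f) < e" if "n \<ge> M" for n
    proof -
      have "(norm (X n - Abs_ell2 f))\<^sup>2 \<le> (e / 2)\<^sup>2"
        unfolding ell2_norm_sq minus_ell2.rep_eq L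
        using est[OF _ M that] summ[OF M that] by (intro infsum_le_finite_sums) auto
      then have "norm (X n - Abs_ell2 f) \<le> e / 2"
        by (rule power2_le_imp_le) (use \<open>e > 0\<close> in simp)
      then show ?thesis using \<open>e > 0\<close> by (simp add: dist_norm)
    qed
    then show "\<exists>N. \<forall>n\<ge>N. dist (X n) (Abs_ell2 f) < e" by blast
  qed
  then show "convergent X" by (rule convergentI)
qed

end

section \<open>The uniform Roe algebra\<close>

text \<open>
  A group is a type of class \<^class>\<open>group_add\<close>: additive notation, but not assumed commutative.

  \<open>mult_op f\<close> is the operator of multiplication by \<open>f\<close>; only used for bounded \<open>f\<close>.\<close>

definition mult_op :: "('g \<Rightarrow> complex) \<Rightarrow> ('g ell2 \<Rightarrow>\<^sub>L 'g ell2)" where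
  "mult_op f = Blinfun (\<lambda>u. Abs_ell2 (\<lambda>x. f x * ell2_fun u x))"

definition left_translation :: "'g::group_add \<Rightarrow> ('g ell2 \<Rightarrow>\<^sub>L 'g ell2)" where
  "left_translation g = Blinfun (\<lambda>u. Abs_ell2 (\<lambda>x. ell2_fun u (- g + x)))"

lemma mult_op_apply:
  assumes "bounded (range f)"
  shows "ell2_fun (mult_op f u) x = f x * ell2_fun u x"
proof -
  obtain K where K: "cmod (f x) \<le> K" for x using assms by (auto simp: bounded_iff)
  have K0: "0 \<le> K" using K[of undefined] norm_ge_zero order_trans by blast
  have rep: "ell2_fun (Abs_ell2 (\<lambda>x. f x * ell2_fun u x)) = (\<lambda>x. f x * ell2_fun u x)" for u
    by (rule Abs_ell2_inverse) (simp add: sq_summable_mult[OF ell2_fun_summable K])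
  have "bounded_linear (\<lambda>u. Abs_ell2 (\<lambda>x. f x * ell2_fun u x))"
  proof (rule bounded_linear_intro)
    fix u v :: "'a ell2" and r :: real
    show "Abs_ell2 (\<lambda>x. f x * ell2_fun (u + v) x) =
        Abs_ell2 (\<lambda>x. f x * ell2_fun u x) + Abs_ell2 (\<lambda>x. f x * ell2_fun v x)"
      using rep[of "u + v"]
      by (intro ell2_fun_inject[THEN iffD1]) (simp add: rep plus_ell2.rep_eq distrib_left)
    show "Abs_ell2 (\<lambda>x. f x * ell2_fun (r *\<^sub>R u) x) = r *\<^sub>R Abs_ell2 (\<lambda>x. f x * ell2_fun u x)"
      using rep[of "r *\<^sub>R u"]
      by (intro ell2_fun_inject[THEN iffD1]) (simp add: rep scaleR_ell2.rep_eq mult.left_commute)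
    have "(norm (Abs_ell2 (\<lambda>x. f x * ell2_fun u x)))\<^sup>2 \<le> (\<Sum>\<^sub>\<infinity>x. K\<^sup>2 * (cmod (ell2_fun u x))\<^sup>2)"
      unfolding ell2_norm_sq rep
    proof (rule infsum_mono)
      show "(\<lambda>x. (cmod (f x * ell2_fun u x))\<^sup>2) summable_on UNIV"
        by (rule sq_summable_mult[OF ell2_fun_summable K])
      show "(\<lambda>x. K\<^sup>2 * (cmod (ell2_fun u x))\<^sup>2) summable_on UNIV"
        by (intro summable_on_cmult_right ell2_fun_summable)
      show "(cmod (f x * ell2_fun u x))\<^sup>2 \<le> K\<^sup>2 * (cmod (ell2_fun u x))\<^sup>2" for x
        using K[of x] by (simp add: norm_mult power_mult_distrib mult_right_mono power_mono)
    qed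
    also have "\<dots> = (norm u * K)\<^sup>2"
      by (simp add: infsum_cmult_right' ell2_norm_sq power_mult_distrib mult.commute)
    finally show "norm (Abs_ell2 (\<lambda>x. f x * ell2_fun u x)) \<le> norm u * K"
      by (rule power2_le_imp_le) (use K0 in simp)
  qed
  then show ?thesis unfolding mult_op_def by (simp add: bounded_linear_Blinfun_apply rep)
qed

lemma left_translation_apply: "ell2_fun (left_translation g u) x = ell2_fun u (- g + x)"
proof -
  have bij: "bij_betw (\<lambda>x. - g + x) UNIV UNIV"
    by (rule bij_betw_byWitness[where f' = "\<lambda>x. g + x"]) (auto simp: add.assoc[symmetric])
  have rep: "ell2_fun (Abs_ell2 (\<lambda>x. ell2_fun u (- g + x))) = (\<lambda>x. ell2_fun u (- g + x))" for u
  proof (rule Abs_ell2_inverse)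
    show "(\<lambda>x. ell2_fun u (- g + x)) \<in> {f. (\<lambda>x. (cmod (f x))\<^sup>2) summable_on UNIV}"
      using ell2_fun_summable[of u]
        summable_on_reindex_bij_betw[OF bij, of "\<lambda>x. (cmod (ell2_fun u x))\<^sup>2"] by simp
  qed
  have "bounded_linear (\<lambda>u. Abs_ell2 (\<lambda>x. ell2_fun u (- g + x)))"
  proof (rule bounded_linear_intro)
    fix u v :: "'a ell2" and r :: real
    show "Abs_ell2 (\<lambda>x. ell2_fun (u + v) (- g + x)) =
        Abs_ell2 (\<lambda>x. ell2_fun u (- g + x)) + Abs_ell2 (\<lambda>x. ell2_fun v (- g + x))"
      using rep[of "u + v"]
      by (intro ell2_fun_inject[THEN iffD1]) (simp add: rep plus_ell2.rep_eq)
    show "Abs_ell2 (\<lambda>x. ell2_fun (r *\<^sub>R u) (- g + x)) = r *\<^sub>R Abs_ell2 (\<lambda>x. ell2_fun u (- g + x))"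
      using rep[of "r *\<^sub>R u"]
      by (intro ell2_fun_inject[THEN iffD1]) (simp add: rep scaleR_ell2.rep_eq)
    have "(norm (Abs_ell2 (\<lambda>x. ell2_fun u (- g + x))))\<^sup>2 = (norm u)\<^sup>2"
      unfolding ell2_norm_sq rep
      using infsum_reindex_bij_betw[OF bij, of "\<lambda>x. (cmod (ell2_fun u x))\<^sup>2"] by simp
    then show "norm (Abs_ell2 (\<lambda>x. ell2_fun u (- g + x))) \<le> norm u * 1" by simp
  qed
  then show ?thesis unfolding left_translation_def by (simp add: bounded_linear_Blinfun_apply rep)
qed

text \<open>
  The reduced crossed product of \<open>\<ell>\<^sup>\<infinity>(\<Gamma>)\<close> by left translation, in its faithful
  representation on \<open>\<ell>\<^sup>2(\<Gamma>)\<close>.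
\<close>

definition uniform_roe_algebra :: "('g::group_add ell2 \<Rightarrow>\<^sub>L 'g ell2) cstar" where
  "uniform_roe_algebra = bounded_operators
     \<lparr>csa_carrier := cstar_generated bounded_operators
        ({mult_op f | f. bounded (range f)} \<union> range left_translation)\<rparr>"

text \<open>The closed two-sided ideal generated by the projection onto \<open>\<ell>\<^sup>2(A)\<close>, as a C*-algebra.\<close>

definition roe_ideal :: "'g::group_add set \<Rightarrow> ('g ell2 \<Rightarrow>\<^sub>L 'g ell2) cstar" where
  "roe_ideal A = uniform_roe_algebra
     \<lparr>csa_carrier := ideal_generated uniform_roe_algebra {mult_op (indicator A)}\<rparr>"


section \<open>Metrics\<close>

text \<open>The group is discrete, so a proper metric is one whose closed balls are finite.\<close>

definition proper_right_invariant_metric :: "('g::group_add \<Rightarrow> 'g \<Rightarrow> real) \<Rightarrow> bool" where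
  "proper_right_invariant_metric d \<longleftrightarrow> Metric_space UNIV d \<and>
     (\<forall>x r. finite (Metric_space.mcball UNIV d x r)) \<and>
     (\<forall>x y g. d (x + g) (y + g) = d x y)"

text \<open>The infimum is taken in the extended reals, so that of the empty set is \<open>\<infinity>\<close>.\<close>

definition sparse_metric_space :: "'a set \<Rightarrow> ('a \<Rightarrow> 'a \<Rightarrow> real) \<Rightarrow> bool" where
  "sparse_metric_space X d \<longleftrightarrow> (\<exists>x\<^sub>0\<in>X.
     ((\<lambda>r. Inf {ereal (d x y) | x y.
         x \<in> X - Metric_space.mball X d x\<^sub>0 r \<and> y \<in> X - Metric_space.mball X d x\<^sub>0 r \<and> x \<noteq> y})
       \<longlongrightarrow> \<infinity>) at_top)"

end

theory Submission
  imports Defs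
begin

text \<open>
  Let \<open>p\<^sub>S\<close> be the projection onto \<open>\<ell>\<^sup>2(S)\<close> for a sparse set \<open>S\<close>. A translation by \<open>g \<noteq> 0\<close> moves every
  point by a fixed positive distance, and only finitely many points of \<open>S\<close> have another point of \<open>S\<close>
  that close. Hence \<open>p\<^sub>S T p\<^sub>S\<close> is diagonal up to a finite rank operator when \<open>T\<close> is a finite sum of
  weighted translations, and diagonal modulo the compact operators, in the limit, for every \<open>T\<close> in the
  uniform Roe algebra. Modulo the compact operators the corner at \<open>p\<^sub>S\<close> is therefore commutative.

  The quotient. The hereditary subalgebra of \<open>b p\<^sub>S\<close> lies in the corner at \<open>p\<^sub>S\<close>, so \<open>b p\<^sub>S\<close> becomes abelian in
  the quotient (\<open>abelian_coset\<close>). The ideal of a finite union of sparse sets is the closed span of the products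
  \<open>b p\<^sub>S c = (b p\<^sub>S) (c\<^sup>* p\<^sub>S)\<^sup>*\<close> with \<open>S\<close> one of these sets, so abelian elements generate
  (\<open>quotient_type_I0\<close>).

  Type I. An irreducible representation \<open>\<pi>\<close> of the ideal does not vanish on some \<open>p\<^sub>S\<close>. If it does not
  vanish on the projection onto a single point, that projection has a scalar corner already in the ideal.
  Otherwise \<open>\<pi>\<close> kills the finite rank part of the corner at \<open>p\<^sub>S\<close>, so that the corner of \<open>\<pi>(p\<^sub>S)\<close> is the
  closure of the image of the bounded functions on \<open>S\<close>. For \<open>B \<subseteq> S\<close> the projection \<open>\<pi>(p\<^sub>B)\<close> commutes
  with it, hence is \<open>0\<close> or \<open>\<pi>(p\<^sub>S)\<close> by irreducibility (\<open>commuting_subprojection\<close>), and the corner is scalar because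
  simple functions are uniformly dense. In both cases \<open>\<pi>\<close> has a rank one projection in its range, and
  irreducibility spreads it to all operators of rank one (\<open>compacts_in_range\<close>). To reach all compact
  operators the range must be closed, which holds for every *-representation of a closed *-algebra of
  operators (\<open>range_closed\<close>). It is proved without functional calculus, from two equations solved
  inside the algebra by the contraction principle: \<open>2 c = a\<^sup>* a + c\<^sup>2\<close> shows that representations are
  contractive, and \<open>b + b a\<^sup>* a = a\<close> gives preimages of controlled norm.
\<close>

section \<open>Adjoints on a complex Hilbert space\<close>

lemma cinner_scaleC_left: "cinner (c *\<^sub>C x) y = cnj c * cinner x y"
  by (metis cinner_commute cinner_scaleC_right complex_cnj_cnj complex_cnj_mult)

lemma cinner_add_left: "cinner (x + y) z = cinner x z + cinner y z"
  by (metis cinner_add_right cinner_commute complex_cnj_add)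

lemma cinner_zero [simp]: "cinner 0 y = 0" "cinner y 0 = 0"
  using cinner_add_left[of 0 0 y] cinner_add_right[of y 0 0] by simp_all

lemma cinner_diff_right: "cinner z (x - y) = cinner z x - cinner z y"
  using cinner_add_right[of z "x - y" y] by simp

lemma cinner_self: "cinner x x = of_real ((norm x)\<^sup>2)"
proof (rule complex_eqI)
  show "Re (cinner x x) = Re (of_real ((norm x)\<^sup>2))"
    by (simp add: Re_cinner power2_norm_eq_inner)
  have "Im (cinner x x) = Im (cnj (cinner x x))" by (rule arg_cong[OF cinner_commute])
  then show "Im (cinner x x) = Im (of_real ((norm x)\<^sup>2))" by simp
qed

lemma cinner_eq_inner: "cinner x y = Complex (inner x y) (- inner x (\<i> *\<^sub>C y))"
  by (rule complex_eqI)
     (simp_all add: Re_cinner Re_cinner[symmetric, of x "\<i> *\<^sub>C y"] cinner_scaleC_right)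

lemma scaleC_zero [simp]: "c *\<^sub>C (0::'h::complex_hilbert_space) = 0"
  using scaleC_add_right[of c 0 0] by simp

lemma scaleC_one [simp]: "1 *\<^sub>C (x::'h::complex_hilbert_space) = x"
  using scaleC_of_real[of 1 x] by simp

lemma scaleC_zero_left [simp]: "0 *\<^sub>C (x::'h::complex_hilbert_space) = 0"
  using scaleC_of_real[of 0 x] by simp

lemma cinner_Cauchy_Schwarz: "cmod (cinner x y) \<le> norm x * norm y"
proof (cases "cinner x y = 0")
  case False
  define u where "u = cnj (cinner x y) / cmod (cinner x y)"
  have u: "cmod u = 1" using False by (simp add: u_def norm_divide)
  have "cinner x (u *\<^sub>C y) = of_real (cmod (cinner x y))"
    using False complex_norm_square[of "cinner x y"]
    by (simp add: u_def cinner_scaleC_right power2_eq_square mult.commute field_simps)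
  then have "cmod (cinner x y) = inner x (u *\<^sub>C y)"
    by (metis Re_cinner Re_complex_of_real)
  also have "\<dots> \<le> norm x * norm (u *\<^sub>C y)" by (rule norm_cauchy_schwarz)
  finally show ?thesis by (simp add: norm_scaleC u)
qed simp

lemma cinner_left_eqI: "(\<And>x. cinner x y = cinner x z) \<Longrightarrow> y = z"
  by (metis cinner_diff_right cinner_self eq_iff_diff_eq_0 norm_eq_zero of_real_eq_0_iff
      zero_eq_power2)

text \<open>
  The representing vector minimises \<open>\<parallel>x\<parallel>\<^sup>2 - 2 \<phi> x\<close>: the parallelogram law makes every minimising
  sequence Cauchy, and the derivative at a minimum vanishes in every direction.
\<close>

theorem Riesz_representation:
  fixes \<phi> :: "'h::{real_inner,banach} \<Rightarrow> real"
  assumes "bounded_linear \<phi>"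
  obtains z where "\<And>x. \<phi> x = inner z x"
proof -
  interpret bounded_linear \<phi> by fact
  obtain K where K: "\<And>x. \<bar>\<phi> x\<bar> \<le> norm x * K" using bounded by auto
  define J where "J x = inner x x - 2 * \<phi> x" for x
  have lower: "- K\<^sup>2 \<le> J x" for x
  proof -
    have "0 \<le> (norm x - K)\<^sup>2" by simp
    then show ?thesis
      using K[of x] unfolding J_def power2_norm_eq_inner[symmetric] power2_diff
      by (auto simp: algebra_simps)
  qed
  then have bdd: "bdd_below (range J)" by (auto simp: bdd_below_def)
  define m where "m = Inf (range J)"
  have mle: "m \<le> J x" for x unfolding m_def by (rule cInf_lower[OF _ bdd]) simp
  have "\<exists>x. J x < m + 1 / Suc n" for n
    using cInf_lessD[of "range J" "m + 1 / Suc n"] by (auto simp: m_def)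
  then obtain X where X: "\<And>n. J (X n) < m + 1 / Suc n" by metis
  have par: "(norm (x - y))\<^sup>2 = 2 * J x + 2 * J y - 4 * J ((1/2) *\<^sub>R (x + y))" for x y
    unfolding J_def power2_norm_eq_inner
    by (simp add: add scaleR inner_simps inner_commute algebra_simps)
  have close: "(norm (X i - X j))\<^sup>2 \<le> 4 / Suc N" if "i \<ge> N" "j \<ge> N" for i j N
  proof -
    have "1 / Suc i \<le> 1 / Suc N" "1 / Suc j \<le> 1 / Suc N" using that by (simp_all add: frac_le)
    then show ?thesis
      using par[of "X i" "X j"] X[of i] X[of j] mle[of "(1/2) *\<^sub>R (X i + X j)"] by simp
  qed
  have "Cauchy X"
  proof (rule CauchyI)
    fix e :: real assume e: "e > 0"
    then obtain N where N: "4 / e\<^sup>2 < Suc N" using reals_Archimedean2 less_trans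
      by (metis lessI of_nat_less_iff)
    then have "4 / Suc N < e\<^sup>2" using e by (simp add: field_simps)
    then have "\<forall>i\<ge>N. \<forall>j\<ge>N. norm (X i - X j) < e"
      using close e by (meson le_less_trans less_imp_le power2_less_imp_less)
    then show "\<exists>N. \<forall>i\<ge>N. \<forall>j\<ge>N. norm (X i - X j) < e" ..
  qed
  then obtain z where z: "X \<longlonglongrightarrow> z" using Cauchy_convergent_iff convergent_def by blast
  have "(\<lambda>n. J (X n)) \<longlonglongrightarrow> J z"
    unfolding J_def by (intro tendsto_intros z tendsto)
  moreover have "(\<lambda>n. m + 1 / Suc n) \<longlonglongrightarrow> m + 0"
    by (intro tendsto_intros LIMSEQ_Suc[OF lim_1_over_n])
  ultimately have "J z \<le> m + 0" by (rule LIMSEQ_le) (use X in \<open>auto intro: less_imp_le\<close>)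
  then have min: "J z \<le> J x" for x using mle[of x] by simp
  have "\<phi> x = inner z x" for x
  proof (cases "x = 0")
    case False
    define s where "s = inner z x - \<phi> x"
    define t where "t = - s / inner x x"
    have nz: "inner x x \<noteq> 0" using False by simp
    have "J (z + t *\<^sub>R x) = J z + 2 * t * s + t\<^sup>2 * inner x x"
      unfolding J_def s_def
      by (simp add: add scaleR inner_simps inner_commute algebra_simps power2_eq_square)
    then have "0 \<le> 2 * t * s + t\<^sup>2 * inner x x" using min[of "z + t *\<^sub>R x"] by simp
    also have "\<dots> = - (s\<^sup>2 / inner x x)"
      using nz by (simp add: t_def power2_eq_square field_simps)
    finally have "s\<^sup>2 / inner x x \<le> 0" by simp
    moreover have "inner x x > 0" using False by simp
    ultimately have "s = 0" by (simp add: divide_le_0_iff)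
    then show ?thesis by (simp add: s_def)
  qed (simp add: zero)
  then show ?thesis by (rule that)
qed

lemma is_clinearD: "is_clinear T \<Longrightarrow> T (c *\<^sub>C x) = c *\<^sub>C T x"
  by (simp add: is_clinear_def)

text \<open>
  The real Riesz theorem yields a real adjoint. It is the complex one because the imaginary part of
  \<open>cinner x y\<close> is the real inner product of \<open>x\<close> with \<open>- \<i> y\<close>, and the operator commutes with \<open>\<i>\<close>.
\<close>

lemma is_adjoint_adj:
  fixes T :: "'h::complex_hilbert_space \<Rightarrow>\<^sub>L 'h"
  assumes T: "is_clinear T"
  shows "is_adjoint (adj T) T"
proof -
  have "\<exists>z. \<forall>y. inner x (T y) = inner z y" for x
  proof -
    have "bounded_linear (\<lambda>y. inner x (T y))"
      by (intro bounded_linear_compose[OF bounded_linear_inner_right] blinfun.bounded_linear_right)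
    then show ?thesis by (metis Riesz_representation)
  qed
  then obtain S where S: "\<And>x y. inner x (T y) = inner (S x) y" by metis
  have "bounded_linear S"
  proof (rule bounded_linear_intro)
    show "S (x + y) = S x + S y" for x y
      by (rule vector_eq_rdot[THEN iffD1]) (simp add: S[symmetric] inner_simps)
    show "S (r *\<^sub>R x) = r *\<^sub>R S x" for r x
      by (rule vector_eq_rdot[THEN iffD1]) (simp add: S[symmetric] inner_simps)
    show "norm (S x) \<le> norm x * norm T" for x
    proof -
      have "norm (S x) * norm (S x) = inner x (T (S x))"
        by (simp add: S power2_norm_eq_inner[symmetric] power2_eq_square)
      also have "\<dots> \<le> norm x * norm (T (S x))" by (rule norm_cauchy_schwarz)
      also have "\<dots> \<le> norm x * (norm T * norm (S x))" by (intro mult_left_mono norm_blinfun) simp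
      finally have "norm (S x) * norm (S x) \<le> (norm x * norm T) * norm (S x)"
        by (simp add: mult.assoc)
      then show ?thesis by (cases "norm (S x) = 0") (auto simp: mult_le_cancel_right)
    qed
  qed
  then have "is_adjoint (Blinfun S) T"
    by (simp add: is_adjoint_def bounded_linear_Blinfun_apply cinner_eq_inner S
        is_clinearD[OF T, symmetric])
  then show ?thesis by (simp add: adj_eqI)
qed

lemma cinner_adj_left: "is_clinear T \<Longrightarrow> cinner (adj T x) y = cinner x (T y)"
  using is_adjoint_adj by (auto simp: is_adjoint_def)

lemma is_adjoint_sym: "is_adjoint S T \<Longrightarrow> is_adjoint T S"
  unfolding is_adjoint_def by (metis cinner_commute)

lemma is_adjoint_clinear:
  assumes "is_adjoint S T"
  shows "is_clinear S"
  unfolding is_clinear_def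
proof (intro allI)
  fix c x
  have "cinner y (S (c *\<^sub>C x)) = cinner y (c *\<^sub>C S x)" for y
    using is_adjoint_sym[OF assms, unfolded is_adjoint_def]
    by (simp add: cinner_scaleC_right) (metis cinner_scaleC_right)
  then show "S (c *\<^sub>C x) = c *\<^sub>C S x" by (rule cinner_left_eqI)
qed

lemma is_clinear_adj: "is_clinear T \<Longrightarrow> is_clinear (adj T)"
  using is_adjoint_adj is_adjoint_clinear by blast

lemma adj_adj: "is_clinear T \<Longrightarrow> adj (adj T) = T"
  by (simp add: adj_eqI is_adjoint_adj is_adjoint_sym)

lemma is_clinear_zero: "is_clinear 0"
  by (simp add: is_clinear_def)

lemma is_clinear_add: "is_clinear S \<Longrightarrow> is_clinear T \<Longrightarrow> is_clinear (S + T)"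
  by (simp add: is_clinear_def blinfun.add_left scaleC_add_right)

lemma scaleC_op_scaleR: "scaleC_op (of_real r) T = r *\<^sub>R T"
  by (rule blinfun_eqI) (simp add: scaleC_op_apply scaleC_of_real blinfun.scaleR_left)

lemma scaleC_op_minus_one: "scaleC_op (-1) T = - T"
  using scaleC_op_scaleR[of "-1" T] by simp

lemma is_clinear_scaleC: "is_clinear T \<Longrightarrow> is_clinear (scaleC_op c T)"
  by (simp add: is_clinear_def scaleC_op_apply scaleC_scaleC mult.commute)

lemma is_clinear_scaleR: "is_clinear T \<Longrightarrow> is_clinear (r *\<^sub>R T)"
  using is_clinear_scaleC[of T "of_real r"] by (simp add: scaleC_op_scaleR)

lemma is_clinear_uminus: "is_clinear T \<Longrightarrow> is_clinear (- T)"
  using is_clinear_scaleR[of T "-1"] by simp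

lemma is_clinear_diff: "is_clinear S \<Longrightarrow> is_clinear T \<Longrightarrow> is_clinear (S - T)"
  using is_clinear_add[of S "- T"] is_clinear_uminus[of T] by simp

lemma is_clinear_compose: "is_clinear S \<Longrightarrow> is_clinear T \<Longrightarrow> is_clinear (S o\<^sub>L T)"
  by (simp add: is_clinear_def)

lemma closed_clinear: "closed {T. is_clinear (T :: 'h::complex_hilbert_space \<Rightarrow>\<^sub>L 'h)}"
proof -
  have "{T. is_clinear (T :: 'h \<Rightarrow>\<^sub>L 'h)} = (\<Inter>c. \<Inter>x. {T :: 'h \<Rightarrow>\<^sub>L 'h. T (c *\<^sub>C x) = c *\<^sub>C T x})"
    by (auto simp: is_clinear_def)
  moreover have "closed {T :: 'h \<Rightarrow>\<^sub>L 'h. T (c *\<^sub>C x) = c *\<^sub>C T x}" for c x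
    by (intro closed_Collect_eq bounded_linear.continuous_on[OF bounded_linear_scaleC]
        continuous_intros)
  ultimately show ?thesis by (auto intro!: closed_INT)
qed

lemma adj_zero: "adj 0 = 0"
  by (rule adj_eqI) (simp add: is_adjoint_def)

lemma adj_add: "is_clinear S \<Longrightarrow> is_clinear T \<Longrightarrow> adj (S + T) = adj S + adj T"
  by (rule adj_eqI) (simp add: is_adjoint_def blinfun.add_left cinner_add_left cinner_add_right cinner_adj_left)

lemma adj_scaleC: "is_clinear T \<Longrightarrow> adj (scaleC_op c T) = scaleC_op (cnj c) (adj T)"
  by (rule adj_eqI)
     (simp add: is_adjoint_def scaleC_op_apply cinner_scaleC_left cinner_scaleC_right cinner_adj_left)

lemma adj_scaleR: "is_clinear T \<Longrightarrow> adj (r *\<^sub>R T) = r *\<^sub>R adj T"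
  using adj_scaleC[of T "of_real r"] by (simp add: scaleC_op_scaleR)

lemma adj_diff: "is_clinear S \<Longrightarrow> is_clinear T \<Longrightarrow> adj (S - T) = adj S - adj T"
  using adj_add[of S "- T"] adj_scaleR[of T "-1"] is_clinear_uminus[of T] by simp

lemma adj_compose: "is_clinear S \<Longrightarrow> is_clinear T \<Longrightarrow> adj (S o\<^sub>L T) = adj T o\<^sub>L adj S"
  by (rule adj_eqI) (simp add: is_adjoint_def cinner_adj_left)

lemma norm_adj:
  fixes T :: "'h::complex_hilbert_space \<Rightarrow>\<^sub>L 'h"
  assumes "is_clinear T"
  shows "norm (adj T) = norm T"
proof -
  have le: "norm (adj T) \<le> norm T" if T: "is_clinear T" for T :: "'h \<Rightarrow>\<^sub>L 'h"
  proof (rule norm_blinfun_bound)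
    fix x
    have "norm (adj T x) * norm (adj T x) = cmod (cinner (adj T x) (adj T x))"
      by (simp add: cinner_self norm_power power2_eq_square norm_mult)
    also have "\<dots> = cmod (cinner x (T (adj T x)))" by (simp add: cinner_adj_left T)
    also have "\<dots> \<le> norm x * norm (T (adj T x))" by (rule cinner_Cauchy_Schwarz)
    also have "\<dots> \<le> norm x * (norm T * norm (adj T x))"
      by (intro mult_left_mono norm_blinfun) simp
    finally have "norm (adj T x) * norm (adj T x) \<le> (norm T * norm x) * norm (adj T x)"
      by (simp add: mult_ac)
    then show "norm (adj T x) \<le> norm T * norm x"
      by (cases "norm (adj T x) = 0") (auto simp: mult_le_cancel_right)
  qed simp
  show ?thesis
    using le[OF assms] le[OF is_clinear_adj[OF assms]] adj_adj[OF assms] by simp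
qed

section \<open>Finite rank and compact operators\<close>

interpretation blinfun_compose: bounded_bilinear "(o\<^sub>L)"
  by (rule bounded_bilinear_blinfun_compose)

lemma subspace_closure_span: "subspace (closure (span A))" for A :: "'a::real_normed_vector set"
  unfolding subspace_def
proof (intro conjI ballI allI)
  show "0 \<in> closure (span A)" using closure_subset span_0 by blast
next
  fix x y assume "x \<in> closure (span A)" "y \<in> closure (span A)"
  then obtain f g where "\<And>n. f n \<in> span A" "f \<longlonglongrightarrow> x" "\<And>n. g n \<in> span A" "g \<longlonglongrightarrow> y"
    by (auto simp: closure_sequential)
  then show "x + y \<in> closure (span A)"
    unfolding closure_sequential by (intro exI[of _ "\<lambda>n. f n + g n"]) (auto intro: tendsto_add span_add)
next
  fix r x assume "x \<in> closure (span A)"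
  then obtain f where "\<And>n. f n \<in> span A" "f \<longlonglongrightarrow> x" by (auto simp: closure_sequential)
  then show "r *\<^sub>R x \<in> closure (span A)"
    unfolding closure_sequential
    by (intro exI[of _ "\<lambda>n. r *\<^sub>R f n"]) (auto intro: tendsto_scaleR span_scale)
qed

text \<open>
  The compact operators, the Roe algebra and its ideal are all treated as closed spans of elements of a
  simple form, and their properties are checked on those. Real spans suffice, because the generating
  sets are stable under complex scalars.
\<close>

lemma closure_span_minimal:
  fixes A :: "'a::real_normed_vector set"
  assumes "A \<subseteq> M" "subspace M" "closed M"
  shows "closure (span A) \<subseteq> M"
  by (intro closure_minimal span_minimal assms)

lemma closure_span_superset: "A \<subseteq> closure (span A)" for A :: "'a::real_normed_vector set"
  using span_superset closure_subset by blast

lemma closure_span_image: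
  fixes f :: "'a::real_normed_vector \<Rightarrow> 'b::real_normed_vector"
  assumes f: "bounded_linear f"
    and A: "\<And>a. a \<in> A \<Longrightarrow> f a \<in> M"
    and M: "subspace M" "closed M"
    and x: "x \<in> closure (span A)"
  shows "f x \<in> M"
proof -
  interpret bounded_linear f by fact
  have "closed (f -` M)"
    by (intro closed_vimage M linear_continuous_on f)
  moreover have "subspace (f -` M)"
    using M(1) by (rule linear_subspace_vimage[OF linear_axioms])
  ultimately have "closure (span A) \<subseteq> f -` M" using A by (intro closure_span_minimal) auto
  then show ?thesis using x by auto
qed

text \<open>
  Outside the complex linear operators \<open>adj\<close> takes unspecified values, so it is not a bounded linear map and
  \<open>closure_span_image\<close> does not apply to it; that it is isometric on linear operators replaces this.
\<close>

lemma closure_span_adj: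
  fixes A :: "('h::complex_hilbert_space \<Rightarrow>\<^sub>L 'h) set"
  assumes clin: "A \<subseteq> Collect is_clinear"
    and A: "\<And>a. a \<in> A \<Longrightarrow> adj a \<in> M"
    and M: "subspace M" "closed M"
    and x: "x \<in> closure (span A)"
  shows "is_clinear x" "adj x \<in> M"
proof -
  have sub: "subspace (Collect (is_clinear :: ('h \<Rightarrow>\<^sub>L 'h) \<Rightarrow> bool))"
    by (simp add: subspace_def is_clinear_zero is_clinear_add is_clinear_scaleR)
  have cl: "closure (span A) \<subseteq> Collect is_clinear"
    by (rule closure_span_minimal[OF clin sub closed_clinear])
  then show cx: "is_clinear x" using x by auto
  have span: "is_clinear y \<and> adj y \<in> M" if "y \<in> span A" for y
    using that
  proof (induction rule: span_induct_alt)
    case base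
    then show ?case by (simp add: is_clinear_zero adj_zero subspace_0 M)
  next
    case (step c a y)
    have "is_clinear a" using step(1) clin by auto
    with step show ?case
      by (auto simp: is_clinear_add is_clinear_scaleR adj_add adj_scaleR
          intro!: subspace_add[OF M(1)] subspace_scale[OF M(1)] A)
  qed
  have "\<exists>z\<in>M. dist z (adj x) < e" if "e > 0" for e
  proof -
    obtain y where y: "y \<in> span A" "dist y x < e"
      using x \<open>e > 0\<close> by (auto simp: closure_approachable)
    have "dist (adj y) (adj x) = norm (adj (y - x))"
      using span[OF y(1)] cx by (simp add: dist_norm adj_diff)
    also have "\<dots> < e" using y span[OF y(1)] cx by (simp add: norm_adj is_clinear_diff dist_norm)
    finally show ?thesis using span[OF y(1)] by blast
  qed
  then have "adj x \<in> closure M" by (simp add: closure_approachable)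
  then show "adj x \<in> M" using M(2) by simp
qed

definition rank_one :: "'h::complex_hilbert_space \<Rightarrow> 'h \<Rightarrow> ('h \<Rightarrow>\<^sub>L 'h)" where
  "rank_one \<eta> \<zeta> = Blinfun (\<lambda>x. cinner \<zeta> x *\<^sub>C \<eta>)"

lemma cinner_scaleR_right: "cinner x (r *\<^sub>R y) = of_real r * cinner x y"
  by (simp add: scaleC_of_real[symmetric] cinner_scaleC_right)

lemma cinner_scaleR_left: "cinner (r *\<^sub>R x) y = of_real r * cinner x y"
  by (simp add: scaleC_of_real[symmetric] cinner_scaleC_left)

lemma bounded_linear_scaleC_left:
  "bounded_linear (\<lambda>c. c *\<^sub>C (x :: 'h::complex_hilbert_space))"
proof (rule bounded_linear_intro)
  show "(r *\<^sub>R c) *\<^sub>C x = r *\<^sub>R (c *\<^sub>C x)" for r c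
    by (simp add: scaleC_of_real[symmetric] scaleC_scaleC scaleR_conv_of_real)
qed (auto simp: scaleC_add_left norm_scaleC)

lemma rank_one_apply: "rank_one \<eta> \<zeta> x = cinner \<zeta> x *\<^sub>C \<eta>"
proof -
  have "bounded_linear (\<lambda>x. cinner \<zeta> x)"
    by (rule bounded_linear_intro[where K = "norm \<zeta>"])
       (auto simp: cinner_add_right cinner_scaleR_right scaleR_conv_of_real mult.commute[of "norm _" "norm \<zeta>"]
         cinner_Cauchy_Schwarz)
  then have "bounded_linear (\<lambda>x. cinner \<zeta> x *\<^sub>C \<eta>)"
    by (rule bounded_linear_compose[OF bounded_linear_scaleC_left])
  then show ?thesis unfolding rank_one_def by (simp add: bounded_linear_Blinfun_apply)
qed

lemma is_clinear_rank_one: "is_clinear (rank_one \<eta> \<zeta>)"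
  by (simp add: is_clinear_def rank_one_apply cinner_scaleC_right scaleC_scaleC)

lemma compose_rank_one: "is_clinear T \<Longrightarrow> T o\<^sub>L rank_one \<eta> \<zeta> = rank_one (T \<eta>) \<zeta>"
  by (rule blinfun_eqI) (simp add: rank_one_apply is_clinearD)

lemma rank_one_compose: "is_clinear T \<Longrightarrow> rank_one \<eta> \<zeta> o\<^sub>L T = rank_one \<eta> (adj T \<zeta>)"
  by (rule blinfun_eqI) (simp add: rank_one_apply cinner_adj_left)

lemma adj_rank_one: "adj (rank_one \<eta> \<zeta>) = rank_one \<zeta> \<eta>"
proof (rule adj_eqI)
  show "is_adjoint (rank_one \<zeta> \<eta>) (rank_one \<eta> \<zeta>)"
    unfolding is_adjoint_def
    by (simp add: rank_one_apply cinner_scaleC_left cinner_scaleC_right)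
       (metis cinner_commute mult.commute)
qed

lemma bounded_bilinear_rank_one: "bounded_bilinear rank_one"
proof
  show "rank_one (a + a') b = rank_one a b + rank_one a' b" for a a' b :: 'a
    by (rule blinfun_eqI) (simp add: rank_one_apply blinfun.add_left scaleC_add_right)
  show "rank_one a (b + b') = rank_one a b + rank_one a b'" for a b b' :: 'a
    by (rule blinfun_eqI) (simp add: rank_one_apply blinfun.add_left cinner_add_left scaleC_add_left)
  show "rank_one (r *\<^sub>R a) b = r *\<^sub>R rank_one a b" for r and a b :: 'a
    by (rule blinfun_eqI)
       (simp add: rank_one_apply blinfun.scaleR_left scaleC_of_real[symmetric] scaleC_scaleC mult.commute)
  show "rank_one a (r *\<^sub>R b) = r *\<^sub>R rank_one a b" for r and a b :: 'a
    by (rule blinfun_eqI)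
       (simp add: rank_one_apply blinfun.scaleR_left cinner_scaleR_left,
        simp add: scaleC_of_real[symmetric] scaleC_scaleC)
  show "\<exists>K. \<forall>a b :: 'a. norm (rank_one a b) \<le> norm a * norm b * K"
  proof (intro exI[of _ 1] allI)
    fix a b :: 'a
    show "norm (rank_one a b) \<le> norm a * norm b * 1"
    proof (rule norm_blinfun_bound)
      show "norm (rank_one a b x) \<le> norm a * norm b * 1 * norm x" for x
        using mult_right_mono[OF cinner_Cauchy_Schwarz[of b x] norm_ge_zero[of a]]
        by (simp add: rank_one_apply norm_scaleC mult_ac)
    qed simp
  qed
qed

definition rank_ones :: "('h::complex_hilbert_space \<Rightarrow>\<^sub>L 'h) set" where
  "rank_ones = {rank_one \<eta> \<zeta> | \<eta> \<zeta>. True}"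

lemma rank_one_in_rank_ones [simp]: "rank_one \<eta> \<zeta> \<in> rank_ones"
  by (auto simp: rank_ones_def)

text \<open>
  Gram--Schmidt: the projection onto the complex span of \<open>F\<close> is built by adding one orthogonal
  direction at a time.
\<close>

lemma finite_rank_projection:
  fixes F :: "'h::complex_hilbert_space set"
  assumes "finite F"
  shows "\<exists>Q\<in>span rank_ones. is_adjoint Q Q \<and> (\<forall>x. Q (Q x) = Q x) \<and> (\<forall>y\<in>F. Q y = y)"
  using assms
proof (induction F)
  case empty
  show ?case by (intro bexI[of _ 0]) (auto simp: is_adjoint_def span_0)
next
  case (insert y F)
  then obtain Q where Q: "Q \<in> span rank_ones" "is_adjoint Q Q"
    "\<And>x. Q (Q x) = Q x" "\<And>y. y \<in> F \<Longrightarrow> Q y = y" by blast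
  define z where "z = y - Q y"
  have Qz: "Q z = 0" by (simp add: z_def blinfun.diff_right Q)
  have zQ: "cinner z (Q x) = 0" for x
    using Q(2)[unfolded is_adjoint_def, rule_format, of z x] Qz by simp
  show ?case
  proof (cases "z = 0")
    case True
    then show ?thesis using Q by (intro bexI[of _ Q]) (auto simp: z_def)
  next
    case False
    define c where "c = 1 / (norm z)\<^sup>2"
    have c: "complex_of_real c * (complex_of_real (norm z))\<^sup>2 = 1" using False by (simp add: c_def)
    define Q' where "Q' = Q + c *\<^sub>R rank_one z z"
    have app: "Q' x = Q x + (of_real c * cinner z x) *\<^sub>C z" for x
      by (simp add: Q'_def blinfun.add_left blinfun.scaleR_left rank_one_apply
          scaleC_of_real[symmetric] scaleC_scaleC)
    have "Q' \<in> span rank_ones"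
      unfolding Q'_def by (intro span_add Q(1) span_scale span_base) simp
    moreover have "is_adjoint Q' Q'"
      unfolding is_adjoint_def
    proof (intro allI)
      fix u v
      have "cinner (Q u) v = cinner u (Q v)" using Q(2) by (simp add: is_adjoint_def)
      moreover have "cinner u z = cnj (cinner z u)" by (rule cinner_commute)
      ultimately show "cinner (Q' u) v = cinner u (Q' v)"
        by (simp add: app cinner_add_left cinner_add_right cinner_scaleC_left cinner_scaleC_right)
    qed
    moreover have "Q' (Q' x) = Q' x" for x
    proof -
      have "Q (w *\<^sub>C z) = 0" for w
        using is_clinearD[OF is_adjoint_clinear[OF Q(2)]] Qz by simp
      moreover have eq: "(of_real c * (of_real c * cinner z x * (of_real (norm z))\<^sup>2))
          = of_real c * cinner z x"
      proof -
        have "of_real c * (of_real c * cinner z x * (of_real (norm z))\<^sup>2)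
            = (of_real c * (of_real (norm z))\<^sup>2) * (of_real c * cinner z x)" by (simp only: mult_ac)
        then show ?thesis by (simp only: c mult_1_left)
      qed
      moreover note arg_cong[OF eq, of "\<lambda>w. w *\<^sub>C z"]
      ultimately show ?thesis
        by (simp add: app blinfun.add_right cinner_add_right zQ Q cinner_scaleC_right cinner_self
            del: mult_cancel_left mult_cancel_right)
    qed
    moreover have "Q' w = w" if "w \<in> F" for w
      using zQ[of w] Q(4)[OF that] by (simp add: app)
    moreover have "Q' y = y"
    proof -
      have "cinner z y = (of_real (norm z))\<^sup>2"
        using cinner_self[of z] zQ[of y] cinner_diff_right[of z y "Q y", folded z_def] by simp
      then have "Q' y = Q y + z" by (simp add: app c)
      then show ?thesis by (simp add: z_def)
    qed
    ultimately show ?thesis by (intro bexI[of _ Q']) auto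
  qed
qed

lemma norm_minus_projection_le:
  assumes "is_adjoint Q Q" "\<And>x. Q (Q x) = Q x"
  shows "norm (x - Q x) \<le> norm x"
proof -
  let ?r = "x - Q x"
  have "cinner ?r (Q x) = cinner (Q ?r) x" using assms(1) by (simp add: is_adjoint_def)
  also have "\<dots> = 0" by (simp add: blinfun.diff_right assms)
  finally have "cinner ?r ?r = cinner ?r x" by (simp add: cinner_diff_right)
  then have "norm ?r * norm ?r = cmod (cinner ?r x)"
    using arg_cong[OF cinner_self[of ?r], of cmod] by (simp add: norm_power power2_eq_square norm_mult)
  also have "\<dots> \<le> norm ?r * norm x" by (rule cinner_Cauchy_Schwarz)
  finally show ?thesis by (cases "norm ?r = 0") (auto simp: mult_le_cancel_left)
qed

lemma compact_operators_iff:
  "T \<in> compact_operators \<longleftrightarrow>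
    is_clinear T \<and> (\<forall>e>0. \<exists>F. finite F \<and> blinfun_apply T ` cball 0 1 \<subseteq> (\<Union>x\<in>F. ball x e))"
proof -
  have "compact (closure S) \<longleftrightarrow> (\<forall>e>0. \<exists>F. finite F \<and> S \<subseteq> (\<Union>x\<in>F. ball x e))" (is "_ = ?tb")
    for S :: "'a set"
  proof
    assume c: "compact (closure S)"
    show ?tb
    proof (intro allI impI)
      fix e :: real assume "e > 0"
      then obtain F where "finite F" "closure S \<subseteq> (\<Union>x\<in>F. ball x e)"
        using c unfolding compact_eq_totally_bounded by blast
      then show "\<exists>F. finite F \<and> S \<subseteq> (\<Union>x\<in>F. ball x e)"
        using closure_subset[of S] by (intro exI[of _ F]) simp
    qed
  next
    assume tb: ?tb
    have "\<exists>F. finite F \<and> closure S \<subseteq> (\<Union>x\<in>F. ball x e)" if "e > 0" for e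
    proof -
      obtain F where F: "finite F" "S \<subseteq> (\<Union>x\<in>F. ball x (e/2))"
        using tb \<open>e > 0\<close> by (meson half_gt_zero)
      then have "S \<subseteq> (\<Union>x\<in>F. cball x (e/2))"
        using UN_mono[of F F "\<lambda>x. ball x (e/2)" "\<lambda>x. cball x (e/2)"] by (meson ball_subset_cball order_refl order_trans)
      moreover have "closed (\<Union>x\<in>F. cball x (e/2))" using F(1) by (intro closed_UN) auto
      ultimately have "closure S \<subseteq> (\<Union>x\<in>F. cball x (e/2))" by (rule closure_minimal)
      also have "\<dots> \<subseteq> (\<Union>x\<in>F. ball x e)"
        using \<open>e > 0\<close> by (intro UN_mono) auto
      finally show ?thesis using F(1) by blast
    qed
    then show "compact (closure S)"
      by (simp add: compact_eq_totally_bounded complete_eq_closed)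
  qed
  note this[of "blinfun_apply T ` cball 0 1"]
  then show ?thesis unfolding compact_operators_def by simp
qed

lemma norm_blinfun_le_on_cball:
  assumes "0 \<le> b" "\<And>x. norm x \<le> 1 \<Longrightarrow> norm (blinfun_apply T x) \<le> b"
  shows "norm T \<le> b"
proof (rule norm_blinfun_bound[OF assms(1)])
  fix x
  show "norm (T x) \<le> b * norm x"
  proof (cases "x = 0")
    case False
    have "norm (T ((1 / norm x) *\<^sub>R x)) \<le> b" using False by (intro assms(2)) simp
    then show ?thesis using False by (simp add: blinfun.scaleR_right field_simps)
  qed simp
qed

text \<open>
  Following a compact operator by the projection onto the span of a finite net of the image of the unit
  ball changes it little in norm; conversely total boundedness survives sums and norm limits.
\<close>

theorem compact_operators_eq:
  "compact_operators = closure (span (rank_ones :: ('h::complex_hilbert_space \<Rightarrow>\<^sub>L 'h) set))"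
proof
  show "compact_operators \<subseteq> closure (span (rank_ones :: ('h \<Rightarrow>\<^sub>L 'h) set))"
  proof
    fix T :: "'h \<Rightarrow>\<^sub>L 'h" assume T: "T \<in> compact_operators"
    then have clin: "is_clinear T" by (simp add: compact_operators_iff)
    have "\<exists>R\<in>span rank_ones. dist R T < e" if "e > 0" for e
    proof -
      have e2: "e / 2 > 0" using that by simp
      then obtain F where F: "finite F" "blinfun_apply T ` cball 0 1 \<subseteq> (\<Union>x\<in>F. ball x (e/2))"
        using T unfolding compact_operators_iff by blast
      obtain Q where Q: "Q \<in> span rank_ones" "is_adjoint Q Q"
        "\<And>x. Q (Q x) = Q x" "\<And>y. y \<in> F \<Longrightarrow> Q y = y"
        using finite_rank_projection[OF F(1)] by blast
      have "Q o\<^sub>L T \<in> span rank_ones"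
        using Q(1)
      proof (induction rule: span_induct_alt)
        case (step c a y)
        obtain \<eta> \<zeta> where "a = rank_one \<eta> \<zeta>" using step(1) by (auto simp: rank_ones_def)
        then have "a o\<^sub>L T \<in> rank_ones" by (simp add: rank_one_compose[OF clin])
        with step(2) show ?case
          by (simp add: blinfun_compose.add_left blinfun_compose.scaleR_left span_add span_scale
              span_base)
      qed (simp add: span_0)
      moreover have "norm (T - (Q o\<^sub>L T)) \<le> e / 2"
      proof (rule norm_blinfun_le_on_cball)
        fix x :: 'h assume "norm x \<le> 1"
        then have "T x \<in> blinfun_apply T ` cball 0 1" by (intro imageI) simp
        then have "T x \<in> (\<Union>x\<in>F. ball x (e/2))" using F(2) by (rule subsetD[rotated])
        then obtain y where y: "y \<in> F" "dist y (T x) < e/2" by auto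
        have "norm (T x - Q (T x)) \<le> norm (T x - y)"
          using norm_minus_projection_le[OF Q(2,3), of "T x - y"] Q(4)[OF y(1)]
          by (simp add: blinfun.diff_right)
        then show "norm ((T - (Q o\<^sub>L T)) x) \<le> e / 2"
          using y by (simp add: blinfun.diff_left dist_norm norm_minus_commute)
      qed (use e2 in simp)
      ultimately show ?thesis using \<open>e > 0\<close>
        by (intro bexI[of _ "Q o\<^sub>L T"]) (auto simp: dist_norm norm_minus_commute)
    qed
    then show "T \<in> closure (span rank_ones)" by (simp add: closure_approachable)
  qed
  show "closure (span rank_ones) \<subseteq> (compact_operators :: ('h \<Rightarrow>\<^sub>L 'h) set)"
  proof (rule closure_span_minimal)
    show "rank_ones \<subseteq> (compact_operators :: ('h \<Rightarrow>\<^sub>L 'h) set)"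
    proof
      fix T :: "'h \<Rightarrow>\<^sub>L 'h" assume "T \<in> rank_ones"
      then obtain \<eta> \<zeta> where T: "T = rank_one \<eta> \<zeta>" by (auto simp: rank_ones_def)
      have "compact ((\<lambda>c. c *\<^sub>C \<eta>) ` cball 0 (norm \<zeta>))"
        by (intro compact_continuous_image linear_continuous_on bounded_linear_scaleC_left) simp
      moreover have "blinfun_apply T ` cball 0 1 \<subseteq> (\<lambda>c. c *\<^sub>C \<eta>) ` cball 0 (norm \<zeta>)"
      proof (rule image_subsetI)
        fix x :: 'h assume "x \<in> cball 0 1"
        then have "cmod (cinner \<zeta> x) \<le> norm \<zeta>"
          using cinner_Cauchy_Schwarz[of \<zeta> x] mult_left_le[of "norm x" "norm \<zeta>"] by simp
        then show "T x \<in> (\<lambda>c. c *\<^sub>C \<eta>) ` cball 0 (norm \<zeta>)" by (auto simp: T rank_one_apply)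
      qed
      ultimately show "T \<in> compact_operators"
        unfolding compact_operators_iff compact_eq_totally_bounded
        by (auto simp: T is_clinear_rank_one) (meson order_trans)
    qed
    show "subspace (compact_operators :: ('h \<Rightarrow>\<^sub>L 'h) set)"
      unfolding subspace_def
    proof (intro conjI ballI allI)
      show "0 \<in> (compact_operators :: ('h \<Rightarrow>\<^sub>L 'h) set)"
      proof -
        have "\<exists>F. finite F \<and> blinfun_apply (0::'h \<Rightarrow>\<^sub>L 'h) ` cball 0 1 \<subseteq> (\<Union>x\<in>F. ball x e)"
          if "e > 0" for e using that by (intro exI[of _ "{0}"]) auto
        then show ?thesis unfolding compact_operators_iff using is_clinear_zero by blast
      qed
    next
      fix S T :: "'h \<Rightarrow>\<^sub>L 'h" assume S: "S \<in> compact_operators" and T: "T \<in> compact_operators"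
      have "\<exists>F. finite F \<and> blinfun_apply (S + T) ` cball 0 1 \<subseteq> (\<Union>x\<in>F. ball x e)"
        if "e > 0" for e
      proof -
        have e2: "e / 2 > 0" using that by simp
        obtain F where F: "finite F" "blinfun_apply S ` cball 0 1 \<subseteq> (\<Union>x\<in>F. ball x (e/2))"
          using S e2 unfolding compact_operators_iff by blast
        obtain G where G: "finite G" "blinfun_apply T ` cball 0 1 \<subseteq> (\<Union>x\<in>G. ball x (e/2))"
          using T e2 unfolding compact_operators_iff by blast
        have "(S + T) v \<in> (\<Union>x\<in>(\<lambda>(a, b). a + b) ` (F \<times> G). ball x e)" if v: "v \<in> cball 0 1" for v
        proof -
          obtain a where a: "a \<in> F" "dist a (S v) < e/2" using F(2) v by (auto dest!: subsetD)
          obtain b where b: "b \<in> G" "dist b (T v) < e/2" using G(2) v by (auto dest!: subsetD)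
          have "dist (a + b) ((S + T) v) \<le> dist a (S v) + dist b (T v)"
            by (simp add: blinfun.add_left dist_triangle_add)
          then have "dist (a + b) ((S + T) v) < e" using a b by linarith
          then show ?thesis using a b by auto
        qed
        then show ?thesis using F(1) G(1)
          by (intro exI[of _ "(\<lambda>(a, b). a + b) ` (F \<times> G)"]) blast
      qed
      then show "S + T \<in> compact_operators"
        using S T by (simp add: compact_operators_iff is_clinear_add)
    next
      fix r and T :: "'h \<Rightarrow>\<^sub>L 'h" assume T: "T \<in> compact_operators"
      have "\<exists>F. finite F \<and> blinfun_apply (r *\<^sub>R T) ` cball 0 1 \<subseteq> (\<Union>x\<in>F. ball x e)"
        if "e > 0" for e
      proof -
        have e2: "e / (\<bar>r\<bar> + 1) > 0" using that by simp
        obtain F where F: "finite F" "blinfun_apply T ` cball 0 1 \<subseteq> (\<Union>x\<in>F. ball x (e / (\<bar>r\<bar> + 1)))"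
          using T e2 unfolding compact_operators_iff by blast
        have "(r *\<^sub>R T) v \<in> (\<Union>x\<in>(*\<^sub>R) r ` F. ball x e)" if v: "v \<in> cball 0 1" for v
        proof -
          obtain a where a: "a \<in> F" "dist a (T v) < e / (\<bar>r\<bar> + 1)" using F(2) v by (auto dest!: subsetD)
          have "dist (r *\<^sub>R a) ((r *\<^sub>R T) v) = \<bar>r\<bar> * dist a (T v)"
            by (simp add: blinfun.scaleR_left dist_norm flip: scaleR_diff_right)
          also have "\<dots> \<le> (\<bar>r\<bar> + 1) * dist a (T v)" by (intro mult_right_mono) auto
          also have "\<dots> < e" using a(2) by (simp add: field_simps)
          finally show ?thesis using a by auto
        qed
        then show ?thesis using F(1) by (intro exI[of _ "(*\<^sub>R) r ` F"]) blast
      qed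
      then show "r *\<^sub>R T \<in> compact_operators"
        using T by (simp add: compact_operators_iff is_clinear_scaleR)
    qed
    show "closed (compact_operators :: ('h \<Rightarrow>\<^sub>L 'h) set)"
    proof (unfold closure_subset_eq[symmetric], rule subsetI)
      fix T :: "'h \<Rightarrow>\<^sub>L 'h" assume T: "T \<in> closure compact_operators"
      have "is_clinear T"
        using T closure_minimal[OF _ closed_clinear, of compact_operators]
        by (auto simp: compact_operators_def)
      moreover have "\<exists>F. finite F \<and> blinfun_apply T ` cball 0 1 \<subseteq> (\<Union>x\<in>F. ball x e)"
        if "e > 0" for e
      proof -
        have e2: "e / 2 > 0" using that by simp
        obtain R where R: "R \<in> compact_operators" "dist R T < e / 2"
          using T e2 unfolding closure_approachable by blast
        obtain F where F: "finite F" "blinfun_apply R ` cball 0 1 \<subseteq> (\<Union>x\<in>F. ball x (e/2))"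
          using R e2 unfolding compact_operators_iff by blast
        have "T v \<in> (\<Union>x\<in>F. ball x e)" if v: "v \<in> cball 0 1" for v
        proof -
          obtain a where a: "a \<in> F" "dist a (R v) < e/2" using F(2) v by (auto dest!: subsetD)
          have "norm ((R - T) v) \<le> norm (R - T) * norm v" by (rule norm_blinfun)
          also have "\<dots> \<le> norm (R - T)" using v by (simp add: mult_left_le)
          finally have "dist (R v) (T v) < e/2" using R(2) by (simp add: dist_norm blinfun.diff_left)
          then have "dist a (T v) < e" using a(2) dist_triangle[of a "T v" "R v"] by linarith
          then show ?thesis using a by auto
        qed
        then show ?thesis using F(1) by blast
      qed
      ultimately show "T \<in> compact_operators" by (simp add: compact_operators_iff)
    qed
  qed
qed

lemma rank_one_compact: "rank_one \<eta> \<zeta> \<in> compact_operators"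
  unfolding compact_operators_eq using closure_span_superset by fastforce

lemma subspace_compact_operators: "subspace compact_operators"
  unfolding compact_operators_eq by (rule subspace_closure_span)

lemma closed_compact_operators: "closed compact_operators"
  unfolding compact_operators_eq by simp

lemma is_clinear_compact: "K \<in> compact_operators \<Longrightarrow> is_clinear K"
  by (simp add: compact_operators_def)

lemma compose_compact_left:
  assumes "is_clinear T" "K \<in> compact_operators"
  shows "T o\<^sub>L K \<in> compact_operators"
  by (rule closure_span_image[OF blinfun_compose.bounded_linear_right _
        subspace_compact_operators closed_compact_operators assms(2)[unfolded compact_operators_eq]])
     (auto simp: rank_ones_def compose_rank_one assms rank_one_compact)

lemma compose_compact_right:
  assumes "is_clinear T" "K \<in> compact_operators"
  shows "K o\<^sub>L T \<in> compact_operators"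
  by (rule closure_span_image[OF blinfun_compose.bounded_linear_left _
        subspace_compact_operators closed_compact_operators assms(2)[unfolded compact_operators_eq]])
     (auto simp: rank_ones_def rank_one_compose assms rank_one_compact)

lemma adj_compact: "K \<in> compact_operators \<Longrightarrow> adj K \<in> compact_operators"
  by (rule closure_span_adj(2)[OF _ _ subspace_compact_operators closed_compact_operators,
        where A = rank_ones])
     (auto simp: rank_ones_def is_clinear_rank_one adj_rank_one rank_one_compact,
      simp add: compact_operators_eq rank_ones_def)

lemma scaleC_compact: "K \<in> compact_operators \<Longrightarrow> scaleC_op c K \<in> compact_operators"
proof -
  assume K: "K \<in> compact_operators"
  have "is_clinear (scaleC_op c id_blinfun)"
    by (simp add: is_clinear_def scaleC_op_apply scaleC_scaleC mult.commute)
  then have "scaleC_op c id_blinfun o\<^sub>L K \<in> compact_operators" using K by (rule compose_compact_left)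
  moreover have "scaleC_op c id_blinfun o\<^sub>L K = scaleC_op c K"
    by (rule blinfun_eqI) (simp add: scaleC_op_apply)
  ultimately show ?thesis by simp
qed

section \<open>Algebras of operators\<close>

definition closed_star_algebra :: "('h::complex_hilbert_space \<Rightarrow>\<^sub>L 'h) set \<Rightarrow> bool" where
  "closed_star_algebra M \<longleftrightarrow> M \<subseteq> Collect is_clinear \<and> subspace M \<and> closed M \<and>
     (\<forall>c. \<forall>a\<in>M. scaleC_op c a \<in> M) \<and> (\<forall>a\<in>M. \<forall>b\<in>M. a o\<^sub>L b \<in> M) \<and> (\<forall>a\<in>M. adj a \<in> M)"

abbreviation operator_algebra :: "('h::complex_hilbert_space \<Rightarrow>\<^sub>L 'h) set \<Rightarrow> ('h \<Rightarrow>\<^sub>L 'h) cstar" where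
  "operator_algebra M \<equiv> bounded_operators\<lparr>csa_carrier := M\<rparr>"

lemma operator_algebra_simps [simp]:
  "csa_carrier (operator_algebra M) = M" "csa_zero (operator_algebra M) = 0"
  "csa_add (operator_algebra M) = (+)" "csa_scale (operator_algebra M) = scaleC_op"
  "csa_mult (operator_algebra M) = (o\<^sub>L)" "csa_star (operator_algebra M) = adj"
  "csa_norm (operator_algebra M) = norm"
  by (simp_all add: bounded_operators_def)

lemma bounded_operators_simps [simp]:
  "csa_carrier bounded_operators = Collect is_clinear" "csa_zero bounded_operators = 0"
  "csa_add bounded_operators = (+)" "csa_scale bounded_operators = scaleC_op"
  "csa_mult bounded_operators = (o\<^sub>L)" "csa_star bounded_operators = adj"
  "csa_norm bounded_operators = norm"
  by (simp_all add: bounded_operators_def)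

lemma csa_closure_operator_algebra: "csa_closure (operator_algebra M) S = closure S \<inter> M"
  by (auto simp: csa_closure_def closure_approachable scaleC_op_minus_one dist_norm norm_minus_commute)

lemma csa_closure_bounded_operators:
  "csa_closure bounded_operators S = closure S \<inter> Collect is_clinear"
  by (auto simp: csa_closure_def closure_approachable scaleC_op_minus_one dist_norm norm_minus_commute)

lemma subspaceI_scaleC:
  assumes "0 \<in> M" "\<And>x y. x \<in> M \<Longrightarrow> y \<in> M \<Longrightarrow> x + y \<in> M" "\<And>c x. x \<in> M \<Longrightarrow> scaleC_op c x \<in> M"
  shows "subspace M"
  unfolding subspace_def using assms by (metis scaleC_op_scaleR)

lemma cstar_subalgebra_iff: "cstar_subalgebra bounded_operators M \<longleftrightarrow> closed_star_algebra M"
proof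
  assume M: "cstar_subalgebra bounded_operators M"
  then have sub: "M \<subseteq> Collect is_clinear" and clos: "closure M \<inter> Collect is_clinear \<subseteq> M"
    unfolding cstar_subalgebra_def csa_closure_bounded_operators by simp_all
  have "closure M \<subseteq> Collect is_clinear" by (rule closure_minimal[OF sub closed_clinear])
  then have "closed M" using clos closure_subset_eq[of M] by blast
  moreover have "subspace M"
    using M by (intro subspaceI_scaleC) (auto simp: cstar_subalgebra_def)
  ultimately show "closed_star_algebra M"
    using M sub by (simp add: cstar_subalgebra_def closed_star_algebra_def)
next
  assume M: "closed_star_algebra M"
  then show "cstar_subalgebra bounded_operators M"
    unfolding cstar_subalgebra_def csa_closure_bounded_operators
    by (auto simp: closed_star_algebra_def subspace_0 subspace_add)
qed

lemma bounded_linear_scaleC_op: "bounded_linear (scaleC_op c)"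
proof (rule bounded_linear_intro[where K = "cmod c"])
  show "scaleC_op c (S + T) = scaleC_op c S + scaleC_op c T" for S T :: "'a \<Rightarrow>\<^sub>L 'a"
    by (rule blinfun_eqI) (simp add: scaleC_op_apply blinfun.add_left scaleC_add_right)
  show "scaleC_op c (r *\<^sub>R T) = r *\<^sub>R scaleC_op c T" for r and T :: "'a \<Rightarrow>\<^sub>L 'a"
    by (rule blinfun_eqI)
       (simp add: scaleC_op_apply blinfun.scaleR_left scaleC_of_real[symmetric] scaleC_scaleC mult.commute)
  show "norm (scaleC_op c T) \<le> norm T * cmod c" for T :: "'a \<Rightarrow>\<^sub>L 'a"
  proof (rule norm_blinfun_bound)
    show "norm (scaleC_op c T x) \<le> norm T * cmod c * norm x" for x
      using mult_left_mono[OF norm_blinfun[of T x], of "cmod c"]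
      by (simp add: scaleC_op_apply norm_scaleC mult_ac)
  qed simp
qed

lemma scaleC_op_compose: "scaleC_op c (S o\<^sub>L T) = scaleC_op c S o\<^sub>L T"
  by (rule blinfun_eqI) (simp add: scaleC_op_apply)

lemma compose_assoc: "(S o\<^sub>L T) o\<^sub>L R = S o\<^sub>L (T o\<^sub>L R)"
  by (rule blinfun_eqI) simp

text \<open>
  Multiplication is extended from the generators to the closed span in one factor at a time.
\<close>

lemma closed_star_algebra_closure_span:
  assumes clin: "A \<subseteq> Collect is_clinear"
    and scale: "\<And>c a. a \<in> A \<Longrightarrow> scaleC_op c a \<in> A"
    and mult: "\<And>a b. a \<in> A \<Longrightarrow> b \<in> A \<Longrightarrow> a o\<^sub>L b \<in> A"
    and star: "\<And>a. a \<in> A \<Longrightarrow> adj a \<in> A"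
  shows "closed_star_algebra (closure (span A))"
proof -
  let ?M = "closure (span A)"
  have sM: "subspace ?M" "closed ?M" by (simp_all add: subspace_closure_span)
  have AM: "a \<in> ?M" if "a \<in> A" for a using closure_span_superset that by blast
  have "a o\<^sub>L b \<in> ?M" if "a \<in> A" "b \<in> ?M" for a b
    by (rule closure_span_image[OF blinfun_compose.bounded_linear_right _ sM that(2)])
       (intro AM mult that)
  then have "a o\<^sub>L b \<in> ?M" if "a \<in> ?M" "b \<in> ?M" for a b
    using that(2) by (intro closure_span_image[OF blinfun_compose.bounded_linear_left _ sM that(1)])
  moreover have "scaleC_op c a \<in> ?M" if "a \<in> ?M" for c a
    by (rule closure_span_image[OF bounded_linear_scaleC_op _ sM that]) (intro AM scale)
  moreover have "is_clinear a \<and> adj a \<in> ?M" if "a \<in> ?M" for a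
    using closure_span_adj[OF clin _ sM that] star AM by blast
  ultimately show ?thesis using sM unfolding closed_star_algebra_def by blast
qed

lemma closed_ideal_iff:
  assumes U: "closed_star_algebra U"
  shows "closed_ideal (operator_algebra U) J \<longleftrightarrow> J \<subseteq> U \<and> subspace J \<and> closed J \<and>
    (\<forall>c. \<forall>x\<in>J. scaleC_op c x \<in> J) \<and> (\<forall>x\<in>J. \<forall>b\<in>U. b o\<^sub>L x \<in> J \<and> x o\<^sub>L b \<in> J)"
proof -
  have "closure J \<inter> U \<subseteq> J \<longleftrightarrow> closed J" if "J \<subseteq> U"
  proof -
    have "closure J \<subseteq> U"
      using that U by (intro closure_minimal) (auto simp: closed_star_algebra_def)
    then show ?thesis using closure_subset_eq[of J] by blast
  qed
  moreover have "(0 \<in> J \<and> (\<forall>x\<in>J. \<forall>y\<in>J. x + y \<in> J) \<and> (\<forall>c. \<forall>x\<in>J. scaleC_op c x \<in> J)) \<longleftrightarrow>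
      subspace J \<and> (\<forall>c. \<forall>x\<in>J. scaleC_op c x \<in> J)"
    using subspaceI_scaleC[of J] by (auto simp: subspace_0 subspace_add)
  ultimately show ?thesis
    unfolding closed_ideal_def csa_closure_operator_algebra by (auto simp del: Int_iff)
qed

section \<open>Representations of operator algebras\<close>

lemma inner_adj: "is_clinear T \<Longrightarrow> inner (adj T x) y = inner x (T y)"
  using cinner_adj_left[of T x y] by (metis Re_cinner)

locale operator_representation =
  fixes M :: "('k::complex_hilbert_space \<Rightarrow>\<^sub>L 'k) set"
    and \<pi> :: "('k \<Rightarrow>\<^sub>L 'k) \<Rightarrow> ('h::complex_hilbert_space \<Rightarrow>\<^sub>L 'h)"
  assumes alg: "closed_star_algebra M"
    and rep: "representation (operator_algebra M) \<pi>"
begin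

lemma clinear: "a \<in> M \<Longrightarrow> is_clinear a"
  and subspace: "subspace M" and closed: "closed M"
  and scaleC_in: "a \<in> M \<Longrightarrow> scaleC_op c a \<in> M"
  and compose_in: "a \<in> M \<Longrightarrow> b \<in> M \<Longrightarrow> a o\<^sub>L b \<in> M"
  and adj_in: "a \<in> M \<Longrightarrow> adj a \<in> M"
  using alg by (auto simp: closed_star_algebra_def)

lemmas add_in = subspace_add[OF subspace] and diff_in = subspace_diff[OF subspace]
  and scaleR_in = subspace_scale[OF subspace] and zero_in = subspace_0[OF subspace]

lemma pi_clinear: "a \<in> M \<Longrightarrow> is_clinear (\<pi> a)"
  and pi_add: "a \<in> M \<Longrightarrow> b \<in> M \<Longrightarrow> \<pi> (a + b) = \<pi> a + \<pi> b"
  and pi_scaleC: "a \<in> M \<Longrightarrow> \<pi> (scaleC_op c a) = scaleC_op c (\<pi> a)"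
  and pi_compose: "a \<in> M \<Longrightarrow> b \<in> M \<Longrightarrow> \<pi> (a o\<^sub>L b) = \<pi> a o\<^sub>L \<pi> b"
  and pi_adj: "a \<in> M \<Longrightarrow> \<pi> (adj a) = adj (\<pi> a)"
  using rep unfolding representation_def bounded_operators_def
  by (auto intro: adj_eqI[symmetric])

lemma pi_scaleR: "a \<in> M \<Longrightarrow> \<pi> (r *\<^sub>R a) = r *\<^sub>R \<pi> a"
  using pi_scaleC[of a "of_real r"] by (simp add: scaleC_op_scaleR)

lemma pi_diff: "a \<in> M \<Longrightarrow> b \<in> M \<Longrightarrow> \<pi> (a - b) = \<pi> a - \<pi> b"
  using pi_add[of a "(-1) *\<^sub>R b"] pi_scaleR[of b "-1"] scaleR_in[of b "-1"] by simp

lemma pi_zero: "\<pi> 0 = 0"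
  using pi_diff[OF zero_in zero_in] by simp

text \<open>
  If \<open>\<parallel>a\<parallel> < 1\<close> then \<open>1 - a\<^sup>* a\<close> has the square root \<open>1 - c\<close>, where \<open>c\<close> solves \<open>2 c = a\<^sup>* a + c\<^sup>2\<close> and is
  found in the algebra as the fixed point of a contraction. Hence \<open>1 - \<pi>(a)\<^sup>* \<pi>(a)\<close> is a square too.
\<close>

lemma pi_norm_le_1:
  assumes a: "a \<in> M" and "norm a < 1"
  shows "norm (\<pi> a) \<le> 1"
proof -
  define x where "x = adj a o\<^sub>L a"
  define r where "r = (norm a)\<^sup>2"
  \<comment> \<open>the smaller root of \<open>\<rho> = (r + \<rho>\<^sup>2) / 2\<close>: the iteration preserves the ball of this radius\<close>
  define \<rho> where "\<rho> = 1 - sqrt (1 - r)"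
  have xM: "x \<in> M" using a by (simp add: x_def compose_in adj_in)
  have xadj: "adj x = x" using clinear[OF a] by (simp add: x_def adj_compose adj_adj is_clinear_adj)
  have r: "0 \<le> r" "r < 1" using assms(2) by (auto simp: r_def power_less_one_iff abs_square_less_1)
  have \<rho>: "0 \<le> \<rho>" "\<rho> < 1" using r by (auto simp: \<rho>_def)
  have "\<rho>\<^sup>2 = 2 * \<rho> - r"
    using r by (simp add: \<rho>_def power2_diff)
  then have \<rho>eq: "r + \<rho> * \<rho> = 2 * \<rho>" by (simp add: power2_eq_square)
  have nx: "norm x \<le> r"
    unfolding x_def r_def power2_eq_square
    using norm_blinfun_compose[of "adj a" a] norm_adj[OF clinear[OF a]] by simp
  define f where "f c = (1/2) *\<^sub>R (x + (c o\<^sub>L c))" for c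
  let ?s = "M \<inter> cball 0 \<rho>"
  have "\<exists>!c\<in>?s. f c = c"
  proof (rule Banach_fix)
    show "complete ?s" using closed by (simp add: complete_eq_closed closed_Int)
    show "?s \<noteq> {}" using zero_in \<rho> by auto
    show "0 \<le> \<rho>" "\<rho> < 1" by (rule \<rho>)+
    show "f ` ?s \<subseteq> ?s"
    proof (rule image_subsetI)
      fix c assume c: "c \<in> ?s"
      have "norm (c o\<^sub>L c) \<le> \<rho> * \<rho>"
        using norm_blinfun_compose[of c c] c mult_mono[of "norm c" \<rho> "norm c" \<rho>] \<rho> by simp
      then have "norm (x + (c o\<^sub>L c)) \<le> 2 * \<rho>"
        using nx norm_triangle_ineq[of x "c o\<^sub>L c"] \<rho>eq by linarith
      then show "f c \<in> ?s" using c xM by (simp add: f_def scaleR_in add_in compose_in)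
    qed
    show "dist (f b) (f c) \<le> \<rho> * dist b c" if "b \<in> ?s" "c \<in> ?s" for b c
    proof -
      have "f b - f c = (1/2) *\<^sub>R ((b o\<^sub>L (b - c)) + ((b - c) o\<^sub>L c))"
        by (simp add: f_def blinfun_compose.diff_left blinfun_compose.diff_right scaleR_diff_right[symmetric])
      moreover have "norm (b o\<^sub>L (b - c)) \<le> \<rho> * norm (b - c)"
        using norm_blinfun_compose[of b "b - c"] mult_right_mono[of "norm b" \<rho> "norm (b - c)"] that
        by simp
      moreover have "norm ((b - c) o\<^sub>L c) \<le> \<rho> * norm (b - c)"
        using norm_blinfun_compose[of "b - c" c] mult_left_mono[of "norm c" \<rho> "norm (b - c)"] that
        by (simp add: mult.commute)
      moreover note norm_triangle_ineq[of "b o\<^sub>L (b - c)" "(b - c) o\<^sub>L c"]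
      ultimately show ?thesis by (simp add: dist_norm)
    qed
  qed
  then obtain c where c: "c \<in> ?s" "f c = c" and uniq: "\<And>c'. c' \<in> ?s \<Longrightarrow> f c' = c' \<Longrightarrow> c' = c" by blast
  have cM: "c \<in> M" and clc: "is_clinear c" using c clinear by auto
  have "f (adj c) = adj (f c)"
    using clc clinear[OF xM]
    by (simp add: f_def adj_scaleR adj_add adj_compose is_clinear_add is_clinear_compose xadj)
  \<comment> \<open>the adjoint of the fixed point solves the same equation\<close>
  then have "adj c = c" using c cM by (intro uniq) (simp_all add: adj_in norm_adj clc)
  then have Cadj: "adj (\<pi> c) = \<pi> c" using pi_adj[OF cM] by simp
  have "x = 2 *\<^sub>R c - (c o\<^sub>L c)"
    using arg_cong[OF c(2), of "\<lambda>t. 2 *\<^sub>R t"] by (simp add: f_def algebra_simps)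
  then have px: "\<pi> x = 2 *\<^sub>R \<pi> c - (\<pi> c o\<^sub>L \<pi> c)"
    using cM by (simp add: pi_diff pi_scaleR pi_compose scaleR_in compose_in)
  show ?thesis
  proof (rule norm_blinfun_bound)
    fix v
    have sym: "inner v (\<pi> c w) = inner (\<pi> c v) w" for w
      using inner_adj[OF pi_clinear[OF cM], of v w] Cadj by simp
    have "(norm (\<pi> a v))\<^sup>2 = inner v (\<pi> x v)"
      using inner_adj[OF is_clinear_adj[OF pi_clinear[OF a]], of v "\<pi> a v"]
      by (simp add: power2_norm_eq_inner x_def pi_compose pi_adj adj_in a adj_adj pi_clinear)
    also have "\<dots> = 2 * inner v (\<pi> c v) - inner (\<pi> c v) (\<pi> c v)"
      by (simp add: px blinfun.diff_left blinfun.scaleR_left inner_diff_right sym)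
    also have "\<dots> = (norm v)\<^sup>2 - (norm (v - \<pi> c v))\<^sup>2"
      by (simp add: power2_norm_eq_inner inner_diff_left inner_diff_right inner_commute)
    also have "\<dots> \<le> (norm v)\<^sup>2" by simp
    finally show "norm (\<pi> a v) \<le> 1 * norm v" by (simp add: power2_le_iff_abs_le)
  qed simp
qed

lemma pi_contractive:
  assumes a: "a \<in> M"
  shows "norm (\<pi> a) \<le> norm a"
proof (rule field_le_epsilon)
  fix e :: real assume "e > 0"
  define t where "t = norm a + e"
  have t: "t > 0" using \<open>e > 0\<close> by (simp add: t_def add_nonneg_pos)
  have "norm ((1/t) *\<^sub>R a) < 1" using t \<open>e > 0\<close> by (simp add: t_def field_simps)
  then have "norm (\<pi> ((1/t) *\<^sub>R a)) \<le> 1" using a by (intro pi_norm_le_1 scaleR_in)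
  then show "norm (\<pi> a) \<le> norm a + e" using t a by (simp add: pi_scaleR field_simps t_def)
qed

lemma pi_tendsto:
  assumes "\<And>n. X n \<in> M" "X \<longlonglongrightarrow> L"
  shows "(\<lambda>n. \<pi> (X n)) \<longlonglongrightarrow> \<pi> L"
proof -
  have L: "L \<in> M" using closed_sequentially[OF closed assms] .
  have "(\<lambda>n. X n - L) \<longlonglongrightarrow> 0" using assms(2) by (simp add: LIM_zero)
  then have "(\<lambda>n. \<pi> (X n - L)) \<longlonglongrightarrow> 0"
    by (rule Lim_transform_bound[rotated]) (auto intro!: always_eventually pi_contractive diff_in assms L)
  then show ?thesis using assms(1) L by (simp add: pi_diff LIM_zero_iff)
qed

lemma pi_closure_span:
  assumes A: "A \<subseteq> M" and x: "x \<in> closure (span A)"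
    and N: "subspace N" "closed N" and "\<And>a. a \<in> A \<Longrightarrow> \<pi> a \<in> N"
  shows "\<pi> x \<in> N"
proof -
  have sp: "y \<in> M \<and> \<pi> y \<in> N" if "y \<in> span A" for y
    using that
  proof (induction rule: span_induct_alt)
    case base
    show ?case by (simp add: pi_zero subspace_0 N zero_in)
  next
    case (step c a y)
    then have aM: "a \<in> M" "\<pi> a \<in> N" using A assms(5) by auto
    with step have "\<pi> (c *\<^sub>R a + y) = c *\<^sub>R \<pi> a + \<pi> y" by (simp add: pi_add pi_scaleR scaleR_in)
    then show ?case
      using aM step(2) subspace_add[OF N(1) subspace_scale[OF N(1) aM(2)]] scaleR_in add_in by simp
  qed
  obtain X where X: "\<And>n. X n \<in> span A" "X \<longlonglongrightarrow> x" using x by (auto simp: closure_sequential)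
  have "(\<lambda>n. \<pi> (X n)) \<longlonglongrightarrow> \<pi> x" by (rule pi_tendsto[OF _ X(2)]) (simp add: sp X(1))
  then show ?thesis by (rule closed_sequentially[OF N(2), rotated]) (simp add: sp X(1))
qed

text \<open>
  The solution is \<open>b = a (1 + a\<^sup>* a)\<^sup>-\<^sup>1\<close>. Its use is that its norm is at most \<open>1/2\<close> whatever \<open>a\<close> is,
  while it differs from \<open>a\<close> only by \<open>b a\<^sup>* a\<close>; both survive in a representation, where \<open>\<pi>(a)\<close> may
  be much smaller than \<open>a\<close>.
\<close>

lemma damped_exists:
  assumes a: "a \<in> M"
  shows "\<exists>b\<in>M. b + (b o\<^sub>L (adj a o\<^sub>L a)) = a"
proof -
  define m where "m = (norm a)\<^sup>2"
  define x where "x = adj a o\<^sub>L a"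
  have m: "m \<ge> 0" by (simp add: m_def)
  have xM: "x \<in> M" using a by (simp add: x_def compose_in adj_in)
  have nrm: "norm (m *\<^sub>R id_blinfun - x) \<le> m"
  proof (rule norm_blinfun_bound[OF m])
    fix v
    have ax: "inner v (x v) = (norm (a v))\<^sup>2"
      using inner_adj[OF clinear[OF a], of "a v" v]
      by (simp only: x_def blinfun_apply_blinfun_compose power2_norm_eq_inner
          inner_commute[of v "adj a (a v)"])
    have "norm (x v) \<le> norm a * norm (a v)"
      using norm_blinfun[of "adj a" "a v"] norm_adj[OF clinear[OF a]] by (simp add: x_def)
    then have "(norm (x v))\<^sup>2 \<le> m * (norm (a v))\<^sup>2"
      unfolding m_def power_mult_distrib[symmetric] by (rule power_mono) simp
    moreover have "(norm ((m *\<^sub>R id_blinfun - x) v))\<^sup>2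
        = m\<^sup>2 * (norm v)\<^sup>2 - 2 * m * (norm (a v))\<^sup>2 + (norm (x v))\<^sup>2"
    proof -
      have expand: "(norm (m *\<^sub>R v - y))\<^sup>2 = m\<^sup>2 * (norm v)\<^sup>2 - 2 * m * inner v y + (norm y)\<^sup>2" for y
        unfolding power2_norm_eq_inner inner_diff_left inner_diff_right inner_scaleR_left
          inner_scaleR_right inner_commute[of y v] power2_eq_square[of m] by (simp add: algebra_simps)
      have "(m *\<^sub>R id_blinfun - x) v = m *\<^sub>R v - x v"
        by (simp add: blinfun.diff_left blinfun.scaleR_left)
      then show ?thesis using expand[of "x v"] by (simp only: ax)
    qed
    moreover have "0 \<le> m * (norm (a v))\<^sup>2" using m by simp
    ultimately have "(norm ((m *\<^sub>R id_blinfun - x) v))\<^sup>2 \<le> (m * norm v)\<^sup>2"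
      unfolding power_mult_distrib by linarith
    then show "norm ((m *\<^sub>R id_blinfun - x) v) \<le> m * norm v"
      by (rule power2_le_imp_le) (use m in simp)
  qed
  \<comment> \<open>adding \<open>m b\<close> to both sides of the equation makes it a contraction with factor \<open>m / (1 + m)\<close>\<close>
  define f where "f b = (1 / (1 + m)) *\<^sub>R (a + (m *\<^sub>R b - (b o\<^sub>L x)))" for b
  have "\<exists>!b\<in>M. f b = b"
  proof (rule Banach_fix)
    show "complete M" using closed by (simp add: complete_eq_closed)
    show "M \<noteq> {}" using zero_in by auto
    show "0 \<le> m / (1 + m)" "m / (1 + m) < 1" using m by auto
    show "f ` M \<subseteq> M" using a xM by (auto simp: f_def scaleR_in add_in diff_in compose_in)
    show "dist (f b) (f c) \<le> m / (1 + m) * dist b c" for b c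
    proof -
      have "f b - f c = (1 / (1 + m)) *\<^sub>R ((b - c) o\<^sub>L (m *\<^sub>R id_blinfun - x))"
      proof -
        have "(b - c) o\<^sub>L (m *\<^sub>R id_blinfun - x) = m *\<^sub>R (b - c) - ((b o\<^sub>L x) - (c o\<^sub>L x))"
          by (rule blinfun_eqI)
             (simp add: blinfun.diff_left blinfun.diff_right blinfun.scaleR_left blinfun.scaleR_right)
        also have "\<dots> = (a + (m *\<^sub>R b - (b o\<^sub>L x))) - (a + (m *\<^sub>R c - (c o\<^sub>L x)))"
          by (simp add: scaleR_diff_right)
        finally show ?thesis by (simp only: f_def scaleR_diff_right[symmetric])
      qed
      then have "dist (f b) (f c) = 1 / (1 + m) * norm ((b - c) o\<^sub>L (m *\<^sub>R id_blinfun - x))"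
        using m by (simp add: dist_norm)
      also have "\<dots> \<le> 1 / (1 + m) * (norm (b - c) * m)"
        using m nrm by (intro mult_left_mono order_trans[OF norm_blinfun_compose]) auto
      finally show ?thesis by (simp add: dist_norm mult.commute)
    qed
  qed
  then obtain b where b: "b \<in> M" "f b = b" by blast
  have "a + (m *\<^sub>R b - (b o\<^sub>L x)) = (1 + m) *\<^sub>R f b" using m by (simp add: f_def)
  then have "a + (m *\<^sub>R b - (b o\<^sub>L x)) = b + m *\<^sub>R b" by (simp only: b(2) scaleR_left_distrib scaleR_one)
  then have "b + (b o\<^sub>L x) = a" by (simp add: algebra_simps)
  then show ?thesis using b(1) by (auto simp: x_def)
qed

end

text \<open>
  With \<open>w = b\<^sup>* v\<close> the equation gives \<open>\<parallel>w\<parallel>\<^sup>2 + t\<^sup>2 = \<langle>v, a w\<rangle> \<le> \<parallel>v\<parallel> t\<close> for \<open>t = \<parallel>a w\<parallel>\<close>, and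
  \<open>\<parallel>v\<parallel> t - t\<^sup>2\<close> is at most \<open>\<parallel>v\<parallel>\<^sup>2 / 4\<close>.
\<close>

lemma damped_norm_le:
  fixes a b :: "'h::complex_hilbert_space \<Rightarrow>\<^sub>L 'h"
  assumes a: "is_clinear a" and b: "is_clinear b" and eq: "b + (b o\<^sub>L (adj a o\<^sub>L a)) = a"
  shows "norm b \<le> 1/2"
proof -
  have "norm (adj b) \<le> 1/2"
  proof (rule norm_blinfun_bound)
    fix v
    define w where "w = adj b v"
    have "adj a = adj b + (adj a o\<^sub>L a o\<^sub>L adj b)"
      using arg_cong[OF eq, of adj] a b
      by (simp add: adj_add adj_compose is_clinear_compose is_clinear_adj adj_adj)
    then have "adj a v = w + adj a (a w)"
      by (metis blinfun.add_left blinfun_apply_blinfun_compose w_def)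
    then have "inner (adj a v) w = (norm w)\<^sup>2 + (norm (a w))\<^sup>2"
      using inner_adj[OF a, of "a w" w] by (simp add: inner_add_left power2_norm_eq_inner)
    then have "(norm w)\<^sup>2 + (norm (a w))\<^sup>2 = inner v (a w)" by (simp add: inner_adj a)
    also have "\<dots> \<le> norm v * norm (a w)" by (rule norm_cauchy_schwarz)
    also have "\<dots> \<le> (norm (a w))\<^sup>2 + (1/2 * norm v)\<^sup>2"
      using zero_le_power2[of "norm (a w) - 1/2 * norm v"]
      by (simp add: power2_eq_square algebra_simps)
    finally have "(norm w)\<^sup>2 \<le> (1/2 * norm v)\<^sup>2" by simp
    then show "norm (adj b v) \<le> 1/2 * norm v"
      unfolding w_def by (rule power2_le_imp_le) simp
  qed simp
  then show ?thesis using norm_adj[OF b] by simp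
qed

context operator_representation
begin

lemma controlled_lift_unit:
  assumes R: "R \<in> \<pi> ` M" and "norm R \<le> 1"
  shows "\<exists>b\<in>M. norm b \<le> 1/2 \<and> norm (R - \<pi> b) \<le> 1/2"
proof -
  obtain a where a: "a \<in> M" "R = \<pi> a" using R by auto
  obtain b where b: "b \<in> M" "b + (b o\<^sub>L (adj a o\<^sub>L a)) = a" using damped_exists[OF a(1)] by blast
  have eq: "\<pi> b + (\<pi> b o\<^sub>L (adj R o\<^sub>L R)) = R"
    using arg_cong[OF b(2), of \<pi>] a b(1)
    by (simp add: pi_add pi_compose pi_adj compose_in adj_in)
  have nb: "norm (\<pi> b) \<le> 1/2"
    by (rule damped_norm_le[OF _ _ eq]) (simp_all add: a b pi_clinear)
  have "norm (adj R o\<^sub>L R) \<le> norm R * norm R"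
    using norm_blinfun_compose[of "adj R" R] by (simp add: norm_adj a pi_clinear)
  also have "\<dots> \<le> 1" using assms(2) by (simp add: mult_le_one)
  finally have n1: "norm (adj R o\<^sub>L R) \<le> 1" .
  have "norm (R - \<pi> b) = norm (\<pi> b o\<^sub>L (adj R o\<^sub>L R))"
    using arg_cong[OF eq, of "\<lambda>t. t - \<pi> b"] by simp
  also have "\<dots> \<le> norm (\<pi> b) * norm (adj R o\<^sub>L R)" by (rule norm_blinfun_compose)
  also have "\<dots> \<le> 1/2 * 1" using nb n1 by (intro mult_mono) auto
  finally have "norm (R - \<pi> b) \<le> 1/2" by simp
  moreover have "norm b \<le> 1/2"
    by (rule damped_norm_le[OF _ _ b(2)]) (simp_all add: a b clinear)
  ultimately show ?thesis using b(1) by blast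
qed

text \<open>
  An element \<open>R\<close> of the range within \<open>t/4\<close> of \<open>D\<close> has norm at most \<open>5/4 t\<close>; lifting \<open>R\<close> up to half of
  that leaves the error \<open>1/4 t + 5/8 t\<close>. A factor below \<open>1\<close> is what lets the errors be summed.
\<close>

lemma controlled_lift:
  assumes D: "D \<in> closure (\<pi> ` M)" and "norm D \<le> t" "t > 0"
  shows "\<exists>b\<in>M. norm b \<le> t \<and> norm (D - \<pi> b) \<le> 7/8 * t"
proof -
  obtain R where R: "R \<in> \<pi> ` M" "dist R D < t/4"
    using D \<open>t > 0\<close> unfolding closure_approachable by (meson zero_less_divide_iff zero_less_numeral)
  define s where "s = 5/4 * t"
  have s: "s > 0" using \<open>t > 0\<close> by (simp add: s_def)
  have "norm R \<le> s"
    using R(2) assms(2) norm_triangle_ineq[of "R - D" D] by (simp add: dist_norm s_def)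
  then have "norm ((1/s) *\<^sub>R R) \<le> 1" using s by (simp add: field_simps)
  moreover have "(1/s) *\<^sub>R R \<in> \<pi> ` M" using R(1) by (auto simp: pi_scaleR[symmetric] scaleR_in)
  ultimately obtain b where b: "b \<in> M" "norm b \<le> 1/2" "norm ((1/s) *\<^sub>R R - \<pi> b) \<le> 1/2"
    using controlled_lift_unit by blast
  have "R - \<pi> (s *\<^sub>R b) = s *\<^sub>R ((1/s) *\<^sub>R R - \<pi> b)"
    using s b(1) by (simp add: pi_scaleR scaleR_diff_right)
  then have "norm (R - \<pi> (s *\<^sub>R b)) \<le> s/2" using s b(3) by simp
  moreover have "norm (D - \<pi> (s *\<^sub>R b)) \<le> norm (D - R) + norm (R - \<pi> (s *\<^sub>R b))"
    using norm_triangle_ineq[of "D - R" "R - \<pi> (s *\<^sub>R b)"] by simp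
  ultimately have "norm (D - \<pi> (s *\<^sub>R b)) \<le> 7/8 * t"
    using R(2) by (simp add: dist_norm norm_minus_commute s_def)
  moreover have "norm (s *\<^sub>R b) \<le> t" using b(2) s \<open>t > 0\<close> by (simp add: s_def)
  ultimately show ?thesis using b(1) by (intro bexI[of _ "s *\<^sub>R b"]) (auto simp: scaleR_in)
qed

text \<open>
  Lifting a point of the closure, then the remaining error, and so on, gives lifts whose norms decrease
  geometrically; their sum converges in the algebra and is a preimage.
\<close>

theorem range_closed: "closed (\<pi> ` M)"
proof (unfold closure_subset_eq[symmetric], rule subsetI)
  fix T assume T: "T \<in> closure (\<pi> ` M)"
  define t where "t n = (norm T + 1) * (7/8) ^ n" for n :: nat
  have t: "t n > 0" for n by (simp add: t_def add_nonneg_pos)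
  have step: "\<exists>s'. (s' \<in> M \<and> norm (T - \<pi> s') \<le> t (Suc n)) \<and> norm (s' - s) \<le> t n"
    if s: "s \<in> M \<and> norm (T - \<pi> s) \<le> t n" for s n
  proof -
    have "T - \<pi> s \<in> closure (\<pi> ` M)"
    proof -
      obtain Y where Y: "\<And>n. Y n \<in> \<pi> ` M" "Y \<longlonglongrightarrow> T" using T by (auto simp: closure_sequential)
      then have "(\<lambda>n. Y n - \<pi> s) \<longlonglongrightarrow> T - \<pi> s" by (intro tendsto_diff) auto
      moreover have "Y n - \<pi> s \<in> \<pi> ` M" for n
        using Y(1)[of n] s by (auto simp: pi_diff[symmetric] diff_in)
      ultimately show ?thesis unfolding closure_sequential by (intro exI[of _ "\<lambda>n. Y n - \<pi> s"]) simp
    qed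
    then obtain b where "b \<in> M" "norm b \<le> t n" "norm (T - \<pi> s - \<pi> b) \<le> 7/8 * t n"
      using controlled_lift[OF _ _ t] s by blast
    then show ?thesis using s
      by (intro exI[of _ "s + b"]) (auto simp: pi_add add_in t_def algebra_simps)
  qed
  have "\<exists>s. \<forall>n. (s n \<in> M \<and> norm (T - \<pi> (s n)) \<le> t n) \<and> norm (s (Suc n) - s n) \<le> t n"
    by (rule dependent_nat_choice) (use step in \<open>auto simp: t_def pi_zero intro!: exI[of _ 0] zero_in\<close>)
  then obtain s where s: "\<And>n. s n \<in> M" "\<And>n. norm (T - \<pi> (s n)) \<le> t n"
    "\<And>n. norm (s (Suc n) - s n) \<le> t n" by blast
  have "summable t" unfolding t_def by (intro summable_mult summable_geometric) simp
  then have "t \<longlonglongrightarrow> 0" by (rule summable_LIMSEQ_zero)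
  have "summable (\<lambda>n. s (Suc n) - s n)"
    by (rule summable_comparison_test'[OF \<open>summable t\<close> s(3)])
  then have "(\<lambda>n. \<Sum>i<n. s (Suc i) - s i) \<longlonglongrightarrow> (\<Sum>i. s (Suc i) - s i)"
    by (rule summable_LIMSEQ)
  then have "(\<lambda>n. s n - s 0) \<longlonglongrightarrow> (\<Sum>i. s (Suc i) - s i)"
    by (simp add: sum_lessThan_telescope)
  then have "(\<lambda>n. (s n - s 0) + s 0) \<longlonglongrightarrow> (\<Sum>i. s (Suc i) - s i) + s 0"
    by (intro tendsto_add tendsto_const)
  then obtain L where L: "s \<longlonglongrightarrow> L" by auto
  have "(\<lambda>n. \<pi> (s n)) \<longlonglongrightarrow> \<pi> L" using s(1) L by (rule pi_tendsto)
  moreover have "(\<lambda>n. \<pi> (s n)) \<longlonglongrightarrow> T"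
  proof -
    have "(\<lambda>n. T - \<pi> (s n)) \<longlonglongrightarrow> 0"
      by (rule Lim_null_comparison[OF _ \<open>t \<longlonglongrightarrow> 0\<close>]) (simp add: s(2) always_eventually)
    then have "(\<lambda>n. T - (T - \<pi> (s n))) \<longlonglongrightarrow> T - 0" by (intro tendsto_diff tendsto_const)
    then show ?thesis by simp
  qed
  ultimately have "T = \<pi> L" by (rule LIMSEQ_unique[rotated])
  then show "T \<in> \<pi> ` M" using closed_sequentially[OF closed s(1) L] by blast
qed

end

section \<open>Irreducible representations with a minimal projection\<close>

locale irreducible_operator_representation = operator_representation +
  assumes irred: "irreducible_representation (operator_algebra M) \<pi>"
begin

lemma nontrivial: "\<exists>a\<in>M. \<pi> a \<noteq> 0"
  using irred by (simp add: irreducible_representation_def bounded_operators_def)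

lemma invariant_subspace_trivial:
  assumes "closed_csubspace V" "\<And>a v. a \<in> M \<Longrightarrow> v \<in> V \<Longrightarrow> \<pi> a v \<in> V" "\<xi> \<in> V" "\<xi> \<noteq> 0"
  shows "V = UNIV"
  using irred assms by (auto simp: irreducible_representation_def bounded_operators_def)

lemma orbit_dense:
  assumes e: "e \<in> M" "\<pi> e \<xi> = \<xi>" and \<xi>: "\<xi> \<noteq> 0"
  shows "closure ((\<lambda>a. \<pi> a \<xi>) ` M) = UNIV"
proof (rule invariant_subspace_trivial)
  let ?O = "(\<lambda>a. \<pi> a \<xi>) ` M"
  show "closed_csubspace (closure ?O)"
    unfolding closed_csubspace_def
  proof (intro conjI ballI allI)
    show "0 \<in> closure ?O"
      using closure_subset zero_in pi_zero by (force simp: image_iff)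
    show "x + y \<in> closure ?O" if xy: "x \<in> closure ?O" "y \<in> closure ?O" for x y
    proof -
      obtain f where f: "\<And>n. f n \<in> ?O" "f \<longlonglongrightarrow> x" using xy(1) unfolding closure_sequential by blast
      obtain g where g: "\<And>n. g n \<in> ?O" "g \<longlonglongrightarrow> y" using xy(2) unfolding closure_sequential by blast
      have "f n + g n \<in> ?O" for n
      proof -
        obtain a b where "a \<in> M" "b \<in> M" "f n = \<pi> a \<xi>" "g n = \<pi> b \<xi>"
          using f(1)[of n] g(1)[of n] by auto
        then show ?thesis
          by (intro image_eqI[of _ _ "a + b"]) (simp_all add: pi_add blinfun.add_left add_in)
      qed
      then show ?thesis
        using tendsto_add[OF f(2) g(2)] unfolding closure_sequential by (intro exI[of _ "\<lambda>n. f n + g n"]) simp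
    qed
    show "c *\<^sub>C x \<in> closure ?O" if x: "x \<in> closure ?O" for c x
    proof -
      obtain f where f: "\<And>n. f n \<in> ?O" "f \<longlonglongrightarrow> x" using x unfolding closure_sequential by blast
      have "c *\<^sub>C f n \<in> ?O" for n
      proof -
        obtain a where "a \<in> M" "f n = \<pi> a \<xi>" using f(1)[of n] by auto
        then show ?thesis
          by (intro image_eqI[of _ _ "scaleC_op c a"]) (simp_all add: pi_scaleC scaleC_op_apply scaleC_in)
      qed
      then show ?thesis
        using bounded_linear.tendsto[OF bounded_linear_scaleC f(2)]
        unfolding closure_sequential by (intro exI[of _ "\<lambda>n. c *\<^sub>C f n"]) simp
    qed
  qed simp
  show "\<pi> a v \<in> closure ?O" if av: "a \<in> M" "v \<in> closure ?O" for a v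
  proof -
    obtain f where f: "\<And>n. f n \<in> ?O" "f \<longlonglongrightarrow> v" using av(2) unfolding closure_sequential by blast
    have "\<pi> a (f n) \<in> ?O" for n
    proof -
      obtain b where "b \<in> M" "f n = \<pi> b \<xi>" using f(1)[of n] by auto
      then show ?thesis using av(1)
        by (intro image_eqI[of _ _ "a o\<^sub>L b"]) (simp_all add: pi_compose compose_in)
    qed
    then show ?thesis
      using blinfun.tendsto[OF tendsto_const f(2), of "\<pi> a"]
      unfolding closure_sequential by (intro exI[of _ "\<lambda>n. \<pi> a (f n)"]) simp
  qed
  show "\<xi> \<in> closure ?O" using e closure_subset by (force simp: image_iff)
qed (rule \<xi>)

lemma eq_on_dense:
  fixes f g :: "'b \<Rightarrow> 'x::real_normed_vector"
  assumes "bounded_linear f" "bounded_linear g" "closure ((\<lambda>a. \<pi> a \<xi>) ` M) = UNIV"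
    "\<And>a. a \<in> M \<Longrightarrow> f (\<pi> a \<xi>) = g (\<pi> a \<xi>)"
  shows "f v = g v"
proof -
  have "closed {v. f v = g v}"
    by (intro closed_Collect_eq linear_continuous_on assms)
  then have "closure ((\<lambda>a. \<pi> a \<xi>) ` M) \<subseteq> {v. f v = g v}"
    using assms(4) by (intro closure_minimal) auto
  then show ?thesis using assms(3) by auto
qed

text \<open>
  If a projection \<open>e\<close> of the algebra has a scalar corner, its image is the projection onto a line, and
  translating it around by irreducibility produces every rank one operator.
\<close>

theorem compacts_in_range:
  assumes e: "e \<in> M" "adj e = e" "e o\<^sub>L e = e" and ne: "\<pi> e \<noteq> 0"
    and corner: "\<And>a. a \<in> M \<Longrightarrow> \<exists>c. \<pi> (e o\<^sub>L a o\<^sub>L e) = scaleC_op c (\<pi> e)"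
  shows "compact_operators \<subseteq> \<pi> ` M"
proof -
  let ?P = "\<pi> e"
  have adjP: "adj ?P = ?P" using pi_adj[OF e(1)] e(2) by simp
  have PP: "?P (?P v) = ?P v" for v
    using pi_compose[OF e(1) e(1)] e(3) by (metis blinfun_apply_blinfun_compose)
  obtain \<xi>0 where "?P \<xi>0 \<noteq> 0" using ne by (metis blinfun_eqI zero_blinfun.rep_eq)
  define \<xi> where "\<xi> = (1 / norm (?P \<xi>0)) *\<^sub>R ?P \<xi>0"
  have \<xi>: "norm \<xi> = 1" "?P \<xi> = \<xi>" using \<open>?P \<xi>0 \<noteq> 0\<close> by (simp_all add: \<xi>_def blinfun.scaleR_right PP)
  have dense: "closure ((\<lambda>a. \<pi> a \<xi>) ` M) = UNIV" using \<xi> e(1) by (intro orbit_dense[of e]) auto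
  have "?P v = rank_one \<xi> \<xi> v" for v
  proof (rule eq_on_dense[OF _ _ dense, where f = "blinfun_apply ?P" and g = "blinfun_apply (rank_one \<xi> \<xi>)"])
    fix a assume a: "a \<in> M"
    obtain c where c: "\<pi> (e o\<^sub>L a o\<^sub>L e) = scaleC_op c ?P" using corner[OF a] by blast
    have "?P (\<pi> a \<xi>) = \<pi> (e o\<^sub>L a o\<^sub>L e) \<xi>" by (simp add: pi_compose compose_in e a \<xi>)
    also have "\<dots> = c *\<^sub>C \<xi>" by (simp add: c scaleC_op_apply \<xi>)
    finally have P: "?P (\<pi> a \<xi>) = c *\<^sub>C \<xi>" .
    have "cinner \<xi> (\<pi> a \<xi>) = cinner \<xi> (?P (\<pi> a \<xi>))"
      using cinner_adj_left[OF pi_clinear[OF e(1)], of \<xi> "\<pi> a \<xi>"] by (simp add: adjP \<xi>)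
    also have "\<dots> = c" by (simp add: P cinner_scaleC_right cinner_self \<xi>)
    finally show "?P (\<pi> a \<xi>) = rank_one \<xi> \<xi> (\<pi> a \<xi>)" by (simp add: P rank_one_apply)
  qed (rule blinfun.bounded_linear_right)+
  then have P: "?P = rank_one \<xi> \<xi>" by (rule blinfun_eqI)
  have r1: "rank_one (\<pi> a \<xi>) (\<pi> b \<xi>) \<in> \<pi> ` M" if "a \<in> M" "b \<in> M" for a b
  proof -
    have "\<pi> (a o\<^sub>L e o\<^sub>L adj b) = rank_one (\<pi> a \<xi>) (\<pi> b \<xi>)"
      using that e(1)
      by (simp add: pi_compose compose_in adj_in pi_adj P compose_rank_one rank_one_compose
          pi_clinear is_clinear_adj adj_adj)
    then show ?thesis using that e(1) by (intro image_eqI[of _ _ "a o\<^sub>L e o\<^sub>L adj b"]) (simp_all add: compose_in adj_in)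
  qed
  have r2: "rank_one \<eta> (\<pi> b \<xi>) \<in> \<pi> ` M" if "b \<in> M" for \<eta> b
  proof -
    have "closed ((\<lambda>\<eta>. rank_one \<eta> (\<pi> b \<xi>)) -` (\<pi> ` M))"
      by (intro closed_vimage range_closed linear_continuous_on
          bounded_bilinear.bounded_linear_left[OF bounded_bilinear_rank_one])
    then have "closure ((\<lambda>a. \<pi> a \<xi>) ` M) \<subseteq> (\<lambda>\<eta>. rank_one \<eta> (\<pi> b \<xi>)) -` (\<pi> ` M)"
      using r1 that by (intro closure_minimal) auto
    then show ?thesis unfolding dense by auto
  qed
  have r3: "rank_one \<eta> \<zeta> \<in> \<pi> ` M" for \<eta> \<zeta>
  proof -
    have "closed ((\<lambda>\<zeta>. rank_one \<eta> \<zeta>) -` (\<pi> ` M))"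
      by (intro closed_vimage range_closed linear_continuous_on
          bounded_bilinear.bounded_linear_right[OF bounded_bilinear_rank_one])
    then have "closure ((\<lambda>a. \<pi> a \<xi>) ` M) \<subseteq> (\<lambda>\<zeta>. rank_one \<eta> \<zeta>) -` (\<pi> ` M)"
      using r2 by (intro closure_minimal) auto
    then show ?thesis unfolding dense by auto
  qed
  have "subspace (\<pi> ` M)"
    unfolding subspace_def
    by (auto simp: pi_add[symmetric] pi_scaleR[symmetric] add_in scaleR_in
        intro!: image_eqI[of _ _ 0] simp: pi_zero zero_in)
  then show ?thesis
    unfolding compact_operators_eq using r3
    by (intro closure_span_minimal range_closed) (auto simp: rank_ones_def)
qed

text \<open>
  A non-zero vector fixed by \<open>\<pi>(b)\<close> is cyclic, so the corner moves it to a dense subset of the range of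
  \<open>\<pi>(e)\<close>; since \<open>\<pi>(b)\<close> commutes with the corner, it fixes that range pointwise.
\<close>

lemma commuting_subprojection:
  assumes e: "e \<in> M" and b: "b \<in> M" "b o\<^sub>L b = b" "e o\<^sub>L b = b" "b o\<^sub>L e = b"
    and comm: "\<And>a. a \<in> M \<Longrightarrow>
      \<pi> b o\<^sub>L \<pi> (e o\<^sub>L a o\<^sub>L e) = \<pi> (e o\<^sub>L a o\<^sub>L e) o\<^sub>L \<pi> b"
  shows "\<pi> b = 0 \<or> \<pi> b = \<pi> e"
proof (rule disjCI)
  assume "\<pi> b \<noteq> \<pi> e"
  show "\<pi> b = 0"
  proof (rule ccontr)
    assume "\<pi> b \<noteq> 0"
    then obtain \<xi>0 where nz: "\<pi> b \<xi>0 \<noteq> 0" by (metis blinfun_eqI zero_blinfun.rep_eq)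
    have pb: "\<pi> b (\<pi> b v) = \<pi> b v" "\<pi> e (\<pi> b v) = \<pi> b v" "\<pi> b (\<pi> e v) = \<pi> b v" for v
      using b e by (metis blinfun_apply_blinfun_compose pi_compose)+
    define \<xi> where "\<xi> = \<pi> b \<xi>0"
    have \<xi>: "\<xi> \<noteq> 0" "\<pi> b \<xi> = \<xi>" "\<pi> e \<xi> = \<xi>" by (simp_all add: \<xi>_def nz pb)
    have dense: "closure ((\<lambda>a. \<pi> a \<xi>) ` M) = UNIV" using \<xi> e by (intro orbit_dense[of e]) auto
    have "(\<pi> b o\<^sub>L \<pi> e) v = \<pi> e v" for v
    proof (rule eq_on_dense[OF _ _ dense, where f = "blinfun_apply (\<pi> b o\<^sub>L \<pi> e)" and g = "blinfun_apply (\<pi> e)"])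
      fix a assume a: "a \<in> M"
      have E: "\<pi> e (\<pi> a \<xi>) = \<pi> (e o\<^sub>L a o\<^sub>L e) \<xi>" by (simp add: pi_compose compose_in e a \<xi>)
      have "\<pi> b (\<pi> (e o\<^sub>L a o\<^sub>L e) \<xi>) = \<pi> (e o\<^sub>L a o\<^sub>L e) (\<pi> b \<xi>)"
        using comm[OF a] by (metis blinfun_apply_blinfun_compose)
      then show "(\<pi> b o\<^sub>L \<pi> e) (\<pi> a \<xi>) = \<pi> e (\<pi> a \<xi>)" by (simp add: E \<xi>)
    qed (rule blinfun.bounded_linear_right)+
    then have "\<pi> b = \<pi> e" by (intro blinfun_eqI) (simp add: pb)
    then show False using \<open>\<pi> b \<noteq> \<pi> e\<close> by simp
  qed
qed

end

text \<open>
  If \<open>P v \<noteq> 0\<close>, the multiples of \<open>P\<close> are the operators with \<open>T = \<phi>(T) P\<close>, where the bounded functional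
  \<open>\<phi>\<close> reads the factor off from \<open>T v\<close>; this is a closed condition on \<open>T\<close>.
\<close>

lemma complex_line_closed_subspace:
  fixes P :: "'h::complex_hilbert_space \<Rightarrow>\<^sub>L 'h"
  shows "subspace {scaleC_op c P | c. True}" "closed {scaleC_op c P | c. True}"
proof -
  let ?L = "{scaleC_op c P | c. True}"
  have add: "scaleC_op c P + scaleC_op d P = scaleC_op (c + d) P" for c d
    by (rule blinfun_eqI) (simp add: scaleC_op_apply blinfun.add_left scaleC_add_left)
  have sc: "r *\<^sub>R scaleC_op c P = scaleC_op (of_real r * c) P" for r c
    by (rule blinfun_eqI) (simp add: scaleC_op_apply blinfun.scaleR_left scaleC_scaleC scaleC_of_real[symmetric])
  have zero: "0 = scaleC_op 0 P" by (rule blinfun_eqI) (simp add: scaleC_op_apply)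
  show "subspace ?L" unfolding subspace_def using add sc zero by auto
  show "closed ?L"
  proof (cases "P = 0")
    case True
    then have "?L = {0}" by (auto intro!: blinfun_eqI exI[of _ 0] simp: scaleC_op_apply)
    then show ?thesis by simp
  next
    case False
    then obtain v where v: "P v \<noteq> 0" by (metis blinfun_eqI zero_blinfun.rep_eq)
    define \<phi> where "\<phi> T = cinner (P v) (blinfun_apply T v) / (norm (P v))\<^sup>2" for T :: "'h \<Rightarrow>\<^sub>L 'h"
    have "?L = {T. T = scaleC_op (\<phi> T) P}"
      using v by (auto simp: \<phi>_def scaleC_op_apply cinner_scaleC_right cinner_self)
    moreover have "closed {T. T = scaleC_op (\<phi> T) P}"
    proof -
      have l1: "bounded_linear (\<lambda>y. cinner (P v) y)"
        by (rule bounded_linear_intro[where K = "norm (P v)"])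
           (auto simp: cinner_add_right cinner_scaleR_right scaleR_conv_of_real
             mult.commute[of "norm _" "norm (P v)"] cinner_Cauchy_Schwarz)
      have "bounded_linear (\<lambda>c. scaleC_op c P)"
        by (rule bounded_linear_intro[where K = "norm P"])
           (auto simp: add sc scaleR_conv_of_real intro!: norm_blinfun_bound
             simp: scaleC_op_apply norm_scaleC mult.assoc intro!: mult_left_mono norm_blinfun)
      moreover have "bounded_linear (\<lambda>T. cinner (P v) (blinfun_apply T v))"
        by (rule bounded_linear_compose[OF l1 blinfun.bounded_linear_left])
      then have "bounded_linear \<phi>"
        unfolding \<phi>_def divide_inverse
        by (rule bounded_linear_compose[OF bounded_linear_mult_left])
      ultimately have "bounded_linear (\<lambda>T. scaleC_op (\<phi> T) P)"
        by (rule bounded_linear_compose)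
      then show ?thesis
        by (intro closed_Collect_eq linear_continuous_on bounded_linear_ident)
    qed
    ultimately show ?thesis by simp
  qed
qed

section \<open>The uniform Roe algebra as a closed span\<close>

lemma ell2_eqI: "(\<And>x. ell2_fun u x = ell2_fun v x) \<Longrightarrow> u = v"
  by (simp add: ell2_fun_inject[symmetric] fun_eq_iff)

lemma bounded_range_mult:
  fixes f g :: "'g \<Rightarrow> complex"
  assumes "bounded (range f)" "bounded (range g)"
  shows "bounded (range (\<lambda>x. f x * g x))"
proof -
  obtain K L where "\<And>x. cmod (f x) \<le> K" "\<And>x. cmod (g x) \<le> L" using assms by (auto simp: bounded_iff)
  then have "cmod (f x * g x) \<le> K * L" for x
    using mult_mono[of "cmod (f x)" K "cmod (g x)" L] norm_ge_zero order_trans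
    by (metis norm_mult)
  then show ?thesis by (auto simp: bounded_iff)
qed

lemma bounded_range_scale:
  fixes f :: "'g \<Rightarrow> complex"
  shows "bounded (range f) \<Longrightarrow> bounded (range (\<lambda>x. c * f x))"
  using bounded_range_mult[of "\<lambda>_. c" f] by (simp add: bounded_iff) blast

lemma bounded_range_cnj: "bounded (range f) \<Longrightarrow> bounded (range (\<lambda>x. cnj (f x)))"
  by (auto simp: bounded_iff)

lemma bounded_range_indicator: "bounded (range (indicator S :: 'g \<Rightarrow> complex))"
  by (auto simp: bounded_iff indicator_def intro!: exI[of _ 1])

lemma bounded_range_shift:
  fixes f :: "'g::group_add \<Rightarrow> complex"
  shows "bounded (range f) \<Longrightarrow> bounded (range (\<lambda>x. f (a + x)))"
  by (auto simp: bounded_iff)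

lemma is_clinear_mult_op: "bounded (range f) \<Longrightarrow> is_clinear (mult_op f)"
  unfolding is_clinear_def
  by (auto intro!: ell2_eqI simp: mult_op_apply scaleC_ell2.rep_eq mult.left_commute)

lemma is_clinear_left_translation: "is_clinear (left_translation g)"
  unfolding is_clinear_def
  by (auto intro!: ell2_eqI simp: left_translation_apply scaleC_ell2.rep_eq)

lemma mult_op_compose:
  "bounded (range f) \<Longrightarrow> bounded (range g) \<Longrightarrow> mult_op f o\<^sub>L mult_op g = mult_op (\<lambda>x. f x * g x)"
  by (auto intro!: blinfun_eqI ell2_eqI simp: mult_op_apply bounded_range_mult mult.assoc)

lemma mult_op_add:
  "bounded (range f) \<Longrightarrow> bounded (range g) \<Longrightarrow> mult_op f + mult_op g = mult_op (\<lambda>x. f x + g x)"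
  by (auto intro!: blinfun_eqI ell2_eqI
      simp: mult_op_apply bounded_plus_comp blinfun.add_left plus_ell2.rep_eq distrib_right)

lemma scaleC_mult_op:
  "bounded (range f) \<Longrightarrow> scaleC_op c (mult_op f) = mult_op (\<lambda>x. c * f x)"
  by (auto intro!: blinfun_eqI ell2_eqI
      simp: mult_op_apply scaleC_op_apply scaleC_ell2.rep_eq mult.assoc bounded_range_scale)

lemma adj_mult_op: "bounded (range f) \<Longrightarrow> adj (mult_op f) = mult_op (\<lambda>x. cnj (f x))"
  by (rule adj_eqI)
     (simp add: is_adjoint_def cinner_ell2_def mult_op_apply bounded_range_cnj mult_ac)

lemma left_translation_compose: "left_translation g o\<^sub>L left_translation h = left_translation (g + h)"
  by (intro blinfun_eqI ell2_eqI)
     (simp only: left_translation_apply blinfun_apply_blinfun_compose minus_add add.assoc)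

lemma left_translation_0: "left_translation 0 = id_blinfun"
  by (auto intro!: blinfun_eqI ell2_eqI simp: left_translation_apply)

lemma adj_left_translation: "adj (left_translation g) = left_translation (- g)"
proof (rule adj_eqI, unfold is_adjoint_def, intro allI)
  fix u v :: "'a ell2"
  have bij: "bij_betw (\<lambda>x. - g + x) UNIV UNIV"
    by (rule bij_betw_byWitness[where f' = "\<lambda>x. g + x"]) (auto simp: add.assoc[symmetric])
  have "cinner (left_translation (- g) u) v = (\<Sum>\<^sub>\<infinity>x. cnj (ell2_fun u (g + x)) * ell2_fun v x)"
    by (simp add: cinner_ell2_def left_translation_apply)
  also have "\<dots> = (\<Sum>\<^sub>\<infinity>x. cnj (ell2_fun u (g + (- g + x))) * ell2_fun v (- g + x))"
    by (rule infsum_reindex_bij_betw[OF bij, symmetric])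
  also have "\<dots> = cinner u (left_translation g v)"
    by (simp add: cinner_ell2_def left_translation_apply add.assoc[symmetric])
  finally show "cinner (left_translation (- g) u) v = cinner u (left_translation g v)" .
qed

lemma translation_mult_op:
  "bounded (range f) \<Longrightarrow>
    left_translation g o\<^sub>L mult_op f = mult_op (\<lambda>x. f (- g + x)) o\<^sub>L left_translation g"
  by (auto intro!: blinfun_eqI ell2_eqI
      simp: left_translation_apply mult_op_apply bounded_range_shift)

definition weighted_translations :: "('g::group_add ell2 \<Rightarrow>\<^sub>L 'g ell2) set" where
  "weighted_translations = {mult_op f o\<^sub>L left_translation g | f g. bounded (range f)}"

lemma weighted_translationsI:
  "bounded (range f) \<Longrightarrow> mult_op f o\<^sub>L left_translation g \<in> weighted_translations"
  by (auto simp: weighted_translations_def)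

text \<open>
  Translations normalise the diagonal operators, so products and adjoints of weighted translations are
  weighted translations.
\<close>

lemma weighted_translations_algebra:
  "closed_star_algebra (closure (span (weighted_translations :: ('g::group_add ell2 \<Rightarrow>\<^sub>L 'g ell2) set)))"
proof (rule closed_star_algebra_closure_span)
  show "weighted_translations \<subseteq> (Collect is_clinear :: ('g ell2 \<Rightarrow>\<^sub>L 'g ell2) set)"
    by (auto simp: weighted_translations_def is_clinear_compose is_clinear_mult_op
        is_clinear_left_translation)
  show "scaleC_op c a \<in> weighted_translations" if w: "a \<in> weighted_translations"
    for c and a :: "'g ell2 \<Rightarrow>\<^sub>L 'g ell2"
  proof -
    obtain f g where a: "a = mult_op f o\<^sub>L left_translation g" "bounded (range f)"
      using w by (auto simp: weighted_translations_def)
    then have "scaleC_op c a = mult_op (\<lambda>x. c * f x) o\<^sub>L left_translation g"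
      by (simp add: scaleC_op_compose scaleC_mult_op)
    then show ?thesis by (simp add: weighted_translationsI bounded_range_scale a)
  qed
  show "a o\<^sub>L b \<in> weighted_translations"
    if ab: "a \<in> weighted_translations" "b \<in> weighted_translations"
    for a b :: "'g ell2 \<Rightarrow>\<^sub>L 'g ell2"
  proof -
    obtain f g h k where a: "a = mult_op f o\<^sub>L left_translation g" "bounded (range f)"
      and b: "b = mult_op h o\<^sub>L left_translation k" "bounded (range h)"
      using ab by (auto simp: weighted_translations_def)
    have "a o\<^sub>L b = mult_op f o\<^sub>L (left_translation g o\<^sub>L mult_op h) o\<^sub>L left_translation k"
      by (simp add: a b compose_assoc)
    also have "\<dots> = (mult_op f o\<^sub>L mult_op (\<lambda>x. h (- g + x))) o\<^sub>L (left_translation g o\<^sub>L left_translation k)"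
      by (simp add: translation_mult_op b compose_assoc)
    also have "\<dots> = mult_op (\<lambda>x. f x * h (- g + x)) o\<^sub>L left_translation (g + k)"
      by (simp add: mult_op_compose left_translation_compose a b bounded_range_shift)
    finally show ?thesis
      by (simp add: weighted_translationsI bounded_range_mult bounded_range_shift a b)
  qed
  show "adj a \<in> weighted_translations" if w: "a \<in> weighted_translations"
    for a :: "'g ell2 \<Rightarrow>\<^sub>L 'g ell2"
  proof -
    obtain f g where a: "a = mult_op f o\<^sub>L left_translation g" "bounded (range f)"
      using w by (auto simp: weighted_translations_def)
    have "adj a = mult_op (\<lambda>x. cnj (f (- (- g) + x))) o\<^sub>L left_translation (- g)"
      using translation_mult_op[OF bounded_range_cnj[OF a(2)], of "- g"]
      by (simp add: a adj_compose is_clinear_mult_op is_clinear_left_translation adj_mult_op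
          adj_left_translation)
    then show ?thesis
      using weighted_translationsI[OF bounded_range_shift[OF bounded_range_cnj[OF a(2)]]] by simp
  qed
qed

definition roe :: "('g::group_add ell2 \<Rightarrow>\<^sub>L 'g ell2) set" where
  "roe = csa_carrier uniform_roe_algebra"

lemma uniform_roe_algebra_eq: "uniform_roe_algebra = operator_algebra roe"
  by (simp add: roe_def uniform_roe_algebra_def)

lemma mult_op_1: "mult_op (\<lambda>_. 1) = id_blinfun"
  by (auto intro!: blinfun_eqI ell2_eqI simp: mult_op_apply)

lemma roe_eq: "roe = closure (span weighted_translations)"
proof
  have "mult_op f \<in> weighted_translations" if "bounded (range f)" for f :: "'a \<Rightarrow> complex"
  proof -
    have "mult_op f o\<^sub>L left_translation 0 = mult_op f"
      by (rule blinfun_eqI) (simp add: left_translation_0)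
    then show ?thesis using weighted_translationsI[OF that, of 0] by simp
  qed
  moreover have "left_translation g \<in> weighted_translations" for g :: 'a
  proof -
    have "mult_op (\<lambda>_. 1) o\<^sub>L left_translation g = left_translation g"
      by (rule blinfun_eqI) (simp add: mult_op_1)
    moreover have "bounded (range (\<lambda>_::'a. 1::complex))" by (auto simp: bounded_iff)
    ultimately show ?thesis using weighted_translationsI[of "\<lambda>_. 1" g] by simp
  qed
  ultimately have "{mult_op f | f. bounded (range f)} \<union> range left_translation
      \<subseteq> closure (span (weighted_translations :: ('a ell2 \<Rightarrow>\<^sub>L 'a ell2) set))"
    using closure_span_superset[of weighted_translations] by blast
  then show "roe \<subseteq> closure (span (weighted_translations :: ('a ell2 \<Rightarrow>\<^sub>L 'a ell2) set))"
    using weighted_translations_algebra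
    by (auto simp: roe_def uniform_roe_algebra_def cstar_generated_def cstar_subalgebra_iff)
  show "closure (span weighted_translations) \<subseteq> (roe :: ('a ell2 \<Rightarrow>\<^sub>L 'a ell2) set)"
    unfolding roe_def uniform_roe_algebra_def operator_algebra_simps cstar_generated_def
      cstar_subalgebra_iff
  proof (rule Inter_greatest, clarify)
    fix T :: "('a ell2 \<Rightarrow>\<^sub>L 'a ell2) set" and x :: "'a ell2 \<Rightarrow>\<^sub>L 'a ell2"
    assume T: "closed_star_algebra T"
      and gen: "{mult_op f | f. bounded (range f)} \<union> range left_translation \<subseteq> T"
      and x: "x \<in> closure (span weighted_translations)"
    have "weighted_translations \<subseteq> T"
    proof
      fix w :: "'a ell2 \<Rightarrow>\<^sub>L 'a ell2" assume "w \<in> weighted_translations"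
      then obtain f g where w: "w = mult_op f o\<^sub>L left_translation g" and f: "bounded (range f)"
        by (auto simp: weighted_translations_def)
      have "mult_op f \<in> T" "left_translation g \<in> T" using gen f by auto
      then show "w \<in> T" using T unfolding closed_star_algebra_def w by blast
    qed
    then show "x \<in> T"
      using closure_span_minimal[of weighted_translations T] T x
      by (auto simp: closed_star_algebra_def)
  qed
qed

lemma roe_algebra: "closed_star_algebra roe"
  unfolding roe_eq by (rule weighted_translations_algebra)

lemma mult_op_in_roe: "bounded (range f) \<Longrightarrow> mult_op f \<in> roe"
  by (simp add: roe_def uniform_roe_algebra_def cstar_generated_def) blast

lemma roe_clinear: "a \<in> roe \<Longrightarrow> is_clinear a"
  and roe_compose: "a \<in> roe \<Longrightarrow> b \<in> roe \<Longrightarrow> a o\<^sub>L b \<in> roe"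
  and roe_adj: "a \<in> roe \<Longrightarrow> adj a \<in> roe"
  and roe_scaleC: "a \<in> roe \<Longrightarrow> scaleC_op c a \<in> roe"
  using roe_algebra by (auto simp: closed_star_algebra_def)

section \<open>Corners of the Roe algebra over sparse sets\<close>

definition thin :: "'g::group_add set \<Rightarrow> bool" where
  "thin S \<longleftrightarrow> (\<forall>g. g \<noteq> 0 \<longrightarrow> finite {x \<in> S. - g + x \<in> S})"

text \<open>
  By right invariance the distance between \<open>x\<close> and \<open>- g + x\<close> does not depend on \<open>x\<close>; outside a large
  ball, which is finite, distinct points of \<open>S\<close> are further apart than that.
\<close>

lemma sparse_imp_thin:
  assumes d: "proper_right_invariant_metric d" and S: "sparse_metric_space S d"
  shows "thin S"
  unfolding thin_def
proof (intro allI impI)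
  fix g :: 'a assume g: "g \<noteq> 0"
  interpret Metric_space UNIV d using d by (simp add: proper_right_invariant_metric_def)
  have fin: "finite (mcball x r)" for x r using d by (simp add: proper_right_invariant_metric_def)
  have inv: "d (x + h) (y + h) = d x y" for x y h
    using d by (simp add: proper_right_invariant_metric_def)
  define K where "K = d 0 (- g)"
  have dK: "d x (- g + x) = K" for x using inv[of 0 x "- g"] by (simp add: K_def)
  define D where "D x0 r = {ereal (d x y) | x y.
      x \<in> S - mball x0 r \<and> y \<in> S - mball x0 r \<and> x \<noteq> y}" for x0 r
  obtain x0 where x0: "x0 \<in> S" and lim0: "((\<lambda>r. Inf {ereal (d x y) | x y.
         x \<in> S - Metric_space.mball S d x0 r \<and> y \<in> S - Metric_space.mball S d x0 r \<and> x \<noteq> y})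
         \<longlongrightarrow> \<infinity>) at_top"
    using S unfolding sparse_metric_space_def by blast
  have ball: "S - Metric_space.mball S d x0 r = S - mball x0 r" for r
  proof -
    have "Metric_space S d" by (rule subspace) simp
    then show ?thesis using x0 by (auto simp only: Metric_space.in_mball in_mball)
  qed
  have "((\<lambda>r. Inf (D x0 r)) \<longlongrightarrow> \<infinity>) at_top"
    using lim0 unfolding ball D_def .
  then have "eventually (\<lambda>r. ereal K < Inf (D x0 r)) at_top"
    by (rule order_tendstoD(1)) simp
  then have "\<exists>r. ereal K < Inf (D x0 r)"
    by (rule eventually_happens'[OF trivial_limit_at_top_linorder])
  then obtain r where r: "ereal K < Inf (D x0 r)" ..
  have "{x \<in> S. - g + x \<in> S} \<subseteq> mcball x0 r \<union> (\<lambda>y. g + y) ` mcball x0 r"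
  proof
    fix x assume x: "x \<in> {x \<in> S. - g + x \<in> S}"
    show "x \<in> mcball x0 r \<union> (\<lambda>y. g + y) ` mcball x0 r"
    proof (rule ccontr)
      assume out: "x \<notin> mcball x0 r \<union> (\<lambda>y. g + y) ` mcball x0 r"
      have x': "x = g + (- g + x)" by (simp add: add.assoc[symmetric])
      have "- g + x \<notin> mcball x0 r"
      proof
        assume "- g + x \<in> mcball x0 r"
        then have "g + (- g + x) \<in> (\<lambda>y. g + y) ` mcball x0 r" by (rule imageI)
        then show False using out x' by simp
      qed
      then have "- g + x \<in> S - mball x0 r" using x mball_subset_mcball by auto
      moreover have "x \<in> S - mball x0 r" using x out mball_subset_mcball by auto
      moreover have "x \<noteq> - g + x" using g add_right_cancel[of 0 x "- g"] by simp
      ultimately have "ereal (d x (- g + x)) \<in> D x0 r" unfolding D_def by blast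
      then have "Inf (D x0 r) \<le> ereal K" unfolding dK by (rule Inf_lower)
      then show False using r by simp
    qed
  qed
  then show "finite {x \<in> S. - g + x \<in> S}" using fin finite_subset by blast
qed

definition proj :: "'g set \<Rightarrow> ('g ell2 \<Rightarrow>\<^sub>L 'g ell2)" where
  "proj S = mult_op (indicator S)"

lemma proj_apply: "ell2_fun (proj S u) x = indicator S x * ell2_fun u x"
  by (simp add: proj_def mult_op_apply bounded_range_indicator)

lemma is_clinear_proj: "is_clinear (proj S)"
  by (simp add: proj_def is_clinear_mult_op bounded_range_indicator)

lemma adj_proj: "adj (proj S) = proj S"
proof -
  have "(\<lambda>x. cnj (indicator S x)) = (indicator S :: 'a \<Rightarrow> complex)" by (auto simp: indicator_def)
  then show ?thesis by (simp add: proj_def adj_mult_op bounded_range_indicator)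
qed

lemma proj_proj: "proj S o\<^sub>L proj V = proj (S \<inter> V)"
  by (intro blinfun_eqI ell2_eqI) (simp add: proj_apply indicator_inter_arith)

lemma proj_union_disjoint: "S \<inter> V = {} \<Longrightarrow> proj (S \<union> V) = proj S + proj V"
  by (intro blinfun_eqI ell2_eqI)
     (simp add: proj_apply blinfun.add_left plus_ell2.rep_eq indicator_add[symmetric] distrib_right)

lemma proj_empty: "proj {} = 0"
  by (intro blinfun_eqI ell2_eqI) (simp add: proj_apply zero_ell2.rep_eq)

lemma proj_finite:
  assumes "finite F"
  shows "proj F = (\<Sum>x\<in>F. proj {x})"
  using assms
proof (induction F)
  case (insert x F)
  then show ?case using proj_union_disjoint[of "{x}" F] by simp
qed (simp add: proj_empty)

lift_definition delta :: "'g \<Rightarrow> 'g ell2" is "\<lambda>x. indicator {x}"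
  by (rule finite_nonzero_values_imp_summable_on) (simp add: indicator_def)

lemma proj_singleton: "proj {x} = rank_one (delta x) (delta x)"
proof (intro blinfun_eqI ell2_eqI)
  fix u y
  have "cinner (delta x) u = (\<Sum>\<^sub>\<infinity>y\<in>{x}. cnj (indicator {x} y) * ell2_fun u y)"
    unfolding cinner_ell2_def delta.rep_eq by (rule infsum_cong_neutral) auto
  then have "cinner (delta x) u = ell2_fun u x" by simp
  then show "ell2_fun (proj {x} u) y = ell2_fun (rank_one (delta x) (delta x) u) y"
    by (simp add: proj_apply rank_one_apply scaleC_ell2.rep_eq delta.rep_eq indicator_def)
qed

lemma proj_in_roe: "proj S \<in> roe"
  by (simp add: proj_def mult_op_in_roe bounded_range_indicator)

text \<open>
  Translation by \<open>g \<noteq> 0\<close> moves all but finitely many points of a thin set out of it, so the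
  off-diagonal part of the corner is supported on finitely many rows.
\<close>

lemma corner_off_diagonal:
  assumes S: "thin S" and f: "bounded (range f)" and g: "g \<noteq> 0"
  defines "E \<equiv> proj S o\<^sub>L (mult_op f o\<^sub>L left_translation g) o\<^sub>L proj S"
  shows "\<exists>F. finite F \<and> F \<subseteq> S \<and> E = (\<Sum>x\<in>F. proj {x} o\<^sub>L E)"
proof (intro exI conjI)
  let ?F = "{x \<in> S. - g + x \<in> S}"
  show "finite ?F" using S g by (simp add: thin_def)
  show "?F \<subseteq> S" by blast
  have "E = proj ?F o\<^sub>L E"
    unfolding E_def
    by (intro blinfun_eqI ell2_eqI)
       (auto simp: proj_apply mult_op_apply f left_translation_apply indicator_def)
  then show "E = (\<Sum>x\<in>?F. proj {x} o\<^sub>L E)"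
    unfolding proj_finite[OF \<open>finite ?F\<close>] blinfun_compose.sum_left .
qed

lemma corner_diagonal:
  assumes f: "bounded (range f)"
  shows "proj S o\<^sub>L (mult_op f o\<^sub>L left_translation 0) o\<^sub>L proj S = mult_op (\<lambda>x. indicator S x * f x)"
  by (intro blinfun_eqI ell2_eqI)
     (auto simp: proj_apply mult_op_apply f left_translation_0 indicator_def
       bounded_range_mult[OF bounded_range_indicator f, unfolded indicator_def])

text \<open>
  A closed span, so that it contains the limits of corners; commutators being continuous, they remain
  compact there.
\<close>

definition essentially_diagonal :: "('g ell2 \<Rightarrow>\<^sub>L 'g ell2) set" where
  "essentially_diagonal = closure (span ({mult_op f | f. bounded (range f)} \<union> compact_operators))"

lemma bounded_linear_corner: "bounded_linear (\<lambda>T. P o\<^sub>L T o\<^sub>L P)"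
  by (rule bounded_linear_compose[OF blinfun_compose.bounded_linear_left
        blinfun_compose.bounded_linear_right])

lemma corner_essentially_diagonal:
  assumes S: "thin S" and T: "T \<in> roe"
  shows "proj S o\<^sub>L T o\<^sub>L proj S \<in> essentially_diagonal"
proof (rule closure_span_image[OF bounded_linear_corner _ _ _ T[unfolded roe_eq]])
  show "subspace (essentially_diagonal :: ('a ell2 \<Rightarrow>\<^sub>L 'a ell2) set)"
    "closed (essentially_diagonal :: ('a ell2 \<Rightarrow>\<^sub>L 'a ell2) set)"
    by (simp_all add: essentially_diagonal_def subspace_closure_span)
  fix a :: "'a ell2 \<Rightarrow>\<^sub>L 'a ell2" assume "a \<in> weighted_translations"
  then obtain f g where a: "a = mult_op f o\<^sub>L left_translation g" and f: "bounded (range f)"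
    by (auto simp: weighted_translations_def)
  have gen: "x \<in> essentially_diagonal"
    if "x \<in> {mult_op f | f. bounded (range f)} \<union> compact_operators" for x :: "'a ell2 \<Rightarrow>\<^sub>L 'a ell2"
    unfolding essentially_diagonal_def by (rule subsetD[OF closure_span_superset that])
  let ?E = "proj S o\<^sub>L a o\<^sub>L proj S"
  show "?E \<in> essentially_diagonal"
  proof (cases "g = 0")
    case True
    have "mult_op (\<lambda>x. indicator S x * f x) \<in> {mult_op f | f. bounded (range f)} \<union> compact_operators"
      using bounded_range_mult[OF bounded_range_indicator f] by blast
    then show ?thesis
      unfolding a True corner_diagonal[OF f] by (rule gen)
  next
    case False
    obtain F where F: "finite F" "?E = (\<Sum>x\<in>F. proj {x} o\<^sub>L ?E)"
      using corner_off_diagonal[OF S f False] a by blast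
    have "is_clinear ?E"
      unfolding a by (intro is_clinear_compose is_clinear_proj is_clinear_mult_op f is_clinear_left_translation)
    then have "(\<Sum>x\<in>F. proj {x} o\<^sub>L ?E) \<in> compact_operators"
      by (intro subspace_sum subspace_compact_operators)
         (simp add: proj_singleton compose_compact_right rank_one_compact)
    then show ?thesis using F gen by simp
  qed
qed

lemma commutator_essentially_diagonal:
  assumes x: "x \<in> essentially_diagonal" and y: "y \<in> essentially_diagonal"
  shows "(x o\<^sub>L y) - (y o\<^sub>L x) \<in> compact_operators"
proof -
  let ?D = "{mult_op f | f. bounded (range f)} :: ('a ell2 \<Rightarrow>\<^sub>L 'a ell2) set"
  note K = subspace_compact_operators closed_compact_operators
  have lin1: "bounded_linear (\<lambda>x. (x o\<^sub>L b) - (b o\<^sub>L x))" for b :: "'a ell2 \<Rightarrow>\<^sub>L 'a ell2"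
    by (intro bounded_linear_sub blinfun_compose.bounded_linear_left blinfun_compose.bounded_linear_right)
  have lin2: "bounded_linear (\<lambda>x. (b o\<^sub>L x) - (x o\<^sub>L b))" for b :: "'a ell2 \<Rightarrow>\<^sub>L 'a ell2"
    by (intro bounded_linear_sub blinfun_compose.bounded_linear_left blinfun_compose.bounded_linear_right)
  have gen: "(a o\<^sub>L b) - (b o\<^sub>L a) \<in> compact_operators"
    if ab: "a \<in> ?D \<union> compact_operators" "b \<in> ?D \<union> compact_operators" for a b
  proof -
    have cl: "is_clinear a" "is_clinear b" using ab by (auto simp: is_clinear_mult_op is_clinear_compact)
    consider "a \<in> ?D" "b \<in> ?D" | "a \<in> compact_operators" | "b \<in> compact_operators" using ab by blast
    then show ?thesis
    proof cases
      case 1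
      then have "a o\<^sub>L b = b o\<^sub>L a" by (auto simp: mult_op_compose mult.commute)
      then show ?thesis by (simp add: subspace_0 K)
    next
      case 2
      then show ?thesis
        by (intro subspace_diff[OF K(1)] compose_compact_right[OF cl(2)] compose_compact_left[OF cl(2)])
    next
      case 3
      then show ?thesis
        by (intro subspace_diff[OF K(1)] compose_compact_left[OF cl(1)] compose_compact_right[OF cl(1)])
    qed
  qed
  have "(x o\<^sub>L b) - (b o\<^sub>L x) \<in> compact_operators" if "b \<in> ?D \<union> compact_operators" for b
    by (rule closure_span_image[OF lin1 _ K x[unfolded essentially_diagonal_def]])
       (rule gen[OF _ that])
  then show ?thesis
    by (rule closure_span_image[OF lin2 _ K y[unfolded essentially_diagonal_def]])
qed

lemma norm_mult_op_le:
  assumes K: "\<And>x. cmod (f x) \<le> K"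
  shows "norm (mult_op f) \<le> K"
proof (rule norm_blinfun_bound)
  have f: "bounded (range f)" using K by (auto simp: bounded_iff)
  show K0: "0 \<le> K" using K[of undefined] norm_ge_zero order_trans by blast
  fix u
  have "(norm (mult_op f u))\<^sup>2 \<le> (\<Sum>\<^sub>\<infinity>x. K\<^sup>2 * (cmod (ell2_fun u x))\<^sup>2)"
    unfolding ell2_norm_sq
  proof (rule infsum_mono)
    show "(\<lambda>x. (cmod (ell2_fun (mult_op f u) x))\<^sup>2) summable_on UNIV" by (rule ell2_fun_summable)
    show "(\<lambda>x. K\<^sup>2 * (cmod (ell2_fun u x))\<^sup>2) summable_on UNIV"
      by (intro summable_on_cmult_right ell2_fun_summable)
    show "(cmod (ell2_fun (mult_op f u) x))\<^sup>2 \<le> K\<^sup>2 * (cmod (ell2_fun u x))\<^sup>2" for x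
      using K[of x] by (simp add: mult_op_apply f norm_mult power_mult_distrib mult_right_mono power_mono)
  qed
  also have "\<dots> = (K * norm u)\<^sup>2" by (simp add: infsum_cmult_right' ell2_norm_sq power_mult_distrib)
  finally show "norm (mult_op f u) \<le> K * norm u" by (rule power2_le_imp_le) (use K0 in simp)
qed

lemma mult_op_sum:
  assumes "finite F" "\<And>i. i \<in> F \<Longrightarrow> bounded (range (f i))"
  shows "bounded (range (\<lambda>x. \<Sum>i\<in>F. f i x)) \<and> mult_op (\<lambda>x. \<Sum>i\<in>F. f i x) = (\<Sum>i\<in>F. mult_op (f i))"
  using assms
proof (induction F)
  case empty
  have "bounded (range (\<lambda>_::'b. 0::complex))" by (auto simp: bounded_iff)
  then show ?case by (auto intro!: blinfun_eqI ell2_eqI simp: mult_op_apply zero_ell2.rep_eq)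
next
  case (insert i F)
  then have "bounded (range (f i))" "bounded (range (\<lambda>x. \<Sum>i\<in>F. f i x))" by auto
  then show ?case using insert by (simp add: mult_op_add[symmetric] bounded_plus_comp)
qed

text \<open>
  The range of \<open>h\<close> is totally bounded, so \<open>h\<close> is a uniform limit of functions with finitely many values.
\<close>

lemma diagonal_simple_approx:
  assumes h: "bounded (range h)" and supp: "\<And>x. x \<notin> S \<Longrightarrow> h x = 0"
  shows "mult_op h \<in> closure (span {scaleC_op c (proj B) | c B. B \<subseteq> S})"
  unfolding closure_approachable
proof (intro allI impI)
  fix e :: real assume "e > 0"
  have "compact (closure (range h))" using h by (simp add: compact_closure)
  then obtain F where F: "finite F" "closure (range h) \<subseteq> (\<Union>c\<in>F. ball c (e/2))"
    using \<open>e > 0\<close> unfolding compact_eq_totally_bounded by (meson half_gt_zero)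
  have "\<exists>c\<in>F. dist c (h x) < e/2" for x
    using F(2) closure_subset[of "range h"] by (force simp: subset_eq)
  then obtain \<kappa> where \<kappa>: "\<And>x. \<kappa> x \<in> F" "\<And>x. dist (\<kappa> x) (h x) < e/2" by metis
  define B where "B c = {x \<in> S. \<kappa> x = c}" for c
  define k where "k c x = c * indicator (B c) x" for c x
  have k: "bounded (range (k c))" for c
    unfolding k_def by (intro bounded_range_scale bounded_range_indicator)
  have kx: "(\<Sum>c\<in>F. k c x) = (if x \<in> S then \<kappa> x else 0)" for x
    using \<kappa>(1)[of x] F(1) by (simp add: k_def B_def indicator_def if_distrib cong: if_cong)
  let ?k = "\<lambda>x. \<Sum>c\<in>F. k c x"
  have bk: "bounded (range ?k)" and mk: "mult_op ?k = (\<Sum>c\<in>F. mult_op (k c))"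
    using mult_op_sum[OF F(1) k] by auto
  have "mult_op (k c) = scaleC_op c (proj (B c))" for c
    unfolding k_def proj_def by (rule scaleC_mult_op[symmetric]) (rule bounded_range_indicator)
  then have in_span: "mult_op ?k \<in> span {scaleC_op c (proj B) | c B. B \<subseteq> S}"
    unfolding mk by (intro span_sum span_base) (auto simp: B_def)
  have "mult_op ?k - mult_op h = mult_op (\<lambda>x. ?k x - h x)"
    using bounded_minus_comp[OF bk h]
    by (intro blinfun_eqI ell2_eqI)
       (simp add: mult_op_apply bk h blinfun.diff_left minus_ell2.rep_eq left_diff_distrib)
  also have "norm \<dots> \<le> e/2"
  proof (rule norm_mult_op_le)
    show "cmod (?k x - h x) \<le> e/2" for x
      using \<kappa>(2)[of x] supp[of x] \<open>e > 0\<close> unfolding kx by (auto simp: dist_norm)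
  qed
  finally have "dist (mult_op ?k) (mult_op h) < e" using \<open>e > 0\<close> by (simp add: dist_norm)
  then show "\<exists>y\<in>span {scaleC_op c (proj B) | c B. B \<subseteq> S}. dist y (mult_op h) < e"
    using in_span by blast
qed

section \<open>The ideal generated by a finite union of sets\<close>

definition roe_ideal_set :: "'g::group_add set \<Rightarrow> ('g ell2 \<Rightarrow>\<^sub>L 'g ell2) set" where
  "roe_ideal_set A = csa_carrier (roe_ideal A)"

lemma roe_ideal_eq: "roe_ideal A = operator_algebra (roe_ideal_set A)"
  by (simp add: roe_ideal_set_def roe_ideal_def uniform_roe_algebra_eq)

lemma roe_ideal_set_eq:
  "roe_ideal_set A = \<Inter>{J. closed_ideal (operator_algebra roe) J \<and> proj A \<in> J}"
  by (simp add: roe_ideal_set_def roe_ideal_def uniform_roe_algebra_eq ideal_generated_def proj_def)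

lemma roe_ideal_set_least:
  "closed_ideal (operator_algebra roe) J \<Longrightarrow> proj A \<in> J \<Longrightarrow> roe_ideal_set A \<subseteq> J"
  unfolding roe_ideal_set_eq by blast

lemma proj_in_roe_ideal_set: "proj A \<in> roe_ideal_set A"
  unfolding roe_ideal_set_eq by blast

lemma closed_ideal_roe: "closed_ideal (operator_algebra roe) roe"
  unfolding closed_ideal_iff[OF roe_algebra]
  using roe_algebra unfolding closed_star_algebra_def by blast

lemma roe_ideal_set_subset: "roe_ideal_set A \<subseteq> roe"
  by (rule roe_ideal_set_least[OF closed_ideal_roe proj_in_roe])

lemma roe_ideal_set_ideal: "closed_ideal (operator_algebra roe) (roe_ideal_set A)"
proof -
  have "subspace (roe_ideal_set A)" "closed (roe_ideal_set A)"
    unfolding roe_ideal_set_eq closed_ideal_iff[OF roe_algebra]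
    by (auto intro!: subspace_Inter closed_Inter)
  then show ?thesis
    unfolding closed_ideal_iff[OF roe_algebra]
    using roe_ideal_set_subset[of A]
    by (auto simp: roe_ideal_set_eq closed_ideal_iff[OF roe_algebra])
qed

lemmas roe_ideal_set_props = roe_ideal_set_ideal[unfolded closed_ideal_iff[OF roe_algebra]]

lemma roe_ideal_set_compose:
  "x \<in> roe_ideal_set A \<Longrightarrow> b \<in> roe \<Longrightarrow> b o\<^sub>L x \<in> roe_ideal_set A"
  "x \<in> roe_ideal_set A \<Longrightarrow> b \<in> roe \<Longrightarrow> x o\<^sub>L b \<in> roe_ideal_set A"
  using roe_ideal_set_props[of A] by blast+

lemma adj_closed_vimage:
  fixes M N :: "('h::complex_hilbert_space \<Rightarrow>\<^sub>L 'h) set"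
  assumes M: "M \<subseteq> Collect is_clinear" "closed M" and N: "closed N"
  shows "closed {x \<in> M. adj x \<in> N}"
proof (rule closed_sequential_limits[THEN iffD2], intro allI impI, elim conjE)
  fix X L assume X: "\<forall>n. X n \<in> {x \<in> M. adj x \<in> N}" "X \<longlonglongrightarrow> L"
  have L: "L \<in> M" by (rule closed_sequentially[OF M(2) _ X(2)]) (use X(1) in simp)
  have cl: "is_clinear (X n)" "is_clinear L" for n using X(1) L M(1) by auto
  have "(\<lambda>n. norm (X n - L)) \<longlonglongrightarrow> 0" using X(2) by (simp add: LIM_zero tendsto_norm_zero)
  then have "(\<lambda>n. norm (adj (X n) - adj L)) \<longlonglongrightarrow> 0"
    by (simp add: adj_diff[symmetric] norm_adj is_clinear_diff cl)
  then have "(\<lambda>n. adj (X n)) \<longlonglongrightarrow> adj L" by (simp add: tendsto_norm_zero_iff LIM_zero_iff)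
  then have "adj L \<in> N" by (rule closed_sequentially[OF N, rotated]) (use X(1) in simp)
  then show "L \<in> {x \<in> M. adj x \<in> N}" using L by simp
qed

text \<open>
  The elements of the ideal whose adjoint belongs to it too form a closed ideal containing the generator.
\<close>

lemma roe_ideal_set_algebra: "closed_star_algebra (roe_ideal_set A)"
proof -
  let ?I = "roe_ideal_set A"
  let ?J = "{x \<in> ?I. adj x \<in> ?I}"
  have cl: "is_clinear x" if "x \<in> ?I" for x using that roe_ideal_set_subset roe_clinear by blast
  have "closed_ideal (operator_algebra roe) ?J"
    unfolding closed_ideal_iff[OF roe_algebra]
  proof (intro conjI ballI allI)
    show "?J \<subseteq> roe" using roe_ideal_set_subset by blast
    have sub: "subspace ?I" using roe_ideal_set_props by blast
    show "subspace ?J"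
      unfolding subspace_def
      by (auto simp: adj_zero adj_add adj_scaleR cl intro: subspace_0[OF sub] subspace_add[OF sub]
          subspace_scale[OF sub])
    show "closed ?J"
      by (rule adj_closed_vimage) (use cl roe_ideal_set_props in auto)
    show "scaleC_op c x \<in> ?J" if "x \<in> ?J" for c x
      using that roe_ideal_set_props[of A] by (simp add: adj_scaleC cl)
    show "b o\<^sub>L x \<in> ?J" if "x \<in> ?J" "b \<in> roe" for x b
      using that by (simp add: adj_compose cl roe_clinear roe_ideal_set_compose roe_adj)
    show "x o\<^sub>L b \<in> ?J" if "x \<in> ?J" "b \<in> roe" for x b
      using that by (simp add: adj_compose cl roe_clinear roe_ideal_set_compose roe_adj)
  qed
  then have "?I \<subseteq> ?J"
    by (rule roe_ideal_set_least) (simp add: adj_proj proj_in_roe_ideal_set)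
  then show ?thesis
    using roe_ideal_set_props[of A] roe_ideal_set_subset[of A] cl roe_ideal_set_compose
    unfolding closed_star_algebra_def by blast
qed

definition sandwiches :: "'g::group_add set set \<Rightarrow> ('g ell2 \<Rightarrow>\<^sub>L 'g ell2) set" where
  "sandwiches \<S> = {b o\<^sub>L proj S o\<^sub>L c | b S c. b \<in> roe \<and> S \<in> \<S> \<and> c \<in> roe}"

lemma proj_subset_in_roe_ideal_set:
  assumes "S \<subseteq> A"
  shows "proj S \<in> roe_ideal_set A"
proof -
  have "proj S = proj S o\<^sub>L proj A" using assms by (simp add: proj_proj Int_absorb2)
  then show ?thesis
    using roe_ideal_set_compose(1)[OF proj_in_roe_ideal_set proj_in_roe, of S A] by simp
qed

lemma sandwiches_in_roe_ideal_set:
  assumes "A = \<Union>\<S>"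
  shows "sandwiches \<S> \<subseteq> roe_ideal_set A"
proof
  fix a assume "a \<in> sandwiches \<S>"
  then obtain b S c where a: "a = b o\<^sub>L proj S o\<^sub>L c" "b \<in> roe" "S \<in> \<S>" "c \<in> roe"
    by (auto simp: sandwiches_def)
  have "proj S \<in> roe_ideal_set A" using a(3) assms by (intro proj_subset_in_roe_ideal_set) blast
  then show "a \<in> roe_ideal_set A" using a by (simp add: roe_ideal_set_compose)
qed

text \<open>
  The closed span is an ideal, and it contains \<open>proj A\<close> because \<open>proj (S \<union> B) = proj S + proj (- S) proj B\<close>.
\<close>

lemma roe_ideal_set_span:
  assumes "finite \<S>" "A = \<Union>\<S>"
  shows "roe_ideal_set A \<subseteq> closure (span (sandwiches \<S>))"
proof (rule roe_ideal_set_least)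
  let ?J = "closure (span (sandwiches \<S>))"
  have sJ: "subspace ?J" "closed ?J" by (simp_all add: subspace_closure_span)
  have gen: "b o\<^sub>L proj S o\<^sub>L c \<in> ?J" if "b \<in> roe" "S \<in> \<S>" "c \<in> roe" for b S c
    by (rule subsetD[OF closure_span_superset]) (use that in \<open>auto simp: sandwiches_def\<close>)
  have left: "b o\<^sub>L x \<in> ?J" if b: "b \<in> roe" and x: "x \<in> ?J" for b x
  proof (rule closure_span_image[OF blinfun_compose.bounded_linear_right _ sJ x])
    fix a assume "a \<in> sandwiches \<S>"
    then obtain b' S c where a: "a = b' o\<^sub>L proj S o\<^sub>L c" "b' \<in> roe" "S \<in> \<S>" "c \<in> roe"
      by (auto simp: sandwiches_def)
    have "b o\<^sub>L a = (b o\<^sub>L b') o\<^sub>L proj S o\<^sub>L c" by (simp only: a compose_assoc)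
    then show "b o\<^sub>L a \<in> ?J" using a b by (simp add: gen roe_compose)
  qed
  have right: "x o\<^sub>L b \<in> ?J" if b: "b \<in> roe" and x: "x \<in> ?J" for b x
  proof (rule closure_span_image[OF blinfun_compose.bounded_linear_left _ sJ x])
    fix a assume "a \<in> sandwiches \<S>"
    then obtain b' S c where a: "a = b' o\<^sub>L proj S o\<^sub>L c" "b' \<in> roe" "S \<in> \<S>" "c \<in> roe"
      by (auto simp: sandwiches_def)
    have "a o\<^sub>L b = b' o\<^sub>L proj S o\<^sub>L (c o\<^sub>L b)" by (simp only: a compose_assoc)
    then show "a o\<^sub>L b \<in> ?J" using a b by (simp add: gen roe_compose)
  qed
  have scale: "scaleC_op c x \<in> ?J" if x: "x \<in> ?J" for c x
  proof (rule closure_span_image[OF bounded_linear_scaleC_op _ sJ x])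
    fix a assume "a \<in> sandwiches \<S>"
    then obtain b' S c' where a: "a = b' o\<^sub>L proj S o\<^sub>L c'" "b' \<in> roe" "S \<in> \<S>" "c' \<in> roe"
      by (auto simp: sandwiches_def)
    then show "scaleC_op c a \<in> ?J" by (simp add: scaleC_op_compose gen roe_scaleC)
  qed
  have "sandwiches \<S> \<subseteq> roe"
    by (auto simp: sandwiches_def intro!: roe_compose proj_in_roe)
  then have "?J \<subseteq> roe"
    using roe_algebra by (intro closure_span_minimal) (auto simp: closed_star_algebra_def)
  then show "closed_ideal (operator_algebra roe) ?J"
    unfolding closed_ideal_iff[OF roe_algebra] using sJ left right scale by blast
  have "proj (\<Union>\<T>) \<in> ?J" if "finite \<T>" "\<T> \<subseteq> \<S>" for \<T>
    using that
  proof (induction \<T>)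
    case empty
    then show ?case by (simp add: proj_empty subspace_0 sJ)
  next
    case (insert S \<T>)
    have id: "proj UNIV o\<^sub>L x = x" "x o\<^sub>L proj UNIV = x" for x :: "'a ell2 \<Rightarrow>\<^sub>L 'a ell2"
    proof -
      have "proj (UNIV :: 'a set) = id_blinfun" by (intro blinfun_eqI ell2_eqI) (simp add: proj_apply)
      then show "proj UNIV o\<^sub>L x = x" "x o\<^sub>L proj UNIV = x" by (auto intro: blinfun_eqI)
    qed
    have S: "proj S \<in> ?J"
      using gen[of "proj UNIV" S "proj UNIV"] insert.prems by (simp add: proj_in_roe id)
    have "\<Union>(insert S \<T>) = S \<union> (- S \<inter> \<Union>\<T>)" by blast
    then have "proj (\<Union>(insert S \<T>)) = proj S + (proj (- S) o\<^sub>L proj (\<Union>\<T>))"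
      by (simp add: proj_proj, subst proj_union_disjoint) auto
    then show ?case
      using insert S by (auto intro!: subspace_add[OF sJ(1)] left proj_in_roe)
  qed
  then show "proj A \<in> ?J" using assms by blast
qed

section \<open>Quotients by the compact operators\<close>

definition coset :: "('h::complex_hilbert_space \<Rightarrow>\<^sub>L 'h) \<Rightarrow> ('h \<Rightarrow>\<^sub>L 'h) set" where
  "coset x = (+) x ` compact_operators"

lemma in_coset: "y \<in> coset x \<longleftrightarrow> y - x \<in> compact_operators"
  unfolding coset_def by (auto intro!: image_eqI[of _ _ "y - x"])

lemma coset_eq: "coset x = coset y \<longleftrightarrow> x - y \<in> compact_operators"
proof
  assume "coset x = coset y"
  moreover have "x \<in> coset x" by (simp add: in_coset subspace_0 subspace_compact_operators)
  ultimately show "x - y \<in> compact_operators" by (simp add: in_coset)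
next
  note K = subspace_compact_operators
  assume xy: "x - y \<in> compact_operators"
  have "z - x \<in> compact_operators \<longleftrightarrow> z - y \<in> compact_operators" for z
    using subspace_add[OF K _ xy, of "z - x"] subspace_diff[OF K _ xy, of "z - y"] by auto
  then show "coset x = coset y" by (auto simp: in_coset)
qed

lemma coset_zero: "coset 0 = compact_operators"
  by (auto simp: in_coset)

lemma coset_self: "x \<in> coset x"
  by (simp add: in_coset subspace_0 subspace_compact_operators)

lemma UN_coset2:
  assumes "\<And>u v. u \<in> coset x \<Longrightarrow> v \<in> coset y \<Longrightarrow> coset (f u v) = C"
  shows "(\<Union>u\<in>coset x. \<Union>v\<in>coset y. coset (f u v)) = C"
  using assms coset_self[of x] coset_self[of y] by auto

lemma UN_coset1:
  assumes "\<And>u. u \<in> coset x \<Longrightarrow> coset (f u) = C"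
  shows "(\<Union>u\<in>coset x. coset (f u)) = C"
  using assms coset_self[of x] by auto

abbreviation compact_quotient :: "('h::complex_hilbert_space \<Rightarrow>\<^sub>L 'h) set \<Rightarrow> ('h \<Rightarrow>\<^sub>L 'h) set cstar" where
  "compact_quotient M \<equiv> csa_quotient (operator_algebra M) compact_operators"

lemma csa_coset_eq: "csa_coset (operator_algebra M) compact_operators = coset"
  by (simp add: csa_coset_def coset_def fun_eq_iff)

lemma quotient_carrier: "csa_carrier (compact_quotient M) = coset ` M"
  by (simp add: csa_quotient_def csa_coset_eq)

lemma quotient_zero: "csa_zero (compact_quotient M) = coset 0"
  by (simp add: csa_quotient_def coset_zero)

lemma quotient_add: "csa_add (compact_quotient M) (coset x) (coset y) = coset (x + y)"
proof -
  have "coset (u + v) = coset (x + y)" if "u \<in> coset x" "v \<in> coset y" for u v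
    using that subspace_add[OF subspace_compact_operators, of "u - x" "v - y"]
    by (simp add: coset_eq in_coset add_diff_add)
  then show ?thesis
    unfolding csa_quotient_def csa_coset_eq cstar.simps operator_algebra_simps by (rule UN_coset2)
qed

lemma quotient_scale: "csa_scale (compact_quotient M) c (coset x) = coset (scaleC_op c x)"
proof -
  have "scaleC_op c u - scaleC_op c x = scaleC_op c (u - x)" for u
    by (rule linear_diff[OF bounded_linear.linear[OF bounded_linear_scaleC_op], symmetric])
  then have "coset (scaleC_op c u) = coset (scaleC_op c x)" if "u \<in> coset x" for u
    using that by (simp add: coset_eq in_coset scaleC_compact)
  then show ?thesis
    unfolding csa_quotient_def csa_coset_eq cstar.simps operator_algebra_simps by (rule UN_coset1)
qed

lemma coset_clinear: "u \<in> coset x \<Longrightarrow> is_clinear x \<Longrightarrow> is_clinear u"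
  using is_clinear_add[of x "u - x"] by (simp add: in_coset is_clinear_compact)

lemma quotient_mult:
  assumes "is_clinear x" "is_clinear y"
  shows "csa_mult (compact_quotient M) (coset x) (coset y) = coset (x o\<^sub>L y)"
proof -
  have "coset (u o\<^sub>L v) = coset (x o\<^sub>L y)" if u: "u \<in> coset x" and v: "v \<in> coset y" for u v
  proof -
    have "(u o\<^sub>L v) - (x o\<^sub>L y) = (u o\<^sub>L (v - y)) + ((u - x) o\<^sub>L y)"
      by (simp add: blinfun_compose.diff_left blinfun_compose.diff_right)
    moreover have "u o\<^sub>L (v - y) \<in> compact_operators" "(u - x) o\<^sub>L y \<in> compact_operators"
      using u v assms coset_clinear[OF u]
      by (auto simp: in_coset intro: compose_compact_left compose_compact_right)
    ultimately show ?thesis by (simp add: coset_eq subspace_add subspace_compact_operators)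
  qed
  then show ?thesis
    unfolding csa_quotient_def csa_coset_eq cstar.simps operator_algebra_simps by (rule UN_coset2)
qed

lemma quotient_star:
  assumes "is_clinear x"
  shows "csa_star (compact_quotient M) (coset x) = coset (adj x)"
proof -
  have "coset (adj u) = coset (adj x)" if u: "u \<in> coset x" for u
    using adj_compact[of "u - x"] u coset_clinear[OF u assms] assms
    by (simp add: coset_eq in_coset adj_diff)
  then show ?thesis
    unfolding csa_quotient_def csa_coset_eq cstar.simps operator_algebra_simps by (rule UN_coset1)
qed

lemma quotient_diff:
  "csa_add (compact_quotient M) (coset x) (csa_scale (compact_quotient M) (-1) (coset y)) = coset (x - y)"
  by (simp add: quotient_scale quotient_add scaleC_op_minus_one)

lemma quotient_norm_le: "csa_norm (compact_quotient M) (coset x) \<le> norm x"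
  by (simp add: csa_quotient_def)
     (rule cInf_lower, auto intro: coset_self simp: bdd_below_def intro!: exI[of _ 0])

lemma quotient_norm_less:
  assumes "csa_norm (compact_quotient M) (coset x) < e"
  shows "\<exists>k\<in>compact_operators. norm (x - k) < e"
proof -
  have "Inf (norm ` coset x) < e" using assms by (simp add: csa_quotient_def)
  then obtain u where u: "u \<in> coset x" "norm u < e"
    using cInf_lessD[of "norm ` coset x" e] coset_self[of x] by auto
  have "x - u \<in> compact_operators"
    using u(1) subspace_neg[OF subspace_compact_operators, of "u - x"] by (simp add: in_coset)
  then show ?thesis using u(2) by (intro bexI[of _ "x - u"]) auto
qed

section \<open>The quotient is generated by abelian elements\<close>

text \<open>
  Every element \<open>x\<^sup>* y x\<close> with \<open>x = b p\<^sub>S\<close> lies in the corner at \<open>p\<^sub>S\<close>. A limit of such elements in the quotient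
  is represented by a limit of operators that differ from corner elements by compact operators.
\<close>

lemma abelian_coset:
  fixes S A :: "'g::group_add set"
  assumes S: "thin S" and b: "b \<in> roe" and M: "b o\<^sub>L proj S \<in> roe_ideal_set A"
  shows "abelian_element (compact_quotient (roe_ideal_set A)) (coset (b o\<^sub>L proj S))"
proof -
  let ?M = "roe_ideal_set A"
  let ?Q = "compact_quotient ?M" and ?x = "b o\<^sub>L proj S"
  have Mroe: "y \<in> roe" if "y \<in> ?M" for y using that roe_ideal_set_subset by blast
  have cl: "is_clinear y" if "y \<in> ?M" for y using that Mroe roe_clinear by blast
  have clx: "is_clinear ?x" using M by (rule cl)
  have ess: "u \<in> essentially_diagonal" if u: "u \<in> ?M" and her: "coset u \<in> hereditary_of ?Q (coset ?x)" for u
  proof -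
    have sub: "subspace (essentially_diagonal :: ('g ell2 \<Rightarrow>\<^sub>L 'g ell2) set)"
      "closed (essentially_diagonal :: ('g ell2 \<Rightarrow>\<^sub>L 'g ell2) set)"
      by (simp_all add: essentially_diagonal_def subspace_closure_span)
    have Ksub: "k \<in> essentially_diagonal" if "k \<in> compact_operators" for k :: "'g ell2 \<Rightarrow>\<^sub>L 'g ell2"
      unfolding essentially_diagonal_def by (rule subsetD[OF closure_span_superset]) (use that in simp)
    have "\<exists>w\<in>essentially_diagonal. dist w u < e" if e: "e > 0" for e
    proof -
      obtain Y where Y: "Y \<in> coset ` ?M"
        and less: "csa_norm ?Q (csa_add ?Q (coset u) (csa_scale ?Q (-1)
          (csa_mult ?Q (csa_mult ?Q (csa_star ?Q (coset ?x)) Y) (coset ?x)))) < e"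
        using her e unfolding hereditary_of_def csa_closure_def quotient_carrier by blast
      obtain y where y: "y \<in> ?M" "Y = coset y" using Y by blast
      define w where "w = adj ?x o\<^sub>L y o\<^sub>L ?x"
      have "csa_mult ?Q (csa_mult ?Q (csa_star ?Q (coset ?x)) Y) (coset ?x) = coset w"
        by (simp add: y quotient_star quotient_mult clx cl is_clinear_adj is_clinear_compose w_def)
      then have "csa_norm ?Q (coset (u - w)) < e" using less by (simp add: quotient_diff)
      then obtain k where k: "k \<in> compact_operators" "norm (u - w - k) < e"
        using quotient_norm_less by blast
      have "w = proj S o\<^sub>L (adj b o\<^sub>L y o\<^sub>L b) o\<^sub>L proj S"
        by (simp add: w_def adj_compose roe_clinear b is_clinear_proj adj_proj compose_assoc)
      then have "w \<in> essentially_diagonal"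
        using corner_essentially_diagonal[OF S, of "adj b o\<^sub>L y o\<^sub>L b"] b Mroe[OF y(1)]
        by (simp add: roe_compose roe_adj)
      then have "w + k \<in> essentially_diagonal" by (rule subspace_add[OF sub(1) _ Ksub[OF k(1)]])
      moreover have "dist (w + k) u < e" using k(2) by (simp add: dist_norm norm_minus_commute algebra_simps)
      ultimately show ?thesis by blast
    qed
    then have "u \<in> closure essentially_diagonal" by (simp add: closure_approachable)
    then show ?thesis using sub(2) by simp
  qed
  show ?thesis
    unfolding abelian_element_def
  proof (intro conjI ballI)
    show "coset ?x \<in> csa_carrier ?Q" using M by (simp add: quotient_carrier)
    fix U V assume U: "U \<in> hereditary_of ?Q (coset ?x)" and V: "V \<in> hereditary_of ?Q (coset ?x)"
    have "U \<in> coset ` ?M" "V \<in> coset ` ?M"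
      using U V unfolding hereditary_of_def csa_closure_def quotient_carrier by auto
    then obtain u v where u: "u \<in> ?M" "U = coset u" and v: "v \<in> ?M" "V = coset v" by blast
    have "(u o\<^sub>L v) - (v o\<^sub>L u) \<in> compact_operators"
      by (rule commutator_essentially_diagonal) (use ess U V u v in auto)
    then show "csa_mult ?Q U V = csa_mult ?Q V U"
      by (simp add: u v quotient_mult cl coset_eq)
  qed
qed

text \<open>
  A subalgebra containing the abelian elements contains \<open>b p\<^sub>S\<close> and \<open>(c\<^sup>* p\<^sub>S)\<^sup>*\<close>, hence their product \<open>b p\<^sub>S c\<close>.
\<close>

theorem quotient_type_I0:
  assumes fin: "finite \<S>" and thin: "\<forall>S\<in>\<S>. thin S" and A: "A = \<Union>\<S>"
  shows "type_I0 (compact_quotient (roe_ideal_set A))"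
proof -
  let ?M = "roe_ideal_set A"
  let ?Q = "compact_quotient ?M"
  have alg: "?M \<subseteq> Collect is_clinear" "subspace ?M" "closed ?M" "\<And>c a. a \<in> ?M \<Longrightarrow> scaleC_op c a \<in> ?M"
    "\<And>a b. a \<in> ?M \<Longrightarrow> b \<in> ?M \<Longrightarrow> a o\<^sub>L b \<in> ?M" "\<And>a. a \<in> ?M \<Longrightarrow> adj a \<in> ?M"
    using roe_ideal_set_algebra[of A] unfolding closed_star_algebra_def by blast+
  have cl: "is_clinear a" if "a \<in> ?M" for a using that alg(1) by blast
  have sub: "cstar_subalgebra ?Q (csa_carrier ?Q)"
    unfolding cstar_subalgebra_def
    by (auto simp: quotient_carrier quotient_zero quotient_add quotient_scale quotient_mult
        quotient_star cl csa_closure_def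
        intro!: imageI alg subspace_0[OF alg(2)] subspace_add[OF alg(2)])
  have "coset x \<in> T"
    if T: "cstar_subalgebra ?Q T" and ab: "{x. abelian_element ?Q x} \<subseteq> T" and x: "x \<in> ?M" for T x
  proof -
    note T' = T[unfolded cstar_subalgebra_def]
    have half: "coset (b o\<^sub>L proj S) \<in> T" "b o\<^sub>L proj S \<in> ?M" if "b \<in> roe" "S \<in> \<S>" for b S
    proof -
      show bS: "b o\<^sub>L proj S \<in> ?M"
        using that A by (intro roe_ideal_set_compose(1) proj_subset_in_roe_ideal_set) auto
      show "coset (b o\<^sub>L proj S) \<in> T"
        using abelian_coset[OF _ that(1) bS] thin that(2) ab by blast
    qed
    have gen: "coset a \<in> T" if "a \<in> sandwiches \<S>" for a
    proof -
      obtain b S c where a: "a = b o\<^sub>L proj S o\<^sub>L c" "b \<in> roe" "S \<in> \<S>" "c \<in> roe"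
        using \<open>a \<in> sandwiches \<S>\<close> by (auto simp: sandwiches_def)
      let ?l = "b o\<^sub>L proj S" and ?r = "adj c o\<^sub>L proj S"
      note l = half[OF a(2,3)] and r = half[OF roe_adj[OF a(4)] a(3)]
      have "a = b o\<^sub>L (proj S o\<^sub>L proj S) o\<^sub>L c" by (simp add: a proj_proj)
      also have "\<dots> = ?l o\<^sub>L adj ?r"
        by (simp add: compose_assoc adj_compose adj_adj roe_clinear is_clinear_adj a is_clinear_proj adj_proj)
      finally have "coset a = csa_mult ?Q (coset ?l) (csa_star ?Q (coset ?r))"
        using cl[OF l(2)] cl[OF r(2)] by (simp add: quotient_star quotient_mult is_clinear_adj)
      then show ?thesis using T' l(1) r(1) by simp
    qed
    have span: "coset y \<in> T" if "y \<in> span (sandwiches \<S>)" for y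
      using that
    proof (induction rule: span_induct_alt)
      case base
      then show ?case using T' by (simp add: quotient_zero)
    next
      case (step c a y)
      have "coset (c *\<^sub>R a + y) = csa_add ?Q (csa_scale ?Q (of_real c) (coset a)) (coset y)"
        by (simp add: quotient_add quotient_scale scaleC_op_scaleR)
      then show ?case using T' gen[OF step(1)] step(2) by simp
    qed
    have "x \<in> closure (span (sandwiches \<S>))" using roe_ideal_set_span[OF fin A] x by blast
    then have approx: "\<exists>y\<in>span (sandwiches \<S>). norm (x - y) < e" if "e > 0" for e
      using that by (auto simp: closure_approachable dist_norm norm_minus_commute)
    have "\<exists>Y\<in>T. csa_norm ?Q (csa_add ?Q (coset x) (csa_scale ?Q (-1) Y)) < e" if e: "e > 0" for e
    proof -
      obtain y where y: "y \<in> span (sandwiches \<S>)" "norm (x - y) < e" using approx[OF e] by blast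
      then have "csa_norm ?Q (csa_add ?Q (coset x) (csa_scale ?Q (-1) (coset y))) < e"
        unfolding quotient_diff by (intro le_less_trans[OF quotient_norm_le])
      then show ?thesis using span[OF y(1)] by blast
    qed
    then have "coset x \<in> csa_closure ?Q T"
      using x by (simp add: csa_closure_def quotient_carrier)
    then show ?thesis using T' by blast
  qed
  then have "csa_carrier ?Q \<subseteq> cstar_generated ?Q {x. abelian_element ?Q x}"
    unfolding cstar_generated_def quotient_carrier by blast
  moreover have "cstar_generated ?Q {x. abelian_element ?Q x} \<subseteq> csa_carrier ?Q"
    unfolding cstar_generated_def using sub by (intro Inter_lower) (auto simp: abelian_element_def)
  ultimately show ?thesis unfolding type_I0_def by blast
qed

section \<open>Irreducible representations of the ideal\<close>

text \<open>
  The case distinction is whether the representation detects a single point of \<open>S\<close>. If not, it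
  annihilates the finitely many rows that carry the off-diagonal part of the corner at \<open>p\<^sub>S\<close>.
\<close>

theorem roe_ideal_irreducible_compacts:
  fixes \<pi> :: "('g::group_add ell2 \<Rightarrow>\<^sub>L 'g ell2) \<Rightarrow> ('h::complex_hilbert_space \<Rightarrow>\<^sub>L 'h)"
  assumes fin: "finite \<S>" and thin: "\<forall>S\<in>\<S>. thin S" and A: "A = \<Union>\<S>"
    and irr: "irreducible_representation (operator_algebra (roe_ideal_set A)) \<pi>"
  shows "compact_operators \<subseteq> \<pi> ` roe_ideal_set A"
proof -
  let ?M = "roe_ideal_set A"
  interpret irreducible_operator_representation ?M \<pi>
    using irr roe_ideal_set_algebra[of A]
    by unfold_locales (simp_all add: irreducible_representation_def)
  have zero_sub: "subspace {0::'h \<Rightarrow>\<^sub>L 'h}" "closed {0::'h \<Rightarrow>\<^sub>L 'h}" by (simp_all add: subspace_def)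
  have Mroe: "y \<in> roe" if "y \<in> ?M" for y using that roe_ideal_set_subset by blast
  have projM: "proj V \<in> ?M" if "V \<subseteq> A" for V using that by (rule proj_subset_in_roe_ideal_set)
  have "\<exists>S\<in>\<S>. \<pi> (proj S) \<noteq> 0"
  proof (rule ccontr)
    assume none: "\<not> (\<exists>S\<in>\<S>. \<pi> (proj S) \<noteq> 0)"
    have gen0: "\<pi> a \<in> {0}" if "a \<in> sandwiches \<S>" for a
    proof -
      obtain b S c where a: "a = b o\<^sub>L proj S o\<^sub>L c" "b \<in> roe" "S \<in> \<S>" "c \<in> roe"
        using \<open>a \<in> sandwiches \<S>\<close> by (auto simp: sandwiches_def)
      have S: "proj S \<in> ?M" using a(3) A by (intro projM) blast
      have "a = (b o\<^sub>L proj S) o\<^sub>L proj S o\<^sub>L (proj S o\<^sub>L c)"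
      proof -
        have "(b o\<^sub>L proj S) o\<^sub>L proj S o\<^sub>L (proj S o\<^sub>L c)
            = b o\<^sub>L ((proj S o\<^sub>L proj S) o\<^sub>L proj S) o\<^sub>L c" by (simp only: compose_assoc)
        then show ?thesis by (simp add: a proj_proj)
      qed
      moreover have "b o\<^sub>L proj S \<in> ?M" "proj S o\<^sub>L c \<in> ?M"
        using S a by (auto intro: roe_ideal_set_compose)
      ultimately show ?thesis using none a(3) S by (simp add: pi_compose compose_in)
    qed
    have "\<pi> x \<in> {0}" if x: "x \<in> ?M" for x
      using pi_closure_span[OF sandwiches_in_roe_ideal_set[OF A] _ zero_sub gen0, of x]
        roe_ideal_set_span[OF fin A] x by blast
    then show False using nontrivial by blast
  qed
  then obtain S where S: "S \<in> \<S>" "\<pi> (proj S) \<noteq> 0" by blast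
  have SA: "S \<subseteq> A" and tS: "thin S" using S(1) A thin by auto
  show ?thesis
  proof (cases "\<exists>x\<in>S. \<pi> (proj {x}) \<noteq> 0")
    case True
    then obtain x where x: "x \<in> S" "\<pi> (proj {x}) \<noteq> 0" by blast
    have xM: "proj {x} \<in> ?M" using x(1) SA by (intro projM) auto
    show ?thesis
    proof (rule compacts_in_range[OF xM adj_proj _ x(2)])
      show "proj {x} o\<^sub>L proj {x} = proj {x}" by (simp add: proj_proj)
      fix a assume a: "a \<in> ?M"
      have "proj {x} o\<^sub>L a o\<^sub>L proj {x} = scaleC_op (cinner (delta x) (a (delta x))) (proj {x})"
        unfolding proj_singleton
        by (rule blinfun_eqI)
           (simp add: rank_one_apply scaleC_op_apply is_clinearD[OF clinear[OF a]]
             cinner_scaleC_right scaleC_scaleC mult.commute)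
      then show "\<exists>c. \<pi> (proj {x} o\<^sub>L a o\<^sub>L proj {x}) = scaleC_op c (\<pi> (proj {x}))"
        using pi_scaleC[OF xM] by metis
    qed
  next
    case points: False
    let ?e = "proj S"
    have eM: "?e \<in> ?M" using SA by (rule projM)
    \<comment> \<open>used with the commutant of a projection, then with the scalar multiples of \<open>\<pi>(p\<^sub>S)\<close>\<close>
    have corner: "\<pi> (?e o\<^sub>L a o\<^sub>L ?e) \<in> N"
      if N: "subspace N" "closed N" and a: "a \<in> ?M"
        and diag: "\<And>h. bounded (range h) \<Longrightarrow> (\<And>x. x \<notin> S \<Longrightarrow> h x = 0) \<Longrightarrow> mult_op h \<in> ?M \<Longrightarrow> \<pi> (mult_op h) \<in> N"
      for N a
    proof -
      let ?W = "(\<lambda>w. ?e o\<^sub>L w o\<^sub>L ?e) ` weighted_translations"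
      have Wroe: "w \<in> roe" if "w \<in> weighted_translations" for w :: "'g ell2 \<Rightarrow>\<^sub>L 'g ell2"
        unfolding roe_eq by (rule subsetD[OF closure_span_superset that])
      have "?e o\<^sub>L a o\<^sub>L ?e \<in> closure (span ?W)"
      proof (rule closure_span_image[OF bounded_linear_corner _ subspace_closure_span closed_closure
            Mroe[OF a, unfolded roe_eq]])
        fix w :: "'g ell2 \<Rightarrow>\<^sub>L 'g ell2" assume "w \<in> weighted_translations"
        then show "?e o\<^sub>L w o\<^sub>L ?e \<in> closure (span ?W)"
          by (intro subsetD[OF closure_span_superset] imageI)
      qed
      moreover have WM: "?W \<subseteq> ?M"
      proof (rule image_subsetI)
        fix w :: "'g ell2 \<Rightarrow>\<^sub>L 'g ell2" assume "w \<in> weighted_translations"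
        then show "?e o\<^sub>L w o\<^sub>L ?e \<in> ?M"
          by (intro roe_ideal_set_compose(2)[OF _ proj_in_roe] roe_ideal_set_compose(2)[OF eM] Wroe)
      qed
      moreover have "\<pi> E \<in> N" if "E \<in> ?W" for E
      proof -
        obtain f g where f: "bounded (range f)" and E: "E = ?e o\<^sub>L (mult_op f o\<^sub>L left_translation g) o\<^sub>L ?e"
          using \<open>E \<in> ?W\<close> by (auto simp: weighted_translations_def)
        have EM: "E \<in> ?M" using \<open>E \<in> ?W\<close> WM by blast
        show ?thesis
        proof (cases "g = 0")
          case True
          then have "E = mult_op (\<lambda>x. indicator S x * f x)" using E corner_diagonal[OF f] by simp
          then show ?thesis
            using diag[OF bounded_range_mult[OF bounded_range_indicator f]] EM by simp
        next
          case False
          obtain F where F: "finite F" "F \<subseteq> S" "E = (\<Sum>x\<in>F. proj {x} o\<^sub>L E)"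
            using corner_off_diagonal[OF tS f False] unfolding E[symmetric] by blast
          have xM: "proj {x} \<in> ?M" if "x \<in> F" for x using that F(2) SA by (intro projM) auto
          have "(\<Sum>x\<in>F. proj {x} o\<^sub>L E) \<in> closure (span ((\<lambda>x. proj {x} o\<^sub>L E) ` F))"
            by (intro subsetD[OF closure_subset] span_sum span_base imageI)
          then have span: "E \<in> closure (span ((\<lambda>x. proj {x} o\<^sub>L E) ` F))"
            unfolding F(3)[symmetric] .
          have "\<pi> E \<in> {0}"
          proof (rule pi_closure_span[OF _ span zero_sub])
            show "(\<lambda>x. proj {x} o\<^sub>L E) ` F \<subseteq> ?M" using xM EM by (auto intro: compose_in)
            show "\<pi> b \<in> {0}" if b: "b \<in> (\<lambda>x. proj {x} o\<^sub>L E) ` F" for b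
            proof -
              obtain x where x: "x \<in> F" "b = proj {x} o\<^sub>L E" using b by blast
              have "\<pi> (proj {x}) = 0" using points x(1) F(2) by blast
              then show ?thesis using xM[OF x(1)] EM by (simp add: x(2) pi_compose)
            qed
          qed
          then show ?thesis using subspace_0[OF N(1)] by simp
        qed
      qed
      ultimately show ?thesis using pi_closure_span[OF _ _ N, of ?W "?e o\<^sub>L a o\<^sub>L ?e"] by blast
    qed
    have sub: "\<pi> (proj B) = 0 \<or> \<pi> (proj B) = \<pi> ?e" if B: "B \<subseteq> S" for B
    proof -
      have BM: "proj B \<in> ?M" using B SA by (intro projM) auto
      have SB: "S \<inter> B = B" "B \<inter> S = B" using B by auto
      have lin: "bounded_linear (\<lambda>T. (\<pi> (proj B) o\<^sub>L T) - (T o\<^sub>L \<pi> (proj B)))"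
        by (intro bounded_linear_sub blinfun_compose.bounded_linear_left
            blinfun_compose.bounded_linear_right)
      let ?N = "(\<lambda>T. (\<pi> (proj B) o\<^sub>L T) - (T o\<^sub>L \<pi> (proj B))) -` {0}"
      have N: "subspace ?N" "closed ?N"
        by (rule linear_subspace_vimage[OF bounded_linear.linear[OF lin] zero_sub(1)],
            intro closed_vimage zero_sub linear_continuous_on lin)
      show ?thesis
      proof (rule commuting_subprojection[OF eM BM])
        show "proj B o\<^sub>L proj B = proj B" "?e o\<^sub>L proj B = proj B" "proj B o\<^sub>L ?e = proj B"
          by (simp_all add: proj_proj SB)
        fix a assume a: "a \<in> ?M"
        have "\<pi> (?e o\<^sub>L a o\<^sub>L ?e) \<in> ?N"
        proof (rule corner[OF N a])
          fix h :: "'g \<Rightarrow> complex" assume h: "bounded (range h)" and hM: "mult_op h \<in> ?M"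
          have "proj B o\<^sub>L mult_op h = mult_op h o\<^sub>L proj B"
            by (simp add: proj_def mult_op_compose h bounded_range_indicator mult.commute)
          then show "\<pi> (mult_op h) \<in> ?N" using pi_compose[OF BM hM] pi_compose[OF hM BM] by simp
        qed
        then show "\<pi> (proj B) o\<^sub>L \<pi> (?e o\<^sub>L a o\<^sub>L ?e) = \<pi> (?e o\<^sub>L a o\<^sub>L ?e) o\<^sub>L \<pi> (proj B)" by simp
      qed
    qed
    let ?L = "{scaleC_op c (\<pi> ?e) | c. True}"
    show ?thesis
    proof (rule compacts_in_range[OF eM adj_proj _ S(2)])
      show "?e o\<^sub>L ?e = ?e" by (simp add: proj_proj)
      fix a assume a: "a \<in> ?M"
      have "\<pi> (?e o\<^sub>L a o\<^sub>L ?e) \<in> ?L"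
      proof (rule corner[OF complex_line_closed_subspace a])
        fix h :: "'g \<Rightarrow> complex" assume h: "bounded (range h)" "\<And>x. x \<notin> S \<Longrightarrow> h x = 0"
        show "\<pi> (mult_op h) \<in> ?L"
        proof (rule pi_closure_span[OF _ diagonal_simple_approx[OF h] complex_line_closed_subspace])
          show "{scaleC_op c (proj B) | c B. B \<subseteq> S} \<subseteq> ?M" using SA by (auto intro!: scaleC_in projM)
          fix b assume "b \<in> {scaleC_op c (proj B) | c B. B \<subseteq> S}"
          then obtain c B where b: "b = scaleC_op c (proj B)" "B \<subseteq> S" by blast
          have "\<pi> b = scaleC_op c (\<pi> (proj B))" using b SA by (auto intro!: pi_scaleC projM)
          moreover have "scaleC_op c (0 :: 'h \<Rightarrow>\<^sub>L 'h) = scaleC_op 0 (\<pi> ?e)"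
            by (rule blinfun_eqI) (simp add: scaleC_op_apply)
          ultimately show "\<pi> b \<in> ?L" using sub[OF b(2)] by auto
        qed
      qed
      then show "\<exists>c. \<pi> (?e o\<^sub>L a o\<^sub>L ?e) = scaleC_op c (\<pi> ?e)" by blast
    qed
  qed
qed

theorem proposition4p5:
  fixes d :: "'g::{group_add,countable} \<Rightarrow> 'g \<Rightarrow> real"
    and A :: "'g set"
    and \<S> :: "'g set set"
  assumes "proper_right_invariant_metric d"
    and "A \<noteq> {}"
    and "finite \<S>" and "\<forall>S\<in>\<S>. sparse_metric_space S d" and "A = \<Union>\<S>"
  shows "type_I0 (csa_quotient (roe_ideal A) compact_operators) \<and>
         type_I TYPE('h::complex_hilbert_space) (roe_ideal A)"
proof
  have thin: "\<forall>S\<in>\<S>. thin S" using assms(1,4) sparse_imp_thin by blast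
  show "type_I0 (csa_quotient (roe_ideal A) compact_operators)"
    unfolding roe_ideal_eq by (rule quotient_type_I0[OF assms(3) thin assms(5)])
  show "type_I TYPE('h) (roe_ideal A)"
    unfolding type_I_def roe_ideal_eq operator_algebra_simps
    using roe_ideal_irreducible_compacts[OF assms(3) thin assms(5)] by blast
qed

end
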